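(* Let $A$ be a $\mathcal{U}(\mathfrak{h}_3(\mathbb{R}))$-module algebra and let $\theta\in\Theta$. For $n\in\mathbb{Z}$ let $E_n:=A_n[[\nu]]$. 1. $A_0^\theta=(A_0[[\nu]],\ast_\theta)$ is an associative unital subalgebra of $A^\theta=(A[[\nu]],\ast_\theta)$. 2. For every $n\in\mathbb{Z}$, $E_n$ is an $A_0^{\alpha_n(\theta)}$-$A_0^\theta$-bimodule, with left module structure given by $\ast_{\alpha_n(\theta)}$ and right module structure given by $\ast_\theta$. 3. For all $j,k\in\mathbb{Z}$, the map $\ast_\theta:E_j\otimes E_k\to E_{j+k}$ descends to a map $E_j\otimes_{A_0^\theta}E_k\to E_{j+k}$, where the right module structure of $E_j$ and the left module structure of $E_k$ over $A_0^\theta$ are given by $\ast_\theta$. 4. For all $m,n,p\in\mathbb{Z}$ and $\theta'=\alpha_n(\theta)$, the diagram with the two paths $$E_m\otimes_{A_0^{\theta'}}E_n\otimes_{A_0^\theta}E_p\xrightarrow{\ \mathrm{id}\otimes\ast_\theta\ }E_m\otimes_{A_0^{\theta'}}E_{n+p}\xrightarrow{\ \ast_{\theta'}\ }E_{m+n+p}$$ and $$E_m\otimes_{A_0^{\theta'}}E_n\otimes_{A_0^\theta}E_p\xrightarrow{\ \ast_{\theta'}\otimes\mathrm{id}\ }E_{m+n}\otimes_{A_0^\theta}E_p\xrightarrow{\ \ast_\theta\ }E_{m+n+p}$$ commutes, i.e. the two compositions coincide. (Here module structures over $A_0^{\theta'}$ are given by $\ast_{\theta'}$ and those over $A_0^\theta$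 by $\ast_\theta$.)
   Context: $\mathfrak{h}_3(\mathbb{R})$ is the 3-dimensional Heisenberg Lie algebra with basis $\mathfrak{p},\mathfrak{q},\mathfrak{t}$, where $\mathfrak{t}$ is central and $[\mathfrak{p},\mathfrak{q}]=\mathfrak{t}$; $\mathcal{U}(\mathfrak{h}_3(\mathbb{R}))$ is its universal enveloping algebra with the standard Hopf algebra structure (elements of the Lie algebra are primitive). A $\mathcal{U}(\mathfrak{h}_3(\mathbb{R}))$-module algebra is a unital associative complex algebra $A$, with multiplication $m:A\otimes A\to A$, on which $\mathfrak{h}_3(\mathbb{R})$ acts by ($\mathbb{C}$-linear) derivations. For $n\in\mathbb{Z}$ put $A_n:=\{a\in A:\mathfrak{t}.a=na\}$; since $\mathfrak{t}$ is central, each $A_n$ is stable under $\mathfrak{p},\mathfrak{q}$. $\Theta:=\nu\,\mathbb{C}[[\nu]]$, and $\alpha_k(\theta):=\frac{\theta}{1+k\theta}=\theta-k\theta^2+\cdots\in\Theta$ for $k\in\mathbb{Z}$, $\theta\in\Theta$. For $\theta\in\Theta$ set $F_\theta:=\exp\{\theta\,\mathfrak{p}\otimes\mathfrak{q}\}$ and define the $\mathbb{C}[[\nu]]$-bilinear (in general non-associative) product on $A[[\nu]]$ by $a\ast_\theta b:=m\circ F_\theta^{-1}(a\otimes b)=\sum_{j\ge 0}\frac{(-\theta)^j}{j!}(\mathfrak{p}^j.a)(\mathfrak{q}^j.b)$ (with $m$ and the action extended $\mathbb{C}[[\nu]]$-linearly). It maps $A_j[[\nu]]\times A_k[[\nu]]$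 into $A_{j+k}[[\nu]]$. Unlabelled tensor products are over $\mathbb{C}[[\nu]]$ (completed in the $\nu$-adic topology). *)

theory Defs
  imports
    "HOL-Algebra.Algebra"
    "HOL-Algebra.Algebraic_Closure_Type"
    "HOL-Computational_Algebra.Formal_Power_Series"
    "HOL-Analysis.Product_Vector"
begin

section \<open>Module algebras of the Heisenberg Lie algebra\<close>

text \<open>The triple \<open>(a, b, c)\<close> stands for \<open>a p + b q + c t\<close>, where \<open>[p, q] = t\<close> and \<open>t\<close> is central.\<close>

type_synonym heis = "real \<times> real \<times> real"

definition heis_p :: heis where "heis_p = (1, 0, 0)"
definition heis_q :: heis where "heis_q = (0, 1, 0)"
definition heis_t :: heis where "heis_t = (0, 0, 1)"

definition heis_bracket :: "heis \<Rightarrow> heis \<Rightarrow> heis" where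
  "heis_bracket = (\<lambda>(a, b, c) (a', b', c'). (0, 0, a * b' - b * a'))"

text \<open>The algebra is a type of class \<open>ring\<close> with an explicit unit, so that the zero algebra is
  not excluded (as it would be by \<open>ring_1\<close>).\<close>

record 'a heis_algebra =
  scal :: "complex \<Rightarrow> 'a \<Rightarrow> 'a"
  unity :: 'a
  act :: "heis \<Rightarrow> 'a \<Rightarrow> 'a"

locale heisenberg_module_algebra =
  fixes H :: "'a::ring heis_algebra"
  assumes vector_space: "vector_space (scal H)"
    and scal_mult_left: "scal H c a * b = scal H c (a * b)"
    and scal_mult_right: "a * scal H c b = scal H c (a * b)"
    and unity_left: "unity H * a = a"
    and unity_right: "a * unity H = a"
    and act_linear: "Vector_Spaces.linear (scal H) (scal H) (act H x)"
    and act_derivation: "act H x (a * b) = act H x a * b + a * act H x b"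
    and act_add: "act H (x + y) a = act H x a + act H y a"
    and act_scaleR: "act H (r *\<^sub>R x) a = scal H (complex_of_real r) (act H x a)"
    and act_bracket: "act H (heis_bracket x y) a = act H x (act H y a) - act H y (act H x a)"

definition weight_space :: "'a::ring heis_algebra \<Rightarrow> int \<Rightarrow> 'a set" where
  "weight_space H n = {a. act H heis_t a = scal H (of_int n) a}"


section \<open>Formal power series and the star products\<close>

text \<open>\<open>A[[\<nu>]]\<close> is \<open>'a fps\<close>, with \<open>\<nu>\<close> the variable \<open>fps_X\<close>; the library metric on \<open>'a fps\<close> induces
  the \<open>\<nu>\<close>-adic topology.\<close>

abbreviation formal_scalars :: "complex fps ring" where
  "formal_scalars \<equiv> ring_of_type_algebra"

definition Theta :: "complex fps set" where
  "Theta = range (\<lambda>c. fps_X * c)"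

definition alpha :: "int \<Rightarrow> complex fps \<Rightarrow> complex fps" where
  "alpha k \<theta> = \<theta> / (1 + of_int k * \<theta>)"

definition series_scal :: "'a::ring heis_algebra \<Rightarrow> complex fps \<Rightarrow> 'a fps \<Rightarrow> 'a fps" where
  "series_scal H c a =
    Abs_fps (\<lambda>n. \<Sum>i=0..n. scal H (fps_nth c i) (fps_nth a (n - i)))"

definition series_act :: "'a::ring heis_algebra \<Rightarrow> heis \<Rightarrow> 'a fps \<Rightarrow> 'a fps" where
  "series_act H x a = Abs_fps (\<lambda>n. act H x (fps_nth a n))"

text \<open>The series converges \<open>\<nu>\<close>-adically for \<open>\<theta> \<in> Theta\<close>.\<close>

definition star :: "'a::ring heis_algebra \<Rightarrow> complex fps \<Rightarrow> 'a fps \<Rightarrow> 'a fps \<Rightarrow> 'a fps" where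
  "star H \<theta> a b =
    suminf (\<lambda>j. series_scal H (fps_const (1 / fact j) * (- \<theta>) ^ j)
      ((series_act H heis_p ^^ j) a * (series_act H heis_q ^^ j) b))"

definition star_algebra ::
    "'a::ring heis_algebra \<Rightarrow> complex fps \<Rightarrow> (complex fps, 'a fps) module" where
  "star_algebra H \<theta> =
    \<lparr>carrier = UNIV, monoid.mult = star H \<theta>, one = fps_const (unity H),
     ring.zero = 0, add = (+), module.smult = series_scal H\<rparr>"

definition weight_series :: "'a::ring heis_algebra \<Rightarrow> int \<Rightarrow> 'a fps set" where
  "weight_series H n = {a. \<forall>i. fps_nth a i \<in> weight_space H n}"

text \<open>\<open>E_n\<close> is only used as a \<open>\<complex>[[\<nu>]]\<close>-module: the \<open>mult\<close> and \<open>one\<close> fields of the record, hence the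
  deformation parameter \<open>0\<close>, play no role.\<close>

definition E_module :: "'a::ring heis_algebra \<Rightarrow> int \<Rightarrow> (complex fps, 'a fps) module" where
  "E_module H n = (star_algebra H 0)\<lparr>carrier := weight_series H n\<rparr>"

definition A0_algebra ::
    "'a::ring heis_algebra \<Rightarrow> complex fps \<Rightarrow> (complex fps, 'a fps) module" where
  "A0_algebra H \<theta> = (star_algebra H \<theta>)\<lparr>carrier := weight_series H 0\<rparr>"


section \<open>Algebras and bimodules over a commutative ring\<close>

text \<open>Associativity is not assumed here.\<close>

locale unital_algebra = module K A for K and A (structure) +
  assumes mult_closed: "\<lbrakk>x \<in> carrier A; y \<in> carrier A\<rbrakk> \<Longrightarrow> x \<otimes> y \<in> carrier A"
    and one_closed: "\<one> \<in> carrier A"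
    and mult_add_left: "\<lbrakk>x \<in> carrier A; y \<in> carrier A; z \<in> carrier A\<rbrakk> \<Longrightarrow>
      (x \<oplus> y) \<otimes> z = x \<otimes> z \<oplus> y \<otimes> z"
    and mult_add_right: "\<lbrakk>x \<in> carrier A; y \<in> carrier A; z \<in> carrier A\<rbrakk> \<Longrightarrow>
      x \<otimes> (y \<oplus> z) = x \<otimes> y \<oplus> x \<otimes> z"
    and mult_smult_left: "\<lbrakk>c \<in> carrier K; x \<in> carrier A; y \<in> carrier A\<rbrakk> \<Longrightarrow>
      (c \<odot> x) \<otimes> y = c \<odot> (x \<otimes> y)"
    and mult_smult_right: "\<lbrakk>c \<in> carrier K; x \<in> carrier A; y \<in> carrier A\<rbrakk> \<Longrightarrow>
      x \<otimes> (c \<odot> y) = c \<odot> (x \<otimes> y)"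
    and one_mult: "x \<in> carrier A \<Longrightarrow> \<one> \<otimes> x = x"
    and mult_one: "x \<in> carrier A \<Longrightarrow> x \<otimes> \<one> = x"

definition assoc_unital_subalgebra ::
    "('k, 'r) ring_scheme \<Rightarrow> 'm set \<Rightarrow> ('k, 'm, 'b) module_scheme \<Rightarrow> bool" where
  "assoc_unital_subalgebra K S A \<longleftrightarrow>
    unital_algebra K A \<and> submodule S K A \<and> \<one>\<^bsub>A\<^esub> \<in> S \<and>
    (\<forall>x\<in>S. \<forall>y\<in>S. x \<otimes>\<^bsub>A\<^esub> y \<in> S) \<and>
    (\<forall>x\<in>S. \<forall>y\<in>S. \<forall>z\<in>S. (x \<otimes>\<^bsub>A\<^esub> y) \<otimes>\<^bsub>A\<^esub> z = x \<otimes>\<^bsub>A\<^esub> (y \<otimes>\<^bsub>A\<^esub> z))"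

locale algebra_bimodule =
  fixes K :: "('k, 'r) ring_scheme"
    and A :: "('k, 'a, 's) module_scheme"
    and B :: "('k, 'b, 't) module_scheme"
    and M :: "('k, 'm, 'u) module_scheme" (structure)
    and l :: "'a \<Rightarrow> 'm \<Rightarrow> 'm"
    and r :: "'m \<Rightarrow> 'b \<Rightarrow> 'm"
  assumes left_algebra: "unital_algebra K A" "ring A"
    and right_algebra: "unital_algebra K B" "ring B"
    and module: "module K M"
    and l_closed: "\<lbrakk>a \<in> carrier A; x \<in> carrier M\<rbrakk> \<Longrightarrow> l a x \<in> carrier M"
    and l_add_left: "\<lbrakk>a \<in> carrier A; a' \<in> carrier A; x \<in> carrier M\<rbrakk> \<Longrightarrow>
      l (a \<oplus>\<^bsub>A\<^esub> a') x = l a x \<oplus> l a' x"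
    and l_add_right: "\<lbrakk>a \<in> carrier A; x \<in> carrier M; y \<in> carrier M\<rbrakk> \<Longrightarrow>
      l a (x \<oplus> y) = l a x \<oplus> l a y"
    and l_smult_left: "\<lbrakk>c \<in> carrier K; a \<in> carrier A; x \<in> carrier M\<rbrakk> \<Longrightarrow>
      l (c \<odot>\<^bsub>A\<^esub> a) x = c \<odot> l a x"
    and l_smult_right: "\<lbrakk>c \<in> carrier K; a \<in> carrier A; x \<in> carrier M\<rbrakk> \<Longrightarrow>
      l a (c \<odot> x) = c \<odot> l a x"
    and l_assoc: "\<lbrakk>a \<in> carrier A; a' \<in> carrier A; x \<in> carrier M\<rbrakk> \<Longrightarrow>
      l (a \<otimes>\<^bsub>A\<^esub> a') x = l a (l a' x)"
    and l_one: "x \<in> carrier M \<Longrightarrow> l \<one>\<^bsub>A\<^esub> x = x"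
    and r_closed: "\<lbrakk>b \<in> carrier B; x \<in> carrier M\<rbrakk> \<Longrightarrow> r x b \<in> carrier M"
    and r_add_left: "\<lbrakk>b \<in> carrier B; x \<in> carrier M; y \<in> carrier M\<rbrakk> \<Longrightarrow>
      r (x \<oplus> y) b = r x b \<oplus> r y b"
    and r_add_right: "\<lbrakk>b \<in> carrier B; b' \<in> carrier B; x \<in> carrier M\<rbrakk> \<Longrightarrow>
      r x (b \<oplus>\<^bsub>B\<^esub> b') = r x b \<oplus> r x b'"
    and r_smult_left: "\<lbrakk>c \<in> carrier K; b \<in> carrier B; x \<in> carrier M\<rbrakk> \<Longrightarrow>
      r (c \<odot> x) b = c \<odot> r x b"
    and r_smult_right: "\<lbrakk>c \<in> carrier K; b \<in> carrier B; x \<in> carrier M\<rbrakk> \<Longrightarrow>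
      r x (c \<odot>\<^bsub>B\<^esub> b) = c \<odot> r x b"
    and r_assoc: "\<lbrakk>b \<in> carrier B; b' \<in> carrier B; x \<in> carrier M\<rbrakk> \<Longrightarrow>
      r x (b \<otimes>\<^bsub>B\<^esub> b') = r (r x b) b'"
    and r_one: "x \<in> carrier M \<Longrightarrow> r x \<one>\<^bsub>B\<^esub> = x"
    and bimodule: "\<lbrakk>a \<in> carrier A; b \<in> carrier B; x \<in> carrier M\<rbrakk> \<Longrightarrow>
      r (l a x) b = l a (r x b)"


section \<open>Completed tensor products\<close>

text \<open>A tensor product \<open>T\<close> of \<open>\<complex>[[\<nu>]]\<close>-modules is presented as the free abelian group on \<open>gens\<close>
  (tuples, standing for pure tensors) modulo the subgroup generated by \<open>rels\<close>; a scalar \<open>c\<close> acts on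
  the generators by \<open>gen_scal c\<close>, that is, on the first tensor factor.\<close>

record 'x tensor_presentation =
  gens :: "'x set"
  rels :: "('x \<Rightarrow>\<^sub>0 int) set"
  gen_scal :: "complex fps \<Rightarrow> 'x \<Rightarrow> 'x"

abbreviation free_on :: "'x tensor_presentation \<Rightarrow> ('x \<Rightarrow>\<^sub>0 int) monoid" where
  "free_on P \<equiv> free_Abelian_group (gens P)"

text \<open>\<open>level P k\<close> is the preimage of \<open>\<nu>^k T\<close> in the free abelian group, so that its cosets are the
  elements of \<open>T / \<nu>^k T\<close>.\<close>

definition level :: "'x tensor_presentation \<Rightarrow> nat \<Rightarrow> ('x \<Rightarrow>\<^sub>0 int) set" where
  "level P k =
    generate (free_on P) (rels P \<union> {frag_of (gen_scal P (fps_X ^ k) x) | x. x \<in> gens P})"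

text \<open>The \<open>\<nu>\<close>-adic completion of \<open>T\<close>: the inverse limit of the quotients \<open>T / \<nu>^k T\<close>, whose elements
  are the decreasing sequences of cosets. The \<open>mult\<close> and \<open>one\<close> fields are not used.\<close>

definition completed ::
    "'x tensor_presentation \<Rightarrow> (complex fps, nat \<Rightarrow> ('x \<Rightarrow>\<^sub>0 int) set) module" where
  "completed P =
    \<lparr>carrier = {s. \<forall>k. s k \<in> rcosets\<^bsub>free_on P\<^esub> (level P k) \<and> s (Suc k) \<subseteq> s k},
     monoid.mult = undefined, one = undefined,
     ring.zero = level P,
     add = (\<lambda>s t k. s k <#>\<^bsub>free_on P\<^esub> t k),
     module.smult = (\<lambda>c s k. level P k <#>\<^bsub>free_on P\<^esub> (frag_extend (frag_of \<circ> gen_scal P c) ` s k))\<rparr>"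

definition pure_tensor :: "'x tensor_presentation \<Rightarrow> 'x \<Rightarrow> nat \<Rightarrow> ('x \<Rightarrow>\<^sub>0 int) set" where
  "pure_tensor P x = (\<lambda>k. level P k #>\<^bsub>free_on P\<^esub> frag_of x)"

text \<open>The canonical projection onto \<open>completed P\<close>, from a completed tensor product with the same
  generators and scalar action but fewer relations.\<close>

definition tensor_projection ::
    "'x tensor_presentation \<Rightarrow> (nat \<Rightarrow> ('x \<Rightarrow>\<^sub>0 int) set) \<Rightarrow> nat \<Rightarrow> ('x \<Rightarrow>\<^sub>0 int) set" where
  "tensor_projection P s = (\<lambda>k. level P k <#>\<^bsub>free_on P\<^esub> s k)"

definition series_linear_maps ::
    "(complex fps, 'm, 'b) module_scheme \<Rightarrow> (complex fps, 'n, 'c) module_scheme \<Rightarrow> ('m \<Rightarrow> 'n) set"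
  where
  "series_linear_maps M N = {f \<in> carrier M \<rightarrow>\<^sub>E carrier N.
     (\<forall>x\<in>carrier M. \<forall>y\<in>carrier M. f (x \<oplus>\<^bsub>M\<^esub> y) = f x \<oplus>\<^bsub>N\<^esub> f y) \<and>
     (\<forall>c. \<forall>x\<in>carrier M. f (c \<odot>\<^bsub>M\<^esub> x) = c \<odot>\<^bsub>N\<^esub> f x)}"

text \<open>\<open>\<complex>[[\<nu>]]\<close>-linear maps are automatically continuous for the \<open>\<nu>\<close>-adic topologies, so the maps
  with prescribed values on pure tensors below need no separate continuity requirement.\<close>

definition tensor_maps ::
    "'x tensor_presentation \<Rightarrow> (complex fps, 'n, 'c) module_scheme \<Rightarrow> ('x \<Rightarrow> 'n) \<Rightarrow>
     ((nat \<Rightarrow> ('x \<Rightarrow>\<^sub>0 int) set) \<Rightarrow> 'n) set" where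
  "tensor_maps P N f =
    {\<phi> \<in> series_linear_maps (completed P) N. \<forall>x\<in>gens P. \<phi> (pure_tensor P x) = f x}"

definition tensor2 ::
    "(complex fps, 'm, 'b) module_scheme \<Rightarrow> (complex fps, 'n, 'c) module_scheme \<Rightarrow>
     ('m \<times> 'n) tensor_presentation" where
  "tensor2 M N =
    \<lparr>gens = carrier M \<times> carrier N,
     rels =
       {frag_of (x \<oplus>\<^bsub>M\<^esub> x', y) - frag_of (x, y) - frag_of (x', y) | x x' y.
          x \<in> carrier M \<and> x' \<in> carrier M \<and> y \<in> carrier N} \<union>
       {frag_of (x, y \<oplus>\<^bsub>N\<^esub> y') - frag_of (x, y) - frag_of (x, y') | x y y'.
          x \<in> carrier M \<and> y \<in> carrier N \<and> y' \<in> carrier N} \<union>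
       {frag_of (c \<odot>\<^bsub>M\<^esub> x, y) - frag_of (x, c \<odot>\<^bsub>N\<^esub> y) | c x y.
          x \<in> carrier M \<and> y \<in> carrier N},
     gen_scal = (\<lambda>c (x, y). (c \<odot>\<^bsub>M\<^esub> x, y))\<rparr>"

definition tensor3 ::
    "(complex fps, 'm, 'b) module_scheme \<Rightarrow> (complex fps, 'n, 'c) module_scheme \<Rightarrow>
     (complex fps, 'p, 'd) module_scheme \<Rightarrow> ('m \<times> 'n \<times> 'p) tensor_presentation" where
  "tensor3 M N P =
    \<lparr>gens = carrier M \<times> carrier N \<times> carrier P,
     rels =
       {frag_of (x \<oplus>\<^bsub>M\<^esub> x', y, z) - frag_of (x, y, z) - frag_of (x', y, z) | x x' y z.
          x \<in> carrier M \<and> x' \<in> carrier M \<and> y \<in> carrier N \<and> z \<in> carrier P} \<union>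
       {frag_of (x, y \<oplus>\<^bsub>N\<^esub> y', z) - frag_of (x, y, z) - frag_of (x, y', z) | x y y' z.
          x \<in> carrier M \<and> y \<in> carrier N \<and> y' \<in> carrier N \<and> z \<in> carrier P} \<union>
       {frag_of (x, y, z \<oplus>\<^bsub>P\<^esub> z') - frag_of (x, y, z) - frag_of (x, y, z') | x y z z'.
          x \<in> carrier M \<and> y \<in> carrier N \<and> z \<in> carrier P \<and> z' \<in> carrier P} \<union>
       {frag_of (c \<odot>\<^bsub>M\<^esub> x, y, z) - frag_of (x, c \<odot>\<^bsub>N\<^esub> y, z) | c x y z.
          x \<in> carrier M \<and> y \<in> carrier N \<and> z \<in> carrier P} \<union>
       {frag_of (x, c \<odot>\<^bsub>N\<^esub> y, z) - frag_of (x, y, c \<odot>\<^bsub>P\<^esub> z) | c x y z.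
          x \<in> carrier M \<and> y \<in> carrier N \<and> z \<in> carrier P},
     gen_scal = (\<lambda>c (x, y, z). (c \<odot>\<^bsub>M\<^esub> x, y, z))\<rparr>"

text \<open>\<open>M \<otimes>\<^sub>R N\<close>, for a right action \<open>r\<close> of \<open>R\<close> on \<open>M\<close> and a left action \<open>l\<close> of \<open>R\<close> on \<open>N\<close>.
  After completion this is the quotient of the completed \<open>M \<otimes> N\<close> by the closed submodule
  generated by the tensors \<open>x a \<otimes> y - x \<otimes> a y\<close>.\<close>

definition balanced_tensor2 ::
    "(complex fps, 'r, 's) module_scheme \<Rightarrow>
     (complex fps, 'm, 'b) module_scheme \<Rightarrow> ('m \<Rightarrow> 'r \<Rightarrow> 'm) \<Rightarrow>
     (complex fps, 'n, 'c) module_scheme \<Rightarrow> ('r \<Rightarrow> 'n \<Rightarrow> 'n) \<Rightarrow>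
     ('m \<times> 'n) tensor_presentation" where
  "balanced_tensor2 R M r N l =
    (tensor2 M N)\<lparr>rels := rels (tensor2 M N) \<union>
       {frag_of (r x a, y) - frag_of (x, l a y) | a x y.
          a \<in> carrier R \<and> x \<in> carrier M \<and> y \<in> carrier N}\<rparr>"

text \<open>\<open>M \<otimes>\<^sub>R N \<otimes>\<^sub>S P\<close>, where \<open>r\<close> and \<open>l\<close> are the actions of \<open>R\<close> on \<open>M\<close> and \<open>N\<close>, and \<open>r'\<close> and \<open>l'\<close>
  are the actions of \<open>S\<close> on \<open>N\<close> and \<open>P\<close>.\<close>

definition balanced_tensor3 ::
    "(complex fps, 'r, 'b1) module_scheme \<Rightarrow> (complex fps, 's, 'b2) module_scheme \<Rightarrow>
     (complex fps, 'm, 'b3) module_scheme \<Rightarrow> ('m \<Rightarrow> 'r \<Rightarrow> 'm) \<Rightarrow>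
     (complex fps, 'n, 'b4) module_scheme \<Rightarrow> ('r \<Rightarrow> 'n \<Rightarrow> 'n) \<Rightarrow> ('n \<Rightarrow> 's \<Rightarrow> 'n) \<Rightarrow>
     (complex fps, 'p, 'b5) module_scheme \<Rightarrow> ('s \<Rightarrow> 'p \<Rightarrow> 'p) \<Rightarrow>
     ('m \<times> 'n \<times> 'p) tensor_presentation" where
  "balanced_tensor3 R S M r N l r' P l' =
    (tensor3 M N P)\<lparr>rels := rels (tensor3 M N P) \<union>
       {frag_of (r x a, y, z) - frag_of (x, l a y, z) | a x y z.
          a \<in> carrier R \<and> x \<in> carrier M \<and> y \<in> carrier N \<and> z \<in> carrier P} \<union>
       {frag_of (x, r' y a, z) - frag_of (x, y, l' a z) | a x y z.
          a \<in> carrier S \<and> x \<in> carrier M \<and> y \<in> carrier N \<and> z \<in> carrier P}\<rparr>"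

definition E_tensor2 ::
    "'a::ring heis_algebra \<Rightarrow> complex fps \<Rightarrow> int \<Rightarrow> int \<Rightarrow> ('a fps \<times> 'a fps) tensor_presentation"
  where
  "E_tensor2 H \<theta> j k =
    balanced_tensor2 (A0_algebra H \<theta>) (E_module H j) (star H \<theta>) (E_module H k) (star H \<theta>)"

definition E_tensor3 ::
    "'a::ring heis_algebra \<Rightarrow> complex fps \<Rightarrow> complex fps \<Rightarrow> int \<Rightarrow> int \<Rightarrow> int \<Rightarrow>
     ('a fps \<times> 'a fps \<times> 'a fps) tensor_presentation" where
  "E_tensor3 H \<theta>' \<theta> m n p =
    balanced_tensor3 (A0_algebra H \<theta>') (A0_algebra H \<theta>)
      (E_module H m) (star H \<theta>') (E_module H n) (star H \<theta>') (star H \<theta>)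
      (E_module H p) (star H \<theta>)"

end

(* The associativity of the deformed products is governed by the weight of the middle factor: for
   b of weight n, a *' (b * c) = (a *' b) * c whenever theta' (1 + n theta) = theta. This follows
   by bringing the operators p and q acting on b into normal order with [p, q] = n and summing the
   resulting binomial series. Weight 0 gives associativity of A_0 and the balancedness of the
   products, weight n the bimodules and the diagram.

   For the completed tensor products the decisive fact is that an element of the inverse limit
   that vanishes modulo nu^k is a nu^k-multiple. Consequently a linear map into a nu-adically
   separated module is determined by its values on pure tensors, and every balanced multilinear
   map into a separated and complete module extends; the inverse limit is itself separated and
   complete. *)

theory Submission
  imports Defs
begin

section \<open>The star products\<close>

text \<open>The relation between the two parameters comes from exponentials on three tensor factors.
  With indices marking the factor acted on, \<open>a *' (b * c)\<close> applies exp(-\<theta>' p1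
  q2) exp(-\<theta>' p1 q3) exp(-\<theta> p2 q3), whereas \<open>(a *' b) * c\<close> applies
  exp(-\<theta> p1 q3) exp(-\<theta> p2 q3) exp(-\<theta>' p1 q2). Exchanging the last two
  exponentials of the second product costs the exponential of their commutator n \<theta> \<theta>'
  p1 q3, because [p2, q2] = n. The two sides therefore agree when -\<theta>' = -\<theta> + n
  \<theta> \<theta>'. The proof carries this out on coefficients, where all sums are finite. The
  tensor products are delicate because the modules need not be finitely generated: the algebraic
  tensor product need be neither separated nor complete, and it is not obvious that the inverse
  limit carries the \<nu>-adic topology. What makes it do so is division by the single element
  \<nu>^k, which generates the k-th power of the ideal.\<close>

lemma funpow_funpow: "(f ^^ m) ((f ^^ n) x) = (f ^^ (m + n)) x"
  by (simp add: funpow_add)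

section \<open>Scalars, products and derivations on A[[\<nu>]]\<close>

context heisenberg_module_algebra begin

sublocale scal: Vector_Spaces.vector_space "scal H"
  by (rule vector_space)

abbreviation sscal :: "complex fps \<Rightarrow> 'a fps \<Rightarrow> 'a fps" (infixr "*\<^sub>S" 75) where
  "c *\<^sub>S a \<equiv> series_scal H c a"

abbreviation "P \<equiv> series_act H heis_p"
abbreviation "Q \<equiv> series_act H heis_q"

lemma series_scal_nth: "(c *\<^sub>S a) $ n = (\<Sum>i=0..n. scal H (c $ i) (a $ (n - i)))"
  by (simp add: series_scal_def)

text \<open>The reindexing behind associativity of power series multiplication holds for arbitrary
  summands in a commutative monoid, so it also serves for products that mix scalars and
  vectors.\<close>

lemma series_scal_assoc: "(c * d) *\<^sub>S a = c *\<^sub>S d *\<^sub>S a"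
proof (rule fps_ext)
  fix n
  have "((c * d) *\<^sub>S a) $ n = (\<Sum>j=0..n. \<Sum>i=0..j. scal H (c $ i * d $ (j - i)) (a $ (n - j)))"
    by (simp add: series_scal_nth fps_mult_nth scal.scale_sum_left)
  also have "\<dots> = (\<Sum>j=0..n. \<Sum>i=0..n - j. scal H (c $ j * d $ i) (a $ (n - j - i)))"
    by (rule fps_mult_assoc_lemma)
  finally show "((c * d) *\<^sub>S a) $ n = (c *\<^sub>S d *\<^sub>S a) $ n"
    by (simp add: series_scal_nth scal.scale_sum_right)
qed

sublocale series: Modules.module "series_scal H"
proof
  fix c d :: "complex fps" and a b :: "'a fps"
  show "c *\<^sub>S (a + b) = c *\<^sub>S a + c *\<^sub>S b"
    by (rule fps_ext) (simp add: series_scal_nth scal.scale_right_distrib sum.distrib)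
  show "(c + d) *\<^sub>S a = c *\<^sub>S a + d *\<^sub>S a"
    by (rule fps_ext) (simp add: series_scal_nth scal.scale_left_distrib sum.distrib)
  show "c *\<^sub>S d *\<^sub>S a = (c * d) *\<^sub>S a"
    by (simp add: series_scal_assoc)
  show "1 *\<^sub>S a = a"
    by (rule fps_ext) (simp add: series_scal_nth if_distrib[of "\<lambda>x. scal H x _"] cong: if_cong)
qed

lemma series_scal_mult_left: "(c *\<^sub>S a) * b = c *\<^sub>S (a * b)"
proof (rule fps_ext)
  fix n
  have "((c *\<^sub>S a) * b) $ n = (\<Sum>j=0..n. \<Sum>i=0..j. scal H (c $ i) (a $ (j - i) * b $ (n - j)))"
    by (simp add: series_scal_nth fps_mult_nth sum_distrib_right scal_mult_left)
  also have "\<dots> = (\<Sum>j=0..n. \<Sum>i=0..n - j. scal H (c $ j) (a $ i * b $ (n - j - i)))"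
    by (rule fps_mult_assoc_lemma)
  finally show "((c *\<^sub>S a) * b) $ n = (c *\<^sub>S (a * b)) $ n"
    by (simp add: series_scal_nth fps_mult_nth scal.scale_sum_right)
qed

lemma series_scal_mult_right: "a * (c *\<^sub>S b) = c *\<^sub>S (a * b)"
proof (rule fps_ext)
  fix n
  have "(a * (c *\<^sub>S b)) $ n = (\<Sum>j=0..n. \<Sum>i=0..n - j. scal H (c $ i) (a $ j * b $ (n - j - i)))"
    by (simp add: series_scal_nth fps_mult_nth sum_distrib_left scal_mult_right)
  also have "\<dots> = (\<Sum>j=0..n. \<Sum>i=0..j. scal H (c $ (j - i)) (a $ i * b $ (n - j)))"
    by (rule fps_mult_assoc_lemma[symmetric])
  \<comment> \<open>The scalar stands to the right of \<open>a\<close> here; reversing the inner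
    convolution brings its coefficient to the front, after which the sums reassociate as
    before.\<close>
  also have "\<dots> = (\<Sum>j=0..n. \<Sum>i=0..j. scal H (c $ i) (a $ (j - i) * b $ (n - j)))"
  proof (rule sum.cong[OF refl])
    fix j
    show "(\<Sum>i=0..j. scal H (c $ (j - i)) (a $ i * b $ (n - j))) = (\<Sum>i=0..j. scal H (c $ i) (a $ (j - i) * b $ (n - j)))"
      by (rule fps_mult_commute_lemma[symmetric, where f = "\<lambda>i k. scal H (c $ i) (a $ k * b $ (n - j))"])
  qed
  also have "\<dots> = (\<Sum>j=0..n. \<Sum>i=0..n - j. scal H (c $ j) (a $ i * b $ (n - j - i)))"
    by (rule fps_mult_assoc_lemma)
  finally show "(a * (c *\<^sub>S b)) $ n = (c *\<^sub>S (a * b)) $ n"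
    by (simp add: series_scal_nth fps_mult_nth scal.scale_sum_right)
qed

lemma act_plus: "act H x (a + b) = act H x a + act H x b"
  and act_scal: "act H x (scal H c a) = scal H c (act H x a)"
  and act_sum: "act H x (sum f A) = (\<Sum>i\<in>A. act H x (f i))"
proof -
  interpret L: Vector_Spaces.linear "scal H" "scal H" "act H x" by (rule act_linear)
  show "act H x (a + b) = act H x a + act H x b" by (rule L.add)
  show "act H x (scal H c a) = scal H c (act H x a)" by (rule L.scale)
  show "act H x (sum f A) = (\<Sum>i\<in>A. act H x (f i))" by (rule L.sum)
qed

lemma act_zero_left: "act H 0 a = 0"
  using act_scaleR[of 0 0 a] by simp

lemma series_act_nth: "series_act H x a $ n = act H x (a $ n)"
  by (simp add: series_act_def)

lemma series_act_add: "series_act H x (a + b) = series_act H x a + series_act H x b"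
  by (rule fps_ext) (simp add: series_act_nth act_plus)

lemma series_act_scal: "series_act H x (c *\<^sub>S a) = c *\<^sub>S series_act H x a"
  by (rule fps_ext) (simp add: series_act_nth series_scal_nth act_sum act_scal)

lemma series_act_mult: "series_act H x (a * b) = series_act H x a * b + a * series_act H x b"
  by (rule fps_ext) (simp add: series_act_nth fps_mult_nth act_sum act_derivation sum.distrib)

lemma series_act_sum: "series_act H x (sum f A) = (\<Sum>i\<in>A. series_act H x (f i))"
  by (rule additive.sum) (simp add: additive_def series_act_add)

lemma series_act_pow_add:
  "(series_act H x ^^ k) (a + b) = (series_act H x ^^ k) a + (series_act H x ^^ k) b"
  by (induction k) (simp_all add: series_act_add)

lemma series_act_pow_scal: "(series_act H x ^^ k) (c *\<^sub>S a) = c *\<^sub>S (series_act H x ^^ k) a"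
  by (induction k) (simp_all add: series_act_scal)

lemma series_act_bracket:
  "series_act H x (series_act H y a) = series_act H y (series_act H x a) + series_act H (heis_bracket x y) a"
  by (rule fps_ext) (simp add: series_act_nth act_bracket)

lemma Leibniz:
  "(series_act H x ^^ n) (a * b) =
    (\<Sum>k\<le>n. of_nat (n choose k) *\<^sub>S ((series_act H x ^^ k) a * (series_act H x ^^ (n - k)) b))"
proof (induction n)
  case (Suc n)
  let ?D = "series_act H x"
  let ?T = "\<lambda>k. (?D ^^ k) a * (?D ^^ (Suc n - k)) b"
  have "(?D ^^ Suc n) (a * b) = (\<Sum>k\<le>n. of_nat (n choose k) *\<^sub>S ?D ((?D ^^ k) a * (?D ^^ (n - k)) b))"
    by (simp add: Suc series_act_sum series_act_scal)
  also have "\<dots> = (\<Sum>k\<le>n. of_nat (n choose k) *\<^sub>S ?T (Suc k)) + (\<Sum>k\<le>n. of_nat (n choose k) *\<^sub>S ?T k)"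
    by (subst sum.distrib[symmetric], rule sum.cong)
      (simp_all add: series_act_mult series.scale_right_distrib Suc_diff_le)
  \<comment> \<open>The added summand has coefficient \<open>n choose Suc n = 0\<close>. Splitting
    off \<open>k = 0\<close> afterwards aligns this sum with the shifted one for Pascal's
    rule.\<close>
  also have "(\<Sum>k\<le>n. of_nat (n choose k) *\<^sub>S ?T k) = (\<Sum>k\<le>Suc n. of_nat (n choose k) *\<^sub>S ?T k)"
    by (simp add: binomial_eq_0)
  also have "\<dots> = of_nat (Suc n choose 0) *\<^sub>S ?T 0 + (\<Sum>k\<le>n. of_nat (n choose Suc k) *\<^sub>S ?T (Suc k))"
    by (subst sum.atMost_Suc_shift) simp
  also have "(\<Sum>k\<le>n. of_nat (n choose k) *\<^sub>S ?T (Suc k)) + \<dots> =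
      of_nat (Suc n choose 0) *\<^sub>S ?T 0 + (\<Sum>k\<le>n. of_nat (Suc n choose Suc k) *\<^sub>S ?T (Suc k))"
    by (simp add: sum.distrib series.scale_left_distrib algebra_simps)
  finally show ?case
    by (subst sum.atMost_Suc_shift)
qed simp

section \<open>Weight spaces and the relation [p, q] = n on them\<close>

abbreviation E :: "int \<Rightarrow> 'a fps set" where "E n \<equiv> weight_series H n"

text \<open>Replaces the coefficientwise definition by an eigenvalue equation for
  \<open>heis_t\<close> on series, so that the closure properties below follow by algebra.\<close>

lemma weight_seriesI: "series_act H heis_t a = of_int n *\<^sub>S a \<Longrightarrow> a \<in> E n"
  and weight_seriesD: "a \<in> E n \<Longrightarrow> series_act H heis_t a = of_int n *\<^sub>S a"
proof -
  have "(of_int n *\<^sub>S a) $ i = scal H (of_int n) (a $ i)" for i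
    by (simp add: series_scal_nth sum.atLeast_Suc_atMost fps_of_int[symmetric])
  then show "series_act H heis_t a = of_int n *\<^sub>S a \<Longrightarrow> a \<in> E n"
    and "a \<in> E n \<Longrightarrow> series_act H heis_t a = of_int n *\<^sub>S a"
    by (auto simp: weight_series_def weight_space_def fps_eq_iff series_act_nth)
qed

lemma E_zero: "0 \<in> E n"
  by (rule weight_seriesI) (simp add: fps_eq_iff series_act_nth act_sum[of _ _ "{}", simplified])

lemma E_add: "\<lbrakk>a \<in> E n; b \<in> E n\<rbrakk> \<Longrightarrow> a + b \<in> E n"
  by (rule weight_seriesI) (simp add: series_act_add weight_seriesD series.scale_right_distrib)

lemma E_scal: "a \<in> E n \<Longrightarrow> c *\<^sub>S a \<in> E n"
  by (rule weight_seriesI) (simp add: series_act_scal weight_seriesD mult.commute)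

lemma E_uminus: "a \<in> E n \<Longrightarrow> - a \<in> E n"
  using E_scal[of a n "-1"] by simp

text \<open>Since \<open>heis_t\<close> acts by a derivation, eigenvalues add under
  products.\<close>

lemma E_mult: "\<lbrakk>a \<in> E j; b \<in> E k\<rbrakk> \<Longrightarrow> a * b \<in> E (j + k)"
  by (rule weight_seriesI)
    (simp add: series_act_mult weight_seriesD series_scal_mult_left series_scal_mult_right
      series.scale_left_distrib)

lemma E_sum: "(\<And>i. i \<in> A \<Longrightarrow> f i \<in> E n) \<Longrightarrow> sum f A \<in> E n"
  by (induction A rule: infinite_finite_induct) (auto simp: E_zero E_add)

lemma heis_t_central: "heis_bracket x heis_t = 0"
  by (cases x) (simp add: heis_bracket_def heis_t_def zero_prod_def)

lemma E_act: "a \<in> E n \<Longrightarrow> series_act H x a \<in> E n"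
proof (rule weight_seriesI)
  assume "a \<in> E n"
  have "series_act H heis_t (series_act H x a) = series_act H x (series_act H heis_t a)"
    using series_act_bracket[of x heis_t a]
    by (simp add: heis_t_central fps_eq_iff series_act_nth act_zero_left)
  then show "series_act H heis_t (series_act H x a) = of_int n *\<^sub>S series_act H x a"
    using \<open>a \<in> E n\<close> by (simp add: weight_seriesD series_act_scal)
qed

lemma E_act_pow: "a \<in> E n \<Longrightarrow> (series_act H x ^^ k) a \<in> E n"
  by (induction k) (auto simp: E_act)

text \<open>Here the relation [p, q] = t enters: on weight \<open>n\<close> the commutator of
  \<open>P\<close> and \<open>Q\<close> is the number \<open>n\<close>, so that the two operators
  behave like a Weyl pair.\<close>

lemma PQ_commute: "b \<in> E n \<Longrightarrow> P (Q b) = Q (P b) + of_int n *\<^sub>S b"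
proof -
  have "heis_bracket heis_p heis_q = heis_t"
    by (simp add: heis_bracket_def heis_p_def heis_q_def heis_t_def)
  then show "b \<in> E n \<Longrightarrow> P (Q b) = Q (P b) + of_int n *\<^sub>S b"
    using series_act_bracket[of heis_p heis_q b] by (simp add: weight_seriesD)
qed

text \<open>This is [p, q^i] = i n q^(i-1). For \<open>i = 0\<close> the exponent is truncated, but
  the factor \<open>of_nat i\<close> vanishes.\<close>

lemma P_Q_pow: "b \<in> E n \<Longrightarrow>
  P ((Q ^^ i) b) = (Q ^^ i) (P b) + (of_nat i * of_int n) *\<^sub>S (Q ^^ (i - 1)) b"
proof (induction i)
  case (Suc i)
  have "P ((Q ^^ Suc i) b) = Q (P ((Q ^^ i) b)) + of_int n *\<^sub>S (Q ^^ i) b"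
    using Suc.prems by (simp add: PQ_commute E_act_pow)
  also have "Q (P ((Q ^^ i) b)) = (Q ^^ Suc i) (P b) + (of_nat i * of_int n) *\<^sub>S (Q ^^ i) b"
    using Suc by (cases i) (simp_all add: series_act_add series_act_scal)
  finally show ?case
    by (simp add: series.scale_left_distrib distrib_right)
qed simp

text \<open>The factor \<open>i choose w\<close> vanishes where the exponent \<open>i - w\<close> is truncated.\<close>

lemma normal_ordering:
  assumes b: "b \<in> E n"
  shows "(P ^^ l) ((Q ^^ i) b) =
    (\<Sum>w\<le>l. (of_nat ((l choose w) * ((i choose w) * fact w)) * of_int n ^ w) *\<^sub>S
       (Q ^^ (i - w)) ((P ^^ (l - w)) b))"
proof (induction l)
  case (Suc l)
  \<comment> \<open>\<open>d l w\<close> counts, with weight \<open>n\<close> for each contraction,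
    the ways to choose \<open>w\<close> of the \<open>l\<close> factors \<open>P\<close> and
    \<open>w\<close> of the \<open>i\<close> factors \<open>Q\<close> and to match them.\<close>
  define d where "d l w = (of_nat ((l choose w) * ((i choose w) * fact w)) * of_int n ^ w :: complex fps)" for l w
  define M where "M w = (Q ^^ (i - w)) ((P ^^ (Suc l - w)) b)" for w
  have step: "P ((Q ^^ (i - w)) ((P ^^ (l - w)) b)) =
      M w + (of_nat (i - w) * of_int n) *\<^sub>S M (Suc w)" if "w \<le> l" for w
  proof -
    have "P ((Q ^^ (i - w)) ((P ^^ (l - w)) b)) = (Q ^^ (i - w)) ((P ^^ Suc (l - w)) b)
        + (of_nat (i - w) * of_int n) *\<^sub>S (Q ^^ (i - w - 1)) ((P ^^ (l - w)) b)"
      using P_Q_pow[OF E_act_pow[OF b]] by simp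
    then show ?thesis using that by (simp add: M_def Suc_diff_le)
  qed
  \<comment> \<open>\<open>(i choose w) * fact w\<close> is the falling factorial of
    \<open>i\<close> with \<open>w\<close> factors, and its next factor is \<open>i - w\<close>. For
    \<open>w \<ge> i\<close> both sides vanish.\<close>
  have absorb: "(i choose w) * fact w * (i - w) = (i choose Suc w) * fact (Suc w)" for w
  proof -
    have "(i - w) * (i choose w) = Suc w * (i choose Suc w)"
      by (simp only: binomial_absorb_comp binomial_absorption)
    then have "fact w * ((i - w) * (i choose w)) = fact w * (Suc w * (i choose Suc w))"
      by simp
    then show ?thesis by (simp only: fact_Suc of_nat_id mult_ac)
  qed
  \<comment> \<open>A further \<open>P\<close> either passes all remaining factors \<open>Q\<close>
    or is contracted with one of the \<open>i - w\<close> that are left.\<close>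
  have d_Suc: "d (Suc l) (Suc w) = d l (Suc w) + d l w * (of_nat (i - w) * of_int n)" for w
  proof -
    have "(Suc l choose Suc w) * ((i choose Suc w) * fact (Suc w))
        = (l choose Suc w) * ((i choose Suc w) * fact (Suc w)) + (l choose w) * ((i choose w) * fact w) * (i - w)"
      by (simp add: distrib_right absorb[symmetric] del: fact_Suc)
    then have "(of_nat ((Suc l choose Suc w) * ((i choose Suc w) * fact (Suc w))) :: complex fps)
        = of_nat ((l choose Suc w) * ((i choose Suc w) * fact (Suc w)))
          + of_nat ((l choose w) * ((i choose w) * fact w)) * of_nat (i - w)"
      by (simp only: of_nat_add of_nat_mult mult.assoc)
    then show ?thesis
      unfolding d_def power_Suc by (simp only: distrib_left distrib_right mult_ac)
  qed
  have "(P ^^ Suc l) ((Q ^^ i) b) = (\<Sum>w\<le>l. d l w *\<^sub>S P ((Q ^^ (i - w)) ((P ^^ (l - w)) b)))"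
    by (simp add: Suc d_def series_act_sum series_act_scal)
  also have "\<dots> = (\<Sum>w\<le>l. d l w *\<^sub>S M w) + (\<Sum>w\<le>l. (d l w * (of_nat (i - w) * of_int n)) *\<^sub>S M (Suc w))"
    by (subst sum.distrib[symmetric], rule sum.cong) (simp_all add: step series.scale_right_distrib)
  also have "(\<Sum>w\<le>l. d l w *\<^sub>S M w) = (\<Sum>w\<le>Suc l. d l w *\<^sub>S M w)"
    by (simp add: d_def binomial_eq_0)
  also have "\<dots> = d (Suc l) 0 *\<^sub>S M 0 + (\<Sum>w\<le>l. d l (Suc w) *\<^sub>S M (Suc w))"
    by (subst sum.atMost_Suc_shift) (simp add: d_def)
  also have "\<dots> + (\<Sum>w\<le>l. (d l w * (of_nat (i - w) * of_int n)) *\<^sub>S M (Suc w)) =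
      d (Suc l) 0 *\<^sub>S M 0 + (\<Sum>w\<le>l. d (Suc l) (Suc w) *\<^sub>S M (Suc w))"
    by (simp only: d_Suc series.scale_left_distrib sum.distrib add.assoc)
  finally show ?case
    unfolding d_def[symmetric] M_def[symmetric] by (subst sum.atMost_Suc_shift)
qed simp


section \<open>The star product as a \<nu>-adically convergent series\<close>

text \<open>Algebraic identities are proved for these summands and transferred to the product
  through finite truncations.\<close>

definition star_term :: "complex fps \<Rightarrow> nat \<Rightarrow> 'a fps \<Rightarrow> 'a fps \<Rightarrow> 'a fps" where
  "star_term \<theta> j a b = (fps_const (1 / fact j) * (- \<theta>) ^ j) *\<^sub>S ((P ^^ j) a * (Q ^^ j) b)"

lemma star_term_add_left: "star_term \<theta> j (a + a') b = star_term \<theta> j a b + star_term \<theta> j a' b"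
  by (simp add: star_term_def series_act_pow_add distrib_right series.scale_right_distrib)

lemma star_term_add_right: "star_term \<theta> j a (b + b') = star_term \<theta> j a b + star_term \<theta> j a b'"
  by (simp add: star_term_def series_act_pow_add distrib_left series.scale_right_distrib)

lemma star_term_scal_left: "star_term \<theta> j (c *\<^sub>S a) b = c *\<^sub>S star_term \<theta> j a b"
  by (simp add: star_term_def series_act_pow_scal series_scal_mult_left mult.commute)

lemma star_term_scal_right: "star_term \<theta> j a (c *\<^sub>S b) = c *\<^sub>S star_term \<theta> j a b"
  by (simp add: star_term_def series_act_pow_scal series_scal_mult_right mult.commute)

lemma star_term_sum_left: "star_term \<theta> j (sum f A) b = (\<Sum>i\<in>A. star_term \<theta> j (f i) b)"
  by (rule additive.sum) (simp add: additive_def star_term_add_left)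

lemma star_term_sum_right: "star_term \<theta> j a (sum f A) = (\<Sum>i\<in>A. star_term \<theta> j a (f i))"
  by (rule additive.sum) (simp add: additive_def star_term_add_right)

lemma star_term_E: "\<lbrakk>a \<in> E m; b \<in> E n\<rbrakk> \<Longrightarrow> star_term \<theta> j a b \<in> E (m + n)"
  by (simp add: star_term_def E_scal E_mult E_act_pow)

lemma X_power_scal_nth: "n < k \<Longrightarrow> ((c * fps_X ^ k) *\<^sub>S a) $ n = 0"
  by (simp add: series_scal_nth fps_X_power_mult_right_nth)

lemma star_term_nth: "\<lbrakk>\<theta> \<in> Theta; n < j\<rbrakk> \<Longrightarrow> star_term \<theta> j a b $ n = 0"
proof -
  assume "\<theta> \<in> Theta" and n: "n < j"
  then obtain c where "\<theta> = fps_X * c" by (auto simp: Theta_def)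
  then have "fps_const (1 / fact j) * (- \<theta>) ^ j = (fps_const (1 / fact j) * (- c) ^ j) * fps_X ^ j"
    by (simp add: power_mult_distrib[symmetric] mult_ac)
  then show ?thesis
    by (simp only: star_term_def X_power_scal_nth[OF n])
qed

text \<open>The j-th summand is divisible by \<nu>^j because \<theta> is divisible by \<nu>, so only
  finitely many summands reach a given coefficient. The cut-off \<open>N\<close> is left free in
  order that several products can be truncated at one common bound.\<close>

lemma star_nth:
  assumes \<theta>: "\<theta> \<in> Theta" and n: "n < N"
  shows "star H \<theta> a b $ n = (\<Sum>j<N. star_term \<theta> j a b $ n)"
proof -
  define L where "L = Abs_fps (\<lambda>n. \<Sum>j\<le>n. star_term \<theta> j a b $ n)"
  \<comment> \<open>The coefficient \<open>m\<close> of the partial sums is constant as soon as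
    \<open>M > m\<close>, which is convergence in the metric on power series.\<close>
  have stable: "(\<Sum>j<M. star_term \<theta> j a b $ m) = L $ m" if "m < M" for m M
    unfolding L_def fps_nth_Abs_fps using that
    by (intro sum.mono_neutral_right) (auto simp: star_term_nth[OF \<theta>])
  have "(\<lambda>j. star_term \<theta> j a b) sums L"
    unfolding sums_def
  proof (rule tendsto_fpsI)
    fix m
    show "eventually (\<lambda>M. (\<Sum>j<M. star_term \<theta> j a b) $ m = L $ m) sequentially"
      using eventually_gt_at_top[of m] by eventually_elim (simp add: fps_sum_nth stable)
  qed
  then have "star H \<theta> a b = L"
    unfolding star_def star_term_def by (rule sums_unique[symmetric])
  then show ?thesis using stable[OF n] by simp
qed

text \<open>Continuity of the summands with an explicit modulus. It allows an inner star product to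
  be replaced by a truncation that agrees with it below \<open>N\<close>.\<close>

lemma star_term_cong:
  assumes "\<And>t. t < N \<Longrightarrow> a $ t = a' $ t" "\<And>t. t < N \<Longrightarrow> b $ t = b' $ t" "t < N"
  shows "star_term \<theta> j a b $ t = star_term \<theta> j a' b' $ t"
proof -
  have pow: "(series_act H x ^^ k) u $ s = (series_act H x ^^ k) v $ s"
    if "\<And>s. s < N \<Longrightarrow> u $ s = v $ s" "s < N" for x k u v s
    using that by (induction k arbitrary: s) (auto simp: series_act_nth)
  show ?thesis
    unfolding star_term_def series_scal_nth fps_mult_nth
    using assms(3) pow[OF assms(1)] pow[OF assms(2)] by (intro sum.cong arg_cong2[where f = "scal H"] refl) simp
qed

lemma star_add_left: "\<theta> \<in> Theta \<Longrightarrow> star H \<theta> (a + a') b = star H \<theta> a b + star H \<theta> a' b"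
  by (rule fps_ext) (simp add: star_nth[OF _ lessI] star_term_add_left sum.distrib)

lemma star_add_right: "\<theta> \<in> Theta \<Longrightarrow> star H \<theta> a (b + b') = star H \<theta> a b + star H \<theta> a b'"
  by (rule fps_ext) (simp add: star_nth[OF _ lessI] star_term_add_right sum.distrib)

text \<open>All coefficients of index at most \<open>n\<close> are truncated at the same bound
  \<open>Suc n\<close>; then the scalar convolution and the sum over \<open>j\<close> can be
  interchanged.\<close>

lemma series_scal_star_nth:
  assumes "\<theta> \<in> Theta"
  shows "(c *\<^sub>S star H \<theta> a b) $ n = (\<Sum>j<Suc n. (c *\<^sub>S star_term \<theta> j a b) $ n)"
proof -
  have "(c *\<^sub>S star H \<theta> a b) $ n = (\<Sum>i=0..n. scal H (c $ i) (\<Sum>j<Suc n. star_term \<theta> j a b $ (n - i)))"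
    by (simp add: series_scal_nth star_nth[OF assms, of _ "Suc n"] del: sum.lessThan_Suc)
  also have "\<dots> = (\<Sum>j<Suc n. (c *\<^sub>S star_term \<theta> j a b) $ n)"
    by (simp only: series_scal_nth scal.scale_sum_right) (rule sum.swap)
  finally show ?thesis .
qed

lemma star_scal_left: "\<theta> \<in> Theta \<Longrightarrow> star H \<theta> (c *\<^sub>S a) b = c *\<^sub>S star H \<theta> a b"
  by (rule fps_ext) (simp only: star_nth[OF _ lessI] series_scal_star_nth star_term_scal_left)

lemma star_scal_right: "\<theta> \<in> Theta \<Longrightarrow> star H \<theta> a (c *\<^sub>S b) = c *\<^sub>S star H \<theta> a b"
  by (rule fps_ext) (simp only: star_nth[OF _ lessI] series_scal_star_nth star_term_scal_right)

lemma star_E: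
  assumes "\<theta> \<in> Theta" "a \<in> E m" "b \<in> E n"
  shows "star H \<theta> a b \<in> E (m + n)"
  unfolding weight_series_def
proof (intro CollectI allI)
  fix i
  have "(\<Sum>j<Suc i. star_term \<theta> j a b) \<in> E (m + n)"
    using assms by (intro E_sum star_term_E)
  then show "star H \<theta> a b $ i \<in> weight_space H (m + n)"
    using star_nth[OF assms(1) lessI, of a b i] by (simp add: weight_series_def fps_sum_nth)
qed

text \<open>A derivation satisfies \<open>D 1 = D (1 * 1) = D 1 + D 1\<close>.\<close>

lemma act_unity: "act H x (unity H) = 0"
  using act_derivation[of x "unity H" "unity H"] by (simp add: unity_left unity_right)

lemma series_act_unity: "(series_act H x ^^ Suc k) (fps_const (unity H)) = 0"
proof (induction k)
  case 0
  show ?case by (rule fps_ext) (simp add: series_act_nth act_unity act_sum[of _ _ "{}", simplified])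
next
  case (Suc k)
  then show ?case
    by (simp only: funpow.simps o_apply)
      (simp add: fps_eq_iff series_act_nth act_sum[of _ _ "{}", simplified])
qed

lemma fps_const_unity_mult: "fps_const (unity H) * a = a" "a * fps_const (unity H) = a"
  by (auto simp: fps_eq_iff fps_mult_left_const_nth fps_mult_right_const_nth unity_left unity_right)

text \<open>Derivations kill the unit, so only the summand \<open>j = 0\<close> survives.\<close>

lemma star_unity:
  assumes "\<theta> \<in> Theta"
  shows "star H \<theta> (fps_const (unity H)) a = a" "star H \<theta> a (fps_const (unity H)) = a"
proof -
  have "star_term \<theta> (Suc j) (fps_const (unity H)) a = 0" "star_term \<theta> (Suc j) a (fps_const (unity H)) = 0" for j
    by (simp_all only: star_term_def series_act_unity mult_zero_left mult_zero_right series.scale_zero_right)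
  then show "star H \<theta> (fps_const (unity H)) a = a" "star H \<theta> a (fps_const (unity H)) = a"
    using assms
    by (auto intro!: fps_ext simp: star_nth[OF _ lessI] sum.lessThan_Suc_shift simp del: sum.lessThan_Suc)
      (simp_all add: star_term_def fps_const_unity_mult)
qed

lemma unity_E: "fps_const (unity H) \<in> E 0"
  by (rule weight_seriesI) (use series_act_unity[of 0 heis_t] in simp)


section \<open>Associativity across two deformation parameters\<close>

text \<open>The proof of \<open>star_assoc\<close> brings both sides to the triple series with the summands
  \<open>assoc_term\<close>. The left-hand side yields it directly by the Leibniz rule. On the right-hand side
  the powers of \<open>P\<close> and \<open>Q\<close> acting on \<open>b\<close> come in the opposite order; normal ordering produces
  \<open>reordered_term\<close>, and the extra summation is a binomial expansion of
  \<open>\<sigma> ^ m * (1 + n * \<sigma>') ^ m = \<sigma>' ^ m\<close>, where \<open>\<sigma> = - \<theta>\<close> and \<open>\<sigma>' = - \<theta>'\<close>.\<close>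

context
  fixes \<theta> \<theta>' :: "complex fps" and n :: int and a b c :: "'a fps"
  assumes \<theta>: "\<theta> \<in> Theta" and \<theta>': "\<theta>' \<in> Theta" and deform: "\<theta>' * (1 + of_int n * \<theta>) = \<theta>"
    and b: "b \<in> E n"
begin

text \<open>The normally ordered monomial: in the middle factor all powers of \<open>Q\<close> stand
  to the left of those of \<open>P\<close>.\<close>

definition triple :: "nat \<Rightarrow> nat \<Rightarrow> nat \<Rightarrow> nat \<Rightarrow> 'a fps" where
  "triple r u v s = (P ^^ r) a * ((Q ^^ u) ((P ^^ v) b) * (Q ^^ s) c)"

text \<open>\<open>u\<close>, \<open>m\<close> and \<open>v\<close> count the pairings of
  \<open>a\<close> with \<open>b\<close>, of \<open>a\<close> with \<open>c\<close> and of
  \<open>b\<close> with \<open>c\<close>. The coefficient is the one in exp(-\<theta>' p1 q2)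
  exp(-\<theta>' p1 q3) exp(-\<theta> p2 q3).\<close>

definition assoc_term :: "nat \<Rightarrow> nat \<Rightarrow> nat \<Rightarrow> 'a fps" where
  "assoc_term u m v = (fps_const (1 / (fact u * fact m * fact v)) * ((- \<theta>') ^ (u + m) * (- \<theta>) ^ v)) *\<^sub>S
     triple (u + m) u v (v + m)"

text \<open>\<open>k\<close> counts the original pairings of \<open>a\<close> with \<open>c\<close>,
  while \<open>w\<close> counts contractions at \<open>b\<close>: each turns a pairing of
  \<open>a\<close> with \<open>b\<close> and one of \<open>b\<close> with \<open>c\<close> into a
  pairing of \<open>a\<close> with \<open>c\<close>, at the price of a factor
  \<open>n\<close>.\<close>

definition reordered_term :: "nat \<Rightarrow> nat \<Rightarrow> nat \<Rightarrow> nat \<Rightarrow> 'a fps" where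
  "reordered_term u v w k =
     (fps_const (1 / (fact u * fact v * fact w * fact k)) *
       (of_int n ^ w * ((- \<theta>') ^ (u + w) * (- \<theta>) ^ (v + w + k)))) *\<^sub>S
     triple (u + w + k) u v (v + w + k)"

lemma of_nat_fps_const: "of_nat m = (fps_const (of_nat m) :: complex fps)"
  by (simp add: fps_of_nat)

lemma inverse_fact_binomial: "k \<le> m \<Longrightarrow> 1 / fact m * of_nat (m choose k) = (1 / (fact k * fact (m - k)) :: complex)"
  by (simp add: binomial_fact)

lemma star_term_star_term_right:
  "star_term \<theta>' i a (star_term \<theta> j b c) = (\<Sum>u\<le>i. assoc_term u (i - u) j)"
proof -
  have "star_term \<theta>' i a (star_term \<theta> j b c) =
      (\<Sum>u\<le>i. (fps_const (1 / fact i) * (- \<theta>') ^ i * ((fps_const (1 / fact j) * (- \<theta>) ^ j) * of_nat (i choose u))) *\<^sub>S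
        triple i u j (i - u + j))"
    by (simp add: star_term_def series_act_pow_scal Leibniz series_scal_mult_right sum_distrib_left
        series.scale_sum_right triple_def funpow_funpow)
  also have "\<dots> = (\<Sum>u\<le>i. assoc_term u (i - u) j)"
  proof (rule sum.cong[OF refl])
    fix u assume "u \<in> {..i}"
    then have u: "u \<le> i" by simp
    have "fps_const (1 / fact i) * (- \<theta>') ^ i * ((fps_const (1 / fact j) * (- \<theta>) ^ j) * of_nat (i choose u)) =
        fps_const (1 / fact i * of_nat (i choose u) * (1 / fact j)) * ((- \<theta>') ^ i * (- \<theta>) ^ j)"
      unfolding of_nat_fps_const fps_const_mult[symmetric] by (simp only: mult_ac)
    also have "\<dots> = fps_const (1 / (fact u * fact (i - u) * fact j)) * ((- \<theta>') ^ i * (- \<theta>) ^ j)"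
      by (simp only: inverse_fact_binomial[OF u]) simp
    finally have coeff: "fps_const (1 / fact i) * (- \<theta>') ^ i * ((fps_const (1 / fact j) * (- \<theta>) ^ j) * of_nat (i choose u)) =
        fps_const (1 / (fact u * fact (i - u) * fact j)) * ((- \<theta>') ^ i * (- \<theta>) ^ j)" .
    show "(fps_const (1 / fact i) * (- \<theta>') ^ i * ((fps_const (1 / fact j) * (- \<theta>) ^ j) * of_nat (i choose u))) *\<^sub>S
        triple i u j (i - u + j) = assoc_term u (i - u) j"
      unfolding coeff using u by (simp add: assoc_term_def add.commute)
  qed
  finally show ?thesis .
qed

lemma star_term_star_term_left:
  "star_term \<theta> j (star_term \<theta>' i a b) c =
    (\<Sum>k\<le>j. \<Sum>w\<le>min i (j - k). reordered_term (i - w) (j - k - w) w k)"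
proof -
  define \<kappa> where "\<kappa> k w = fps_const (1 / fact j) * (- \<theta>) ^ j * ((fps_const (1 / fact i) * (- \<theta>') ^ i) *
      (of_nat (j choose k) * (of_nat (((j - k) choose w) * ((i choose w) * fact w)) * of_int n ^ w)))" for k w
  have "star_term \<theta> j (star_term \<theta>' i a b) c =
      (\<Sum>k\<le>j. (fps_const (1 / fact j) * (- \<theta>) ^ j * ((fps_const (1 / fact i) * (- \<theta>') ^ i) * of_nat (j choose k))) *\<^sub>S
        ((P ^^ (k + i)) a * ((P ^^ (j - k)) ((Q ^^ i) b) * (Q ^^ j) c)))"
    by (simp add: star_term_def series_act_pow_scal Leibniz series_scal_mult_left sum_distrib_right
        series.scale_sum_right funpow_funpow mult.assoc)
  also have "\<dots> = (\<Sum>k\<le>j. \<Sum>w\<le>j - k. \<kappa> k w *\<^sub>S triple (k + i) (i - w) (j - k - w) j)"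
    by (simp add: normal_ordering[OF b] sum_distrib_right sum_distrib_left series_scal_mult_left
        series_scal_mult_right series.scale_sum_right triple_def \<kappa>_def mult.assoc)
  also have "\<dots> = (\<Sum>k\<le>j. \<Sum>w\<le>min i (j - k). reordered_term (i - w) (j - k - w) w k)"
  proof (rule sum.cong[OF refl])
    fix k assume "k \<in> {..j}"
    then have k: "k \<le> j" by simp
    show "(\<Sum>w\<le>j - k. \<kappa> k w *\<^sub>S triple (k + i) (i - w) (j - k - w) j) =
        (\<Sum>w\<le>min i (j - k). reordered_term (i - w) (j - k - w) w k)"
    proof (rule sum.mono_neutral_cong_right)
      \<comment> \<open>Normal ordering lets \<open>w\<close> run up to the number
        \<open>j - k\<close> of factors \<open>P\<close>; beyond the number \<open>i\<close> of
        factors \<open>Q\<close> the binomial \<open>i choose w\<close> is zero.\<close>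
      show "\<forall>w\<in>{..j - k} - {..min i (j - k)}. \<kappa> k w *\<^sub>S triple (k + i) (i - w) (j - k - w) j = 0"
      proof
        fix w assume "w \<in> {..j - k} - {..min i (j - k)}"
        then have "i choose w = 0" by (intro binomial_eq_0) auto
        then show "\<kappa> k w *\<^sub>S triple (k + i) (i - w) (j - k - w) j = 0" by (simp add: \<kappa>_def binomial_eq_0)
      qed
      fix w assume "w \<in> {..min i (j - k)}"
      then have w: "w \<le> i" "w \<le> j - k" by auto
      \<comment> \<open>Two of the binomials contribute a \<open>1 / fact w\<close> each, and the
        \<open>fact w\<close> of normal ordering cancels one of them. What remains is symmetric in
        the four counts.\<close>
      have "1 / fact j * (1 / fact i) * (of_nat (j choose k) * of_nat (((j - k) choose w) * ((i choose w) * fact w)))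
          = 1 / fact j * of_nat (j choose k) * of_nat ((j - k) choose w) * (1 / fact i * of_nat (i choose w)) * (fact w :: complex)"
        by (simp only: of_nat_mult of_nat_fact mult_ac)
      also have "\<dots> = 1 / (fact k * fact (j - k)) * of_nat ((j - k) choose w) * (1 / (fact w * fact (i - w))) * fact w"
        by (simp only: inverse_fact_binomial[OF k] inverse_fact_binomial[OF w(1)])
      also have "\<dots> = 1 / fact k * (1 / fact (j - k) * of_nat ((j - k) choose w)) * (1 / fact (i - w))"
        by simp
      also have "\<dots> = 1 / fact k * (1 / (fact w * fact (j - k - w))) * (1 / fact (i - w))"
        by (simp only: inverse_fact_binomial[OF w(2)])
      finally have coeff: "1 / fact j * (1 / fact i) * (of_nat (j choose k) * of_nat (((j - k) choose w) * ((i choose w) * fact w)))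
          = (1 / (fact (i - w) * fact (j - k - w) * fact w * fact k) :: complex)"
        by (simp add: mult_ac)
      have "\<kappa> k w = fps_const (1 / fact j * (1 / fact i) * (of_nat (j choose k) * of_nat (((j - k) choose w) * ((i choose w) * fact w))))
          * (of_int n ^ w * ((- \<theta>') ^ i * (- \<theta>) ^ j))"
        unfolding \<kappa>_def of_nat_fps_const fps_const_mult[symmetric] by (simp only: mult_ac)
      then have "\<kappa> k w = fps_const (1 / (fact (i - w) * fact (j - k - w) * fact w * fact k))
          * (of_int n ^ w * ((- \<theta>') ^ i * (- \<theta>) ^ j))"
        by (simp only: coeff)
      then show "\<kappa> k w *\<^sub>S triple (k + i) (i - w) (j - k - w) j = reordered_term (i - w) (j - k - w) w k"
        using w k by (simp add: reordered_term_def add.commute)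
    qed auto
  qed
  finally show ?thesis .
qed

lemma sum_reordered_term: "(\<Sum>w\<le>m. reordered_term u v w (m - w)) = assoc_term u m v"
proof -
  let ?s = "- \<theta>" and ?s' = "- \<theta>'"
  \<comment> \<open>\<open>deform\<close> says \<theta>' + n \<theta>' \<theta> = \<theta>; here it
    is solved for \<theta>' with \<theta> as the common factor and the signs changed.\<close>
  have s': "?s * (1 + of_int n * ?s') = ?s'"
    using deform by (simp add: algebra_simps)
  \<comment> \<open>All summands share one \<open>triple\<close>, in which \<open>w\<close> and
    \<open>k\<close> occur only through \<open>w + k = m\<close>. The claim thus becomes one about
    scalars.\<close>
  have "(\<Sum>w\<le>m. reordered_term u v w (m - w)) =
      (\<Sum>w\<le>m. fps_const (1 / (fact u * fact m * fact v)) * (?s' ^ u * ?s ^ v * ?s ^ m) *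
         (of_nat (m choose w) * (of_int n * ?s') ^ w)) *\<^sub>S triple (u + m) u v (v + m)"
    unfolding series.scale_sum_left
  proof (rule sum.cong[OF refl])
    fix w assume "w \<in> {..m}"
    then have w: "w \<le> m" by simp
    have "1 / (fact u * fact v * fact w * fact (m - w)) = 1 / (fact w * fact (m - w)) * (1 / (fact u * fact v) :: complex)"
      by simp
    also have "\<dots> = 1 / (fact u * fact m * fact v) * of_nat (m choose w)"
      by (simp only: inverse_fact_binomial[OF w, symmetric]) simp
    finally have "fps_const (1 / (fact u * fact v * fact w * fact (m - w))) =
        fps_const (1 / (fact u * fact m * fact v)) * (of_nat (m choose w) :: complex fps)"
      by (simp only: of_nat_fps_const fps_const_mult)
    then show "reordered_term u v w (m - w) =
        (fps_const (1 / (fact u * fact m * fact v)) * (?s' ^ u * ?s ^ v * ?s ^ m) *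
         (of_nat (m choose w) * (of_int n * ?s') ^ w)) *\<^sub>S triple (u + m) u v (v + m)"
      using w unfolding reordered_term_def
      by (simp only: power_add power_mult_distrib add.assoc le_add_diff_inverse mult_ac)
  qed
  also have "(\<Sum>w\<le>m. fps_const (1 / (fact u * fact m * fact v)) * (?s' ^ u * ?s ^ v * ?s ^ m) *
         (of_nat (m choose w) * (of_int n * ?s') ^ w)) =
      fps_const (1 / (fact u * fact m * fact v)) * (?s' ^ u * ?s ^ v * (?s * (1 + of_int n * ?s')) ^ m)"
  proof -
    have "(1 + of_int n * ?s') ^ m = (\<Sum>w\<le>m. of_nat (m choose w) * (of_int n * ?s') ^ w)"
      using binomial_ring[of "of_int n * ?s'" 1 m] by (simp add: add.commute)
    then show ?thesis
      by (simp only: power_mult_distrib sum_distrib_left mult.assoc)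
  qed
  finally show ?thesis
    unfolding s' by (simp only: assoc_term_def power_add mult_ac)
qed

text \<open>Each parameter contributes a factor \<nu>. This bound makes the different truncations
  met in \<open>star_assoc\<close> interchangeable.\<close>

lemma reordered_term_nth:
  assumes "t < u + v + w + k"
  shows "reordered_term u v w k $ t = 0"
proof -
  obtain d d' where d: "\<theta> = fps_X * d" "\<theta>' = fps_X * d'"
    using \<theta> \<theta>' by (auto simp: Theta_def)
  \<comment> \<open>A contraction uses both parameters, so the term is divisible even by
    \<nu>^(u+v+2w+k); the extra \<open>fps_X ^ w\<close> stays in the cofactor, which makes the
    bound depend on \<open>w\<close> and \<open>k\<close> through their sum alone.\<close>
  have "(- \<theta>') ^ (u + w) * (- \<theta>) ^ (v + w + k) =
      ((- d') ^ (u + w) * (- d) ^ (v + w + k) * fps_X ^ w) * fps_X ^ (u + v + w + k)"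
    unfolding d minus_mult_right power_mult_distrib power_add by (simp only: mult_ac)
  then show ?thesis
    unfolding reordered_term_def by (simp only: mult.assoc[symmetric] X_power_scal_nth[OF assms])
qed

text \<open>Inherited from the reordered terms, all of which have the same total
  \<open>u + v + m\<close>.\<close>

lemma assoc_term_nth: "t < u + m + v \<Longrightarrow> assoc_term u m v $ t = 0"
  unfolding sum_reordered_term[symmetric] fps_sum_nth
  by (intro sum.neutral ballI reordered_term_nth) auto

lemma star_assoc: "star H \<theta>' a (star H \<theta> b c) = star H \<theta> (star H \<theta>' a b) c"
proof (rule fps_ext)
  fix t
  \<comment> \<open>One bound for all sums: a term whose total reaches \<open>N\<close> contributes
    nothing to coefficient \<open>t\<close>.\<close>
  define N where "N = Suc t"
  have t: "t < N" by (simp add: N_def)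
  have sum_nth: "(\<Sum>j<N. star_term \<eta> j x y) $ s = star H \<eta> x y $ s" if "\<eta> \<in> Theta" "s < N" for \<eta> x y s
    using star_nth[OF that] by (simp add: fps_sum_nth)
  have "star H \<theta>' a (star H \<theta> b c) $ t = (\<Sum>i<N. star_term \<theta>' i a (star H \<theta> b c) $ t)"
    by (rule star_nth[OF \<theta>' t])
  \<comment> \<open>The inner product is replaced by its truncation, which agrees with it in all
    coefficients below \<open>N\<close>.\<close>
  also have "\<dots> = (\<Sum>i<N. star_term \<theta>' i a (\<Sum>j<N. star_term \<theta> j b c) $ t)"
    by (intro sum.cong refl star_term_cong[OF _ _ t]) (simp_all add: sum_nth[OF \<theta>])
  also have "\<dots> = (\<Sum>i<N. \<Sum>j<N. \<Sum>u\<le>i. assoc_term u (i - u) j $ t)"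
    by (simp add: star_term_sum_right fps_sum_nth star_term_star_term_right)
  also have "\<dots> = (\<Sum>(i, j, u)\<in>(SIGMA i:{..<N}. SIGMA j:{..<N}. {..i}). assoc_term u (i - u) j $ t)"
    by (simp add: sum.Sigma split_beta)
  \<comment> \<open>The substitution \<open>m = i - u\<close> yields the triples with
    \<open>u + m < N\<close>. The set \<open>T'\<close> completes them to a cube, and its terms
    vanish at \<open>t\<close>.\<close>
  also have "\<dots> = (\<Sum>(u, m, v)\<in>{..<N} \<times> {..<N} \<times> {..<N}. assoc_term u m v $ t)"
    by (rule sum.reindex_bij_witness_not_neutral[where S' = "{}"
          and T' = "({..<N} \<times> {..<N} \<times> {..<N}) \<inter> {(u, m, v). N \<le> u + m}"
          and j = "\<lambda>(i, j, u). (u, i - u, j)" and i = "\<lambda>(u, m, v). (u + m, v, u)"])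
      (use t in \<open>auto simp: assoc_term_nth\<close>)
  also have "\<dots> = (\<Sum>(u, m, v)\<in>{..<N} \<times> {..<N} \<times> {..<N}. \<Sum>w\<le>m. reordered_term u v w (m - w) $ t)"
    by (simp add: sum_reordered_term[symmetric] fps_sum_nth)
  also have "\<dots> = (\<Sum>(u, m, v, w)\<in>(SIGMA u:{..<N}. SIGMA m:{..<N}. SIGMA v:{..<N}. {..m}).
      reordered_term u v w (m - w) $ t)"
    by (simp add: sum.Sigma[symmetric] sum.cartesian_product[symmetric])
  \<comment> \<open>The new indices are the orders of the two star products on the other side:
    \<open>i = u + w\<close> pairings for \<theta>' and \<open>j = v + m\<close> for \<theta>. The
    tuples in \<open>S'\<close>, where one of these orders reaches \<open>N\<close>, vanish at
    \<open>t\<close>.\<close>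
  also have "\<dots> = (\<Sum>(i, j, k, w)\<in>(SIGMA i:{..<N}. SIGMA j:{..<N}. SIGMA k:{..j}. {..min i (j - k)}).
      reordered_term (i - w) (j - k - w) w k $ t)"
    by (rule sum.reindex_bij_witness_not_neutral[where T' = "{}"
          and S' = "(SIGMA u:{..<N}. SIGMA m:{..<N}. SIGMA v:{..<N}. {..m}) \<inter> {(u, m, v, w). N \<le> u + w \<or> N \<le> v + m}"
          and j = "\<lambda>(u, m, v, w). (u + w, v + m, m - w, w)" and i = "\<lambda>(i, j, k, w). (i - w, k + w, j - k - w, w)"])
      (use t in \<open>auto simp: reordered_term_nth\<close>)
  also have "\<dots> = (\<Sum>i<N. \<Sum>j<N. \<Sum>k\<le>j. \<Sum>w\<le>min i (j - k). reordered_term (i - w) (j - k - w) w k $ t)"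
    by (simp add: sum.Sigma[symmetric])
  also have "\<dots> = (\<Sum>j<N. \<Sum>i<N. star_term \<theta> j (star_term \<theta>' i a b) c $ t)"
    by (subst sum.swap) (simp add: fps_sum_nth star_term_star_term_left)
  also have "\<dots> = (\<Sum>j<N. star_term \<theta> j (\<Sum>i<N. star_term \<theta>' i a b) c $ t)"
    by (simp add: star_term_sum_left fps_sum_nth)
  also have "\<dots> = (\<Sum>j<N. star_term \<theta> j (star H \<theta>' a b) c $ t)"
    by (intro sum.cong refl star_term_cong[OF _ _ t]) (simp_all add: sum_nth[OF \<theta>'])
  also have "\<dots> = star H \<theta> (star H \<theta>' a b) c $ t"
    by (rule star_nth[OF \<theta> t, symmetric])
  finally show "star H \<theta>' a (star H \<theta> b c) $ t = star H \<theta> (star H \<theta>' a b) c $ t" .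
qed

end

end

text \<open>For \<theta> divisible by \<nu>, the denominator has constant coefficient 1 and is a
  unit, so the quotient is a genuine inverse and divisibility by \<nu> is kept.\<close>

lemma alpha_Theta: "\<theta> \<in> Theta \<Longrightarrow> alpha k \<theta> \<in> Theta"
  and alpha_times: "\<theta> \<in> Theta \<Longrightarrow> alpha k \<theta> * (1 + of_int k * \<theta>) = \<theta>"
proof -
  assume "\<theta> \<in> Theta"
  then obtain c where c: "\<theta> = fps_X * c" by (auto simp: Theta_def)
  have nz: "(1 + of_int k * \<theta>) $ 0 \<noteq> 0"
    by (simp add: c)
  have alpha: "alpha k \<theta> = \<theta> * inverse (1 + of_int k * \<theta>)"
    unfolding alpha_def by (rule fps_divide_unit[OF nz])
  then show "alpha k \<theta> * (1 + of_int k * \<theta>) = \<theta>"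
    using inverse_mult_eq_1[OF nz] by (simp add: mult.assoc)
  have "alpha k \<theta> = fps_X * (c * inverse (1 + of_int k * \<theta>))"
    unfolding mult.assoc[symmetric] c[symmetric] by (rule alpha)
  then show "alpha k \<theta> \<in> Theta"
    unfolding Theta_def by (rule range_eqI)
qed

section \<open>Completed tensor products and linear maps out of them\<close>

abbreviation nu_power :: "nat \<Rightarrow> complex fps" where "nu_power k \<equiv> fps_X ^ k"

definition nu_multiples :: "(complex fps, 'n, 'b) module_scheme \<Rightarrow> nat \<Rightarrow> 'n set" where
  "nu_multiples N k = (\<lambda>u. nu_power k \<odot>\<^bsub>N\<^esub> u) ` carrier N"

text \<open>Completeness is required for sequences whose m-th increment is a \<nu>^m-multiple, with
  a limit approached at the same rate. Every \<nu>-adic Cauchy sequence has such a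
  subsequence.\<close>

locale adic_module = module formal_scalars N for N :: "(complex fps, 'n, 'b) module_scheme" (structure) +
  assumes separated: "\<lbrakk>x \<in> carrier N; \<And>k. x \<in> nu_multiples N k\<rbrakk> \<Longrightarrow> x = \<zero>\<^bsub>N\<^esub>"
    and complete: "\<lbrakk>\<And>m. y m \<in> carrier N; \<And>m. y (Suc m) \<ominus>\<^bsub>N\<^esub> y m \<in> nu_multiples N m\<rbrakk> \<Longrightarrow>
      \<exists>z\<in>carrier N. \<forall>m. z \<ominus>\<^bsub>N\<^esub> y m \<in> nu_multiples N m"

lemma formal_scalars_simps [simp]:
  "carrier formal_scalars = UNIV" "c \<oplus>\<^bsub>formal_scalars\<^esub> d = c + d"
  "c \<otimes>\<^bsub>formal_scalars\<^esub> d = c * d" "\<one>\<^bsub>formal_scalars\<^esub> = 1"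
  by (auto simp: ring_of_type_algebra_def)

context adic_module begin

lemma nu_multiplesI: "u \<in> carrier N \<Longrightarrow> nu_power k \<odot> u \<in> nu_multiples N k"
  by (auto simp: nu_multiples_def)

lemma nu_multiples_zero: "\<zero> \<in> nu_multiples N k"
  by (auto simp: nu_multiples_def image_iff intro!: bexI[of _ \<zero>])

lemma nu_multiples_minus:
  "\<lbrakk>x \<in> nu_multiples N k; y \<in> nu_multiples N k\<rbrakk> \<Longrightarrow> x \<ominus> y \<in> nu_multiples N k"
proof -
  assume "x \<in> nu_multiples N k" "y \<in> nu_multiples N k"
  then obtain u v where "u \<in> carrier N" "v \<in> carrier N"
    "x = nu_power k \<odot> u" "y = nu_power k \<odot> v"
    by (auto simp: nu_multiples_def)
  then have "x \<ominus> y = nu_power k \<odot> (u \<ominus> v)" "u \<ominus> v \<in> carrier N"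
    by (simp_all add: a_minus_def smult_r_distr smult_r_minus)
  then show ?thesis by (auto simp: nu_multiples_def)
qed

lemma nu_multiples_closed: "x \<in> nu_multiples N k \<Longrightarrow> x \<in> carrier N"
  by (auto simp: nu_multiples_def)

lemma nu_multiples_uminus: "x \<in> nu_multiples N k \<Longrightarrow> \<ominus> x \<in> nu_multiples N k"
  using nu_multiples_minus[OF nu_multiples_zero, of x k] nu_multiples_closed[of x k]
  by (simp add: a_minus_def)

lemma nu_multiples_add:
  "\<lbrakk>x \<in> nu_multiples N k; y \<in> nu_multiples N k\<rbrakk> \<Longrightarrow> x \<oplus> y \<in> nu_multiples N k"
  using nu_multiples_minus[OF _ nu_multiples_uminus, of x k y] nu_multiples_closed
  by (simp add: a_minus_def)

lemma nu_multiples_smult: "x \<in> nu_multiples N k \<Longrightarrow> c \<odot> x \<in> nu_multiples N k"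
proof -
  assume "x \<in> nu_multiples N k"
  then obtain u where u: "u \<in> carrier N" "x = nu_power k \<odot> u"
    by (auto simp: nu_multiples_def)
  then have "c \<odot> x = nu_power k \<odot> (c \<odot> u)"
    using smult_assoc1[of c "nu_power k" u] smult_assoc1[of "nu_power k" c u] by (simp add: mult.commute)
  then show ?thesis using u by (auto simp: nu_multiples_def)
qed

lemma eq_if_minus_nu_multiples:
  assumes "x \<in> carrier N" "y \<in> carrier N" "\<And>k. x \<ominus> y \<in> nu_multiples N k"
  shows "x = y"
proof -
  have "x \<ominus> y = \<zero>"
    using separated[OF _ assms(3)] assms(1,2) by simp
  moreover have "x = (x \<ominus> y) \<oplus> y"
    using assms(1,2) by (simp add: minus_eq a_assoc l_neg)
  ultimately show ?thesis using assms(2) by simp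
qed

end

lemma (in abelian_group) minus_add_minus:
  "\<lbrakk>a \<in> carrier G; b \<in> carrier G; c \<in> carrier G; d \<in> carrier G\<rbrakk> \<Longrightarrow>
    (a \<oplus> b) \<ominus> (c \<oplus> d) = (a \<ominus> c) \<oplus> (b \<ominus> d)"
  by (simp add: a_minus_def minus_add a_ac)

lemma (in abelian_group) minus_minus_add:
  "\<lbrakk>a \<in> carrier G; b \<in> carrier G; c \<in> carrier G\<rbrakk> \<Longrightarrow> a \<ominus> b \<ominus> c = a \<ominus> (b \<oplus> c)"
  by (simp add: a_minus_def minus_add a_assoc)

lemma (in abelian_group) minus_minus_cancel:
  assumes "a \<in> carrier G" "b \<in> carrier G" "c \<in> carrier G"
  shows "(a \<ominus> c) \<ominus> (b \<ominus> c) = a \<ominus> b"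
proof -
  have "(a \<ominus> c) \<ominus> (b \<ominus> c) = (a \<ominus> b) \<oplus> (c \<oplus> \<ominus> c)"
    using assms by (simp add: a_minus_def minus_add a_ac del: r_neg)
  then show ?thesis using assms by (simp add: r_neg)
qed

text \<open>All relations in the presentations have one of two shapes: a generator equals a sum of
  two others, or two generators are equal. The predicate says that the values of \<open>f\<close>
  respect such a relation.\<close>

definition compatible ::
    "(complex fps, 'n, 'b) module_scheme \<Rightarrow> 'x set \<Rightarrow> ('x \<Rightarrow> 'n) \<Rightarrow> ('x \<Rightarrow>\<^sub>0 int) \<Rightarrow> bool" where
  "compatible N S f r \<longleftrightarrow>
    (\<exists>x\<in>S. \<exists>y\<in>S. \<exists>z\<in>S. r = frag_of x - frag_of y - frag_of z \<and> f x = f y \<oplus>\<^bsub>N\<^esub> f z) \<or>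
    (\<exists>x\<in>S. \<exists>y\<in>S. r = frag_of x - frag_of y \<and> f x = f y)"

lemma compatible_add:
  "\<lbrakk>x \<in> S; y \<in> S; z \<in> S; f x = f y \<oplus>\<^bsub>N\<^esub> f z\<rbrakk> \<Longrightarrow>
    compatible N S f (frag_of x - frag_of y - frag_of z)"
  unfolding compatible_def by blast

lemma compatible_eq: "\<lbrakk>x \<in> S; y \<in> S; f x = f y\<rbrakk> \<Longrightarrow> compatible N S f (frag_of x - frag_of y)"
  unfolding compatible_def by blast

section \<open>Presentations and their levels\<close>

text \<open>Conditions under which generators and relations present a module over the power series.
  Additivity in the scalar can hold only modulo relations, because the scalar of a generator is
  again a single generator.\<close>

locale tensor_pres =
  fixes P :: "'x tensor_presentation"
  assumes rels_keys: "r \<in> rels P \<Longrightarrow> Poly_Mapping.keys r \<subseteq> gens P"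
    and gen_scal_closed: "x \<in> gens P \<Longrightarrow> gen_scal P c x \<in> gens P"
    and gen_scal_mult: "x \<in> gens P \<Longrightarrow> gen_scal P (c * d) x = gen_scal P c (gen_scal P d x)"
    and gen_scal_one: "x \<in> gens P \<Longrightarrow> gen_scal P 1 x = x"
    and gen_scal_add: "x \<in> gens P \<Longrightarrow>
      frag_of (gen_scal P (c + d) x) - frag_of (gen_scal P c x) - frag_of (gen_scal P d x) \<in> rels P"
    and rels_scal: "r \<in> rels P \<Longrightarrow> frag_extend (frag_of \<circ> gen_scal P c) r \<in> rels P"
begin

abbreviation elems :: "('x \<Rightarrow>\<^sub>0 int) set" where
  "elems \<equiv> {f. Poly_Mapping.keys f \<subseteq> gens P}"

definition scale :: "complex fps \<Rightarrow> ('x \<Rightarrow>\<^sub>0 int) \<Rightarrow> ('x \<Rightarrow>\<^sub>0 int)" where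
  "scale c = frag_extend (frag_of \<circ> gen_scal P c)"

lemma scale_zero [simp]: "scale c 0 = 0"
  by (simp add: scale_def)

lemma scale_frag_of [simp]: "scale c (frag_of x) = frag_of (gen_scal P c x)"
  by (simp add: scale_def)

lemma scale_add: "scale c (f + g) = scale c f + scale c g"
  by (simp add: scale_def frag_extend_add)

lemma scale_diff: "scale c (f - g) = scale c f - scale c g"
  by (simp add: scale_def frag_extend_diff)

lemma elems_add: "\<lbrakk>f \<in> elems; g \<in> elems\<rbrakk> \<Longrightarrow> f + g \<in> elems"
  using keys_add[of f g] by auto

lemma elems_diff: "\<lbrakk>f \<in> elems; g \<in> elems\<rbrakk> \<Longrightarrow> f - g \<in> elems"
  using keys_diff[of f g] by auto

lemma elems_induct [consumes 1, case_names zero diff gen]: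
  assumes "f \<in> elems" "Q 0" "\<And>f g. \<lbrakk>f \<in> elems; g \<in> elems; Q f; Q g\<rbrakk> \<Longrightarrow> Q (f - g)"
    "\<And>x. x \<in> gens P \<Longrightarrow> Q (frag_of x)"
  shows "Q f"
  by (rule free_Abelian_group_induct[of f "gens P"]) (use assms in auto)

lemma scale_elems: "f \<in> elems \<Longrightarrow> scale c f \<in> elems"
proof (induction rule: elems_induct)
  case (diff f g)
  then show ?case using elems_diff by (simp only: scale_diff)
qed (auto simp: gen_scal_closed)

lemma scale_mult: "f \<in> elems \<Longrightarrow> scale (c * d) f = scale c (scale d f)"
  by (induction rule: elems_induct) (auto simp: scale_diff gen_scal_mult)

lemma scale_one: "f \<in> elems \<Longrightarrow> scale 1 f = f"
  by (induction rule: elems_induct) (auto simp: scale_diff gen_scal_one)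

text \<open>One step for differences replaces the inverse and product steps of
  \<open>generate\<close>. Membership in \<open>elems\<close> is carried along because it identifies
  the inverse of the free group with negation.\<close>

lemma level_induct [consumes 1, case_names zero rel gen diff]:
  assumes f: "f \<in> level P k" and "Q 0" and rel: "\<And>r. r \<in> rels P \<Longrightarrow> Q r"
    and gen: "\<And>x. x \<in> gens P \<Longrightarrow> Q (frag_of (gen_scal P (nu_power k) x))"
    and diff: "\<And>f g. \<lbrakk>f \<in> level P k; g \<in> level P k; f \<in> elems; g \<in> elems; Q f; Q g\<rbrakk> \<Longrightarrow> Q (f - g)"
  shows "f \<in> elems \<and> Q f"
  using f unfolding level_def
proof (induction rule: generate.induct)
  case one
  then show ?case using \<open>Q 0\<close> by simp
next
  case (incl h)
  then show ?case using rel gen rels_keys gen_scal_closed by auto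
next
  case (inv h)
  have 0: "0 \<in> level P k"
    unfolding level_def using generate.one[of "free_on P"] by simp
  have hl: "h \<in> level P k"
    unfolding level_def using generate.incl[OF inv] .
  have h: "h \<in> elems \<and> Q h"
    using inv rel gen rels_keys gen_scal_closed by auto
  then have "Q (0 - h)"
    using diff[OF 0 hl] \<open>Q 0\<close> by simp
  then show ?case using h by simp
next
  case (eng h1 h2)
  have 0: "0 \<in> level P k"
    unfolding level_def using generate.one[of "free_on P"] by simp
  have l: "h1 \<in> level P k" "h2 \<in> level P k"
    using eng by (auto simp: level_def)
  have m: "- h2 \<in> level P k"
  proof -
    have "inv\<^bsub>free_on P\<^esub> h2 \<in> generate (free_on P) (rels P \<union> {frag_of (gen_scal P (nu_power k) x) | x. x \<in> gens P})"
      using eng rels_keys gen_scal_closed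
      by (intro group.generate_m_inv_closed[OF group_free_Abelian_group]) auto
    then show ?thesis using eng by (simp add: level_def)
  qed
  have "Q (0 - h2)"
    using diff[OF 0 l(2)] \<open>Q 0\<close> eng by simp
  then have "Q (h1 - (- h2))"
    using diff[OF l(1) m] eng by simp
  then show ?case using eng elems_add by simp
qed

lemma level_elems: "f \<in> level P k \<Longrightarrow> f \<in> elems"
  by (erule level_induct[where Q = "\<lambda>_. True", THEN conjunct1]) auto

lemma level_subgroup: "subgroup (level P k) (free_on P)"
  unfolding level_def
  by (rule group.generate_is_subgroup[OF group_free_Abelian_group])
    (use rels_keys gen_scal_closed in auto)

lemma level_zero [simp]: "0 \<in> level P k"
  using subgroup.one_closed[OF level_subgroup] by simp

lemma level_add: "\<lbrakk>f \<in> level P k; g \<in> level P k\<rbrakk> \<Longrightarrow> f + g \<in> level P k"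
  using subgroup.m_closed[OF level_subgroup, of f k g] by simp

lemma level_uminus: "f \<in> level P k \<Longrightarrow> - f \<in> level P k"
  using subgroup.m_inv_closed[OF level_subgroup, of f k] level_elems[of f k] by simp

lemma level_diff: "\<lbrakk>f \<in> level P k; g \<in> level P k\<rbrakk> \<Longrightarrow> f - g \<in> level P k"
  using level_add[of f k "- g"] level_uminus[of g k] by simp

lemma level_rel: "r \<in> rels P \<Longrightarrow> r \<in> level P k"
  unfolding level_def by (rule generate.incl) auto

lemma level_gen: "x \<in> gens P \<Longrightarrow> frag_of (gen_scal P (nu_power k) x) \<in> level P k"
  unfolding level_def by (rule generate.incl) auto

lemma level_scale_nu: "f \<in> elems \<Longrightarrow> scale (nu_power k) f \<in> level P k"
  by (induction rule: elems_induct) (auto simp: scale_diff level_diff level_gen)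

lemma level_scale: "f \<in> level P k \<Longrightarrow> scale c f \<in> level P k"
proof (induction rule: level_induct[THEN conjunct2, consumes 1, case_names zero rel gen diff])
  case (rel r)
  then show ?case by (rule level_rel[OF rels_scal[folded scale_def]])
next
  case (gen x)
  then have "gen_scal P c (gen_scal P (nu_power k) x) = gen_scal P (nu_power k) (gen_scal P c x)"
    by (simp flip: gen_scal_mult add: mult.commute)
  then show ?case using gen level_gen[OF gen_scal_closed] by simp
qed (auto simp: scale_diff level_diff)

lemma level_Suc: "f \<in> level P (Suc k) \<Longrightarrow> f \<in> level P k"
proof (induction rule: level_induct[THEN conjunct2, consumes 1, case_names zero rel gen diff])
  case (gen x)
  then have "gen_scal P (nu_power (Suc k)) x = gen_scal P (nu_power k) (gen_scal P fps_X x)"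
    by (simp flip: gen_scal_mult add: mult.commute)
  then show ?case using gen level_gen[OF gen_scal_closed] by simp
qed (auto simp: level_rel level_diff)

text \<open>What remains after subtracting the \<nu>^k-multiple is a combination of relations, and
  these lie in every level. Hence the witness \<open>g\<close> serves all \<open>j\<close> at once,
  as the division in \<open>completed_nu_multiple\<close> demands.\<close>

lemma level_decomp:
  "f \<in> level P k \<Longrightarrow> \<exists>g\<in>elems. \<forall>j. f - scale (nu_power k) g \<in> level P j"
proof (induction rule: level_induct[THEN conjunct2, consumes 1, case_names zero rel gen diff])
  case zero
  then show ?case by (intro bexI[of _ 0]) auto
next
  case (rel r)
  then show ?case by (intro bexI[of _ 0]) (auto simp: level_rel)
next
  case (gen x)
  then show ?case by (intro bexI[of _ "frag_of x"]) auto
next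
  case (diff f g)
  then obtain f' g' where fg: "f' \<in> elems" "g' \<in> elems"
    "\<And>j. f - scale (nu_power k) f' \<in> level P j" "\<And>j. g - scale (nu_power k) g' \<in> level P j"
    by blast
  have "f - g - scale (nu_power k) (f' - g') \<in> level P j" for j
    using level_diff[OF fg(3,4)] by (simp add: scale_diff algebra_simps)
  then show ?case using elems_diff[OF fg(1,2)] by blast
qed

lemma scale_add_left: "f \<in> elems \<Longrightarrow> scale (c + d) f - scale c f - scale d f \<in> level P k"
proof (induction rule: elems_induct)
  case (diff f g)
  have "scale (c + d) (f - g) - scale c (f - g) - scale d (f - g) =
      (scale (c + d) f - scale c f - scale d f) - (scale (c + d) g - scale c g - scale d g)"
    by (simp add: scale_diff)
  then show ?case using level_diff[OF diff.IH] by simp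
qed (auto intro: level_rel gen_scal_add)

section \<open>The inverse limit and its topology\<close>

definition coset :: "nat \<Rightarrow> ('x \<Rightarrow>\<^sub>0 int) \<Rightarrow> ('x \<Rightarrow>\<^sub>0 int) set" where
  "coset k f = {g. g - f \<in> level P k}"

text \<open>A choice of one representative from each coset of an element of the inverse limit.
  Inclusions between cosets become memberships in levels, and operations are performed on
  representatives.\<close>

definition coherent :: "(nat \<Rightarrow> ('x \<Rightarrow>\<^sub>0 int)) \<Rightarrow> bool" where
  "coherent f \<longleftrightarrow> (\<forall>k. f k \<in> elems \<and> f (Suc k) - f k \<in> level P k)"

definition seq_class :: "(nat \<Rightarrow> ('x \<Rightarrow>\<^sub>0 int)) \<Rightarrow> nat \<Rightarrow> ('x \<Rightarrow>\<^sub>0 int) set" where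
  "seq_class f = (\<lambda>k. coset k (f k))"

lemma coset_self [simp]: "f \<in> coset k f"
  by (simp add: coset_def)

lemma coset_eq_iff: "coset k f = coset k g \<longleftrightarrow> f - g \<in> level P k"
proof
  assume "coset k f = coset k g"
  then show "f - g \<in> level P k" using coset_self[of f k] by (simp add: coset_def)
next
  assume *: "f - g \<in> level P k"
  show "coset k f = coset k g"
    unfolding coset_def
  proof (intro Collect_cong iffI)
    fix h
    show "h - f \<in> level P k \<Longrightarrow> h - g \<in> level P k"
      using level_add[OF _ *, of "h - f"] by simp
    show "h - g \<in> level P k \<Longrightarrow> h - f \<in> level P k"
      using level_diff[OF _ *, of "h - g"] by simp
  qed
qed

lemma r_coset_eq: "level P k #>\<^bsub>free_on P\<^esub> f = coset k f"
  by (force simp: r_coset_def coset_def image_iff)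

lemma set_mult_coset: "coset k f <#>\<^bsub>free_on P\<^esub> coset k g = coset k (f + g)"
proof
  show "coset k f <#>\<^bsub>free_on P\<^esub> coset k g \<subseteq> coset k (f + g)"
  proof
    fix h assume "h \<in> coset k f <#>\<^bsub>free_on P\<^esub> coset k g"
    then obtain a b where "h = a + b" "a - f \<in> level P k" "b - g \<in> level P k"
      by (auto simp: set_mult_def coset_def)
    then show "h \<in> coset k (f + g)"
      using level_add[of "a - f" k "b - g"] by (simp add: coset_def algebra_simps)
  qed
  show "coset k (f + g) \<subseteq> coset k f <#>\<^bsub>free_on P\<^esub> coset k g"
  proof
    fix h assume "h \<in> coset k (f + g)"
    then have "h - g \<in> coset k f"
      by (simp add: coset_def algebra_simps)
    then show "h \<in> coset k f <#>\<^bsub>free_on P\<^esub> coset k g"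
      unfolding set_mult_def using coset_self[of g k] by force
  qed
qed

text \<open>\<open>B\<close> need not be a full coset: it is applied to the image of a coset under
  scaling and to a coset of a smaller level.\<close>

lemma level_set_mult:
  assumes "f \<in> B" "\<And>g. g \<in> B \<Longrightarrow> g - f \<in> level P k"
  shows "level P k <#>\<^bsub>free_on P\<^esub> B = coset k f"
proof
  show "level P k <#>\<^bsub>free_on P\<^esub> B \<subseteq> coset k f"
  proof
    fix h assume "h \<in> level P k <#>\<^bsub>free_on P\<^esub> B"
    then obtain a b where "h = a + b" "a \<in> level P k" "b - f \<in> level P k"
      using assms by (auto simp: set_mult_def)
    then show "h \<in> coset k f"
      using level_add[of a k "b - f"] by (simp add: coset_def algebra_simps)
  qed
  show "coset k f \<subseteq> level P k <#>\<^bsub>free_on P\<^esub> B"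
  proof
    fix h assume "h \<in> coset k f"
    then have "h - f \<in> level P k" "h = (h - f) + f"
      by (auto simp: coset_def)
    then show "h \<in> level P k <#>\<^bsub>free_on P\<^esub> B"
      unfolding set_mult_def using assms(1) by (auto intro: bexI[of _ "h - f"])
  qed
qed

lemma seq_class_eq_iff: "seq_class f = seq_class g \<longleftrightarrow> (\<forall>k. f k - g k \<in> level P k)"
  by (auto simp: seq_class_def fun_eq_iff coset_eq_iff)

lemma coherent_level:
  assumes "coherent f"
  shows "f (k + m) - f k \<in> level P k"
proof (induction m)
  case (Suc m)
  have "f (Suc (k + m)) - f (k + m) \<in> level P (k + m)"
    using assms by (simp add: coherent_def)
  moreover have "h \<in> level P (k + m) \<Longrightarrow> h \<in> level P k" for h
    by (induction m) (auto dest: level_Suc)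
  ultimately show ?case
    using level_add[of "f (Suc (k + m)) - f (k + m)" k "f (k + m) - f k"] Suc by simp
qed simp

lemma coherent_add: "\<lbrakk>coherent f; coherent g\<rbrakk> \<Longrightarrow> coherent (\<lambda>k. f k + g k)"
  unfolding coherent_def
proof (intro allI conjI)
  fix k
  assume *: "\<forall>k. f k \<in> elems \<and> f (Suc k) - f k \<in> level P k"
    "\<forall>k. g k \<in> elems \<and> g (Suc k) - g k \<in> level P k"
  then show "f k + g k \<in> elems" using elems_add by blast
  show "f (Suc k) + g (Suc k) - (f k + g k) \<in> level P k"
    using level_add[of "f (Suc k) - f k" k "g (Suc k) - g k"] * by (simp add: algebra_simps)
qed

lemma coherent_scale: "coherent f \<Longrightarrow> coherent (\<lambda>k. scale c (f k))"
  unfolding coherent_def using scale_elems level_scale by (metis scale_diff)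

lemma coherent_uminus: "coherent f \<Longrightarrow> coherent (\<lambda>k. - f k)"
  unfolding coherent_def using level_uminus[of "f (Suc k) - f k" k for k] by simp

lemma coherent_const: "f \<in> elems \<Longrightarrow> coherent (\<lambda>_. f)"
  by (simp add: coherent_def)

lemma completed_carrier: "carrier (completed P) = {seq_class f | f. coherent f}"
proof (intro equalityI subsetI)
  fix s assume s: "s \<in> carrier (completed P)"
  then have "\<exists>f\<in>elems. s k = coset k f" for k
  proof -
    have "s k \<in> rcosets\<^bsub>free_on P\<^esub> (level P k)" using s by (simp add: completed_def)
    then obtain x where "x \<in> elems" "s k = coset k x"
      by (auto simp: RCOSETS_def r_coset_eq)
    then show ?thesis by (rule bexI[rotated])
  qed
  then obtain f where f: "\<And>k. f k \<in> elems" "\<And>k. s k = coset k (f k)"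
    by metis
  have "f (Suc k) - f k \<in> level P k" for k
  proof -
    have "coset (Suc k) (f (Suc k)) \<subseteq> coset k (f k)"
      using s by (simp add: completed_def f)
    then have "f (Suc k) \<in> coset k (f k)" using coset_self by blast
    then show ?thesis by (simp add: coset_def)
  qed
  then have "coherent f" using f by (auto simp: coherent_def)
  moreover have "s = seq_class f" using f by (auto simp: seq_class_def)
  ultimately show "s \<in> {seq_class f | f. coherent f}" by blast
next
  fix s assume "s \<in> {seq_class f | f. coherent f}"
  then obtain f where f: "coherent f" "s = seq_class f" by blast
  have "coset (Suc k) (f (Suc k)) \<subseteq> coset k (f k)" for k
  proof
    fix g assume "g \<in> coset (Suc k) (f (Suc k))"
    then have "g - f (Suc k) \<in> level P k" by (auto simp: coset_def dest: level_Suc)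
    then show "g \<in> coset k (f k)"
      using f level_add[of "g - f (Suc k)" k "f (Suc k) - f k"] by (simp add: coset_def coherent_def)
  qed
  moreover have "coset k (f k) \<in> rcosets\<^bsub>free_on P\<^esub> (level P k)" for k
    using f by (auto simp: RCOSETS_def r_coset_eq coherent_def)
  ultimately show "s \<in> carrier (completed P)"
    by (auto simp: completed_def f seq_class_def)
qed

lemma completed_zero: "\<zero>\<^bsub>completed P\<^esub> = seq_class (\<lambda>_. 0)"
  by (auto simp: completed_def seq_class_def coset_def)

lemma completed_add: "seq_class f \<oplus>\<^bsub>completed P\<^esub> seq_class g = seq_class (\<lambda>k. f k + g k)"
  by (simp add: completed_def seq_class_def set_mult_coset)

lemma completed_smult: "c \<odot>\<^bsub>completed P\<^esub> seq_class f = seq_class (\<lambda>k. scale c (f k))"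
proof -
  have "level P k <#>\<^bsub>free_on P\<^esub> scale c ` coset k (f k) = coset k (scale c (f k))" for k
    by (rule level_set_mult) (auto simp: coset_def intro: level_scale simp flip: scale_diff)
  then show ?thesis
    by (simp add: completed_def seq_class_def flip: scale_def)
qed

lemma pure_tensor_eq: "pure_tensor P x = seq_class (\<lambda>_. frag_of x)"
  by (simp add: pure_tensor_def seq_class_def r_coset_eq)

lemma pure_tensor_closed: "x \<in> gens P \<Longrightarrow> pure_tensor P x \<in> carrier (completed P)"
  by (auto simp: completed_carrier pure_tensor_eq intro!: exI[of _ "\<lambda>_. frag_of x"] coherent_const)

lemma completed_module: "module formal_scalars (completed P)"
proof (intro moduleI abelian_groupI)
  show "cring formal_scalars" by (rule cring_from_type_algebra)
  note simps = completed_carrier completed_zero completed_add completed_smult ring_of_type_algebra_def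
  show "\<zero>\<^bsub>completed P\<^esub> \<in> carrier (completed P)"
    by (auto simp: simps intro!: exI[of _ "\<lambda>_. 0"] coherent_const)
  fix s t u assume s: "s \<in> carrier (completed P)"
  then obtain f where f: "s = seq_class f" "coherent f" by (auto simp: completed_carrier)
  show "\<zero>\<^bsub>completed P\<^esub> \<oplus>\<^bsub>completed P\<^esub> s = s" by (simp add: f simps)
  show "\<exists>y\<in>carrier (completed P). y \<oplus>\<^bsub>completed P\<^esub> s = \<zero>\<^bsub>completed P\<^esub>"
    using coherent_uminus[OF f(2)]
    by (intro bexI[of _ "seq_class (\<lambda>k. - f k)"]) (auto simp: f simps)
  show "\<one>\<^bsub>formal_scalars\<^esub> \<odot>\<^bsub>completed P\<^esub> s = s"
    using f(2) by (simp add: f(1) simps scale_one coherent_def)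
  fix c d :: "complex fps"
  show "c \<odot>\<^bsub>completed P\<^esub> s \<in> carrier (completed P)"
    using f coherent_scale by (auto simp: simps)
  show "(c \<otimes>\<^bsub>formal_scalars\<^esub> d) \<odot>\<^bsub>completed P\<^esub> s = c \<odot>\<^bsub>completed P\<^esub> (d \<odot>\<^bsub>completed P\<^esub> s)"
    using f(2) by (simp add: f(1) simps scale_mult coherent_def)
  show "(c \<oplus>\<^bsub>formal_scalars\<^esub> d) \<odot>\<^bsub>completed P\<^esub> s
      = c \<odot>\<^bsub>completed P\<^esub> s \<oplus>\<^bsub>completed P\<^esub> d \<odot>\<^bsub>completed P\<^esub> s"
    using f(2) scale_add_left by (simp add: f(1) simps seq_class_eq_iff coherent_def flip: diff_diff_eq)
  assume t: "t \<in> carrier (completed P)"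
  then obtain g where g: "t = seq_class g" "coherent g" by (auto simp: completed_carrier)
  show "s \<oplus>\<^bsub>completed P\<^esub> t \<in> carrier (completed P)"
    using coherent_add[OF f(2) g(2)] by (auto simp: simps f g)
  show "s \<oplus>\<^bsub>completed P\<^esub> t = t \<oplus>\<^bsub>completed P\<^esub> s"
    by (simp add: f g simps add.commute)
  show "c \<odot>\<^bsub>completed P\<^esub> (s \<oplus>\<^bsub>completed P\<^esub> t)
      = c \<odot>\<^bsub>completed P\<^esub> s \<oplus>\<^bsub>completed P\<^esub> c \<odot>\<^bsub>completed P\<^esub> t"
    by (simp add: f g simps scale_add)
  assume "u \<in> carrier (completed P)"
  then obtain h where h: "u = seq_class h" by (auto simp: completed_carrier)
  show "s \<oplus>\<^bsub>completed P\<^esub> t \<oplus>\<^bsub>completed P\<^esub> u = s \<oplus>\<^bsub>completed P\<^esub> (t \<oplus>\<^bsub>completed P\<^esub> u)"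
    by (simp add: f g h simps add.assoc)
qed

lemma completed_minus:
  assumes "coherent f" "coherent g"
  shows "seq_class f \<ominus>\<^bsub>completed P\<^esub> seq_class g = seq_class (\<lambda>k. f k - g k)"
proof -
  interpret C: module formal_scalars "completed P" by (rule completed_module)
  have *: "seq_class (\<lambda>k. - g k) \<in> carrier (completed P)" "seq_class g \<in> carrier (completed P)"
    using coherent_uminus[OF assms(2)] assms(2) by (auto simp: completed_carrier)
  have "\<ominus>\<^bsub>completed P\<^esub> seq_class g = seq_class (\<lambda>k. - g k)"
    using * by (intro C.minus_equality) (auto simp: completed_add completed_zero)
  then show ?thesis by (simp add: a_minus_def completed_add)
qed

text \<open>Telescoping: writing the increments of a coherent sequence beyond index \<open>k\<close> as multiples of
  \<open>\<nu>\<close>-powers and dividing by \<open>\<nu>^k\<close> gives a coherent sequence again.\<close>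

lemma completed_nu_multiple:
  assumes f: "coherent f" and k: "f k \<in> level P k"
  shows "seq_class f \<in> nu_multiples (completed P) k"
proof -
  obtain e0 where e0: "e0 \<in> elems" "\<And>j. f k - scale (nu_power k) e0 \<in> level P j"
    using level_decomp[OF k] by blast
  have "\<exists>g\<in>elems. \<forall>j. (f (Suc (k + m)) - f (k + m)) - scale (nu_power (k + m)) g \<in> level P j" for m
    using f by (intro level_decomp) (auto simp: coherent_def)
  then obtain e where e: "\<And>m. e m \<in> elems"
    "\<And>m j. (f (Suc (k + m)) - f (k + m)) - scale (nu_power (k + m)) (e m) \<in> level P j"
    by metis
  \<comment> \<open>The quotient of \<open>f (k + j)\<close> by \<nu>^k modulo relations: the m-th
    increment is \<nu>^(k+m) times \<open>e m\<close>, so \<nu>^m times \<open>e m\<close> is left.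
    Its increments put \<open>g\<close> in the inverse limit.\<close>
  define g where "g j = e0 + (\<Sum>m<j. scale (nu_power m) (e m))" for j
  have g_elems: "g j \<in> elems" for j
  proof (induction j)
    case (Suc j)
    then show ?case
      using elems_add[OF Suc scale_elems[OF e(1)]] by (simp add: g_def algebra_simps)
  qed (simp add: g_def e0(1)[simplified])
  have "coherent g"
    unfolding coherent_def using g_elems level_scale_nu[OF e(1)] by (simp add: g_def)
  moreover have step: "f (k + j) - scale (nu_power k) (g j) \<in> level P i" for i j
  proof (induction j)
    case 0
    then show ?case using e0 by (simp add: g_def)
  next
    case (Suc j)
    have "scale (nu_power k) (g (Suc j)) = scale (nu_power k) (g j) + scale (nu_power (k + j)) (e j)"
      using e(1)[of j] by (simp add: g_def scale_add scale_mult power_add add.assoc)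
    then show ?case
      using level_add[OF Suc e(2)[of j i]] by (simp add: algebra_simps)
  qed
  \<comment> \<open>\<open>g j\<close> has been matched with \<open>f (k + j)\<close>, which
    coherence identifies with \<open>f j\<close> at level \<open>j\<close>.\<close>
  moreover have "f j - scale (nu_power k) (g j) \<in> level P j" for j
    using level_diff[OF step[of j j] coherent_level[OF f, of j k]] by (simp add: add.commute)
  then have "seq_class f = nu_power k \<odot>\<^bsub>completed P\<^esub> seq_class g"
    by (simp add: completed_smult seq_class_eq_iff)
  ultimately show ?thesis
    by (auto simp: nu_multiples_def completed_carrier)
qed

text \<open>The \<nu>-adic topology of the inverse limit coincides with the limit topology: being a
  \<nu>^k-multiple is a condition on the k-th component alone.\<close>

lemma completed_nu_multiple_iff:
  assumes f: "coherent f"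
  shows "seq_class f \<in> nu_multiples (completed P) k \<longleftrightarrow> f k \<in> level P k"
proof
  assume "seq_class f \<in> nu_multiples (completed P) k"
  then obtain g where g: "coherent g" "seq_class f = seq_class (\<lambda>j. scale (nu_power k) (g j))"
    by (auto simp: nu_multiples_def completed_carrier completed_smult)
  then have "f k - scale (nu_power k) (g k) \<in> level P k"
    by (simp add: seq_class_eq_iff)
  moreover have "scale (nu_power k) (g k) \<in> level P k"
    using g(1) by (intro level_scale_nu) (auto simp: coherent_def)
  ultimately show "f k \<in> level P k"
    using level_add by fastforce
qed (rule completed_nu_multiple[OF f])

lemma completed_adic_module: "adic_module (completed P)"
proof (intro adic_module.intro adic_module_axioms.intro completed_module)
  fix s assume "s \<in> carrier (completed P)" and s: "\<And>k. s \<in> nu_multiples (completed P) k"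
  then obtain f where f: "s = seq_class f" "coherent f" by (auto simp: completed_carrier)
  then show "s = \<zero>\<^bsub>completed P\<^esub>"
    using s by (simp add: completed_zero seq_class_eq_iff completed_nu_multiple_iff)
next
  fix y assume "\<And>m. y m \<in> carrier (completed P)"
    and y: "\<And>m. y (Suc m) \<ominus>\<^bsub>completed P\<^esub> y m \<in> nu_multiples (completed P) m"
  then have "\<exists>f. y m = seq_class f \<and> coherent f" for m by (auto simp: completed_carrier)
  then obtain f where f: "\<And>m. y m = seq_class (f m)" "\<And>m. coherent (f m)" by metis
  have coh_diff: "coherent (\<lambda>k. g k - h k)" if "coherent g" "coherent h" for g h
    using coherent_add[OF that(1) coherent_uminus[OF that(2)]] by simp
  have step: "f (Suc m) m - f m m \<in> level P m" for m
    using y[of m] coh_diff[OF f(2) f(2)] by (simp add: f completed_minus completed_nu_multiple_iff)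
  \<comment> \<open>The limit is the diagonal sequence: modulo \<nu>^m it has the same component as
    \<open>y m\<close>.\<close>
  define z where "z m = f m m" for m
  have "z (Suc k) - z k \<in> level P k" for k
    using level_add[OF _ step[of k], of "f (Suc k) (Suc k) - f (Suc k) k"] f(2)[of "Suc k"]
    by (simp add: z_def coherent_def)
  then have z: "coherent z"
    using f(2) by (simp add: coherent_def z_def)
  have "seq_class z \<ominus>\<^bsub>completed P\<^esub> y m \<in> nu_multiples (completed P) m" for m
    using coh_diff[OF z f(2)] by (simp add: f z completed_minus completed_nu_multiple_iff) (simp add: z_def)
  then show "\<exists>z\<in>carrier (completed P). \<forall>m. z \<ominus>\<^bsub>completed P\<^esub> y m \<in> nu_multiples (completed P) m"
    using z by (auto simp: completed_carrier)
qed


section \<open>Linear maps out of a completed tensor product\<close>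

lemma hom_diff:
  assumes N: "abelian_group N" and h: "h \<in> hom (free_on P) (add_monoid N)"
    and fg: "f \<in> elems" "g \<in> elems"
  shows "h (f - g) = h f \<ominus>\<^bsub>N\<^esub> h g"
proof -
  interpret N: abelian_group N by (rule N)
  have cl: "h f \<in> carrier N" "h g \<in> carrier N" "h (f - g) \<in> carrier N"
    using h fg elems_diff[OF fg] by (auto simp: hom_def)
  have "h ((f - g) + g) = h (f - g) \<oplus>\<^bsub>N\<^esub> h g"
    using h fg elems_diff[OF fg] hom_mult[OF h, of "f - g" g] by simp
  then show ?thesis using cl by (simp add: N.minus_eq N.a_assoc N.r_neg)
qed

text \<open>Linearity carries \<nu>^k-multiples to \<nu>^k-multiples, which is continuity. Since
  integer combinations of pure tensors approximate every element, separatedness of \<open>N\<close>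
  does the rest.\<close>

lemma series_linear_maps_eqI:
  assumes N: "adic_module N"
    and lin: "\<phi> \<in> series_linear_maps (completed P) N" "\<psi> \<in> series_linear_maps (completed P) N"
    and pure: "\<And>x. x \<in> gens P \<Longrightarrow> \<phi> (pure_tensor P x) = \<psi> (pure_tensor P x)"
    and s: "s \<in> carrier (completed P)"
  shows "\<phi> s = \<psi> s"
proof -
  interpret N: adic_module N by (rule N)
  interpret C: module formal_scalars "completed P" by (rule completed_module)
  have add: "\<chi> (x \<oplus>\<^bsub>completed P\<^esub> y) = \<chi> x \<oplus>\<^bsub>N\<^esub> \<chi> y"
    and smult: "\<chi> (c \<odot>\<^bsub>completed P\<^esub> x) = c \<odot>\<^bsub>N\<^esub> \<chi> x"
    and cl: "\<chi> x \<in> carrier N"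
    if "\<chi> = \<phi> \<or> \<chi> = \<psi>" "x \<in> carrier (completed P)" "y \<in> carrier (completed P)" for \<chi> x y c
    using that lin by (auto simp: series_linear_maps_def)
  have minus: "\<chi> (x \<ominus>\<^bsub>completed P\<^esub> y) = \<chi> x \<ominus>\<^bsub>N\<^esub> \<chi> y"
    if "\<chi> = \<phi> \<or> \<chi> = \<psi>" "x \<in> carrier (completed P)" "y \<in> carrier (completed P)" for \<chi> x y
  proof -
    have "\<chi> (x \<ominus>\<^bsub>completed P\<^esub> y) \<oplus>\<^bsub>N\<^esub> \<chi> y = \<chi> x"
      using that by (simp flip: add add: C.minus_eq C.a_assoc C.l_neg)
    then show ?thesis
      using cl[OF that] cl[OF that(1,3,2)] cl[OF that(1) C.minus_closed[OF that(2,3)] that(2)]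
      by (metis N.minus_eq N.add.inv_solve_right)
  qed
  have const: "seq_class (\<lambda>_. f) \<in> carrier (completed P) \<and> \<phi> (seq_class (\<lambda>_. f)) = \<psi> (seq_class (\<lambda>_. f))"
    if "f \<in> elems" for f
    using that
  proof (induction rule: elems_induct)
    case zero
    have "\<chi> \<zero>\<^bsub>completed P\<^esub> = \<zero>\<^bsub>N\<^esub>" if "\<chi> = \<phi> \<or> \<chi> = \<psi>" for \<chi>
      using minus[OF that C.zero_closed C.zero_closed] cl[OF that C.zero_closed C.zero_closed]
        C.r_neg[OF C.zero_closed]
      by (simp only: C.minus_eq N.minus_eq N.r_neg)
    from this[of \<phi>] this[of \<psi>] show ?case by (simp flip: completed_zero)
  next
    case (diff f g)
    then have "seq_class (\<lambda>_. f - g) = seq_class (\<lambda>_. f) \<ominus>\<^bsub>completed P\<^esub> seq_class (\<lambda>_. g)"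
      by (intro completed_minus[symmetric] coherent_const)
    then show ?case using diff by (simp add: minus)
  next
    case (gen x)
    then show ?case using pure pure_tensor_closed by (simp flip: pure_tensor_eq)
  qed
  obtain f where f: "s = seq_class f" "coherent f" using s by (auto simp: completed_carrier)
  have "\<phi> s \<ominus>\<^bsub>N\<^esub> \<psi> s \<in> nu_multiples N k" for k
  proof -
    have fk: "f k \<in> elems" using f(2) by (auto simp: coherent_def)
    \<comment> \<open>An integer combination of pure tensors that agrees with \<open>s\<close>
      modulo \<nu>^k, since both have the component \<open>f k\<close>.\<close>
    let ?c = "seq_class (\<lambda>_. f k)"
    have cf: "coherent (\<lambda>j. f j - f k)"
      using coherent_add[OF f(2) coherent_uminus[OF coherent_const[OF fk]]] by simp
    have "s \<ominus>\<^bsub>completed P\<^esub> ?c \<in> nu_multiples (completed P) k"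
      by (simp add: f completed_minus coherent_const[OF fk] completed_nu_multiple_iff cf)
    then obtain u where u: "u \<in> carrier (completed P)"
      "s \<ominus>\<^bsub>completed P\<^esub> ?c = nu_power k \<odot>\<^bsub>completed P\<^esub> u"
      by (auto simp: nu_multiples_def)
    have c: "?c \<in> carrier (completed P)" using const[OF fk] by simp
    have *: "\<chi> s = nu_power k \<odot>\<^bsub>N\<^esub> \<chi> u \<oplus>\<^bsub>N\<^esub> \<chi> ?c" if "\<chi> = \<phi> \<or> \<chi> = \<psi>" for \<chi>
    proof -
      have "s = nu_power k \<odot>\<^bsub>completed P\<^esub> u \<oplus>\<^bsub>completed P\<^esub> ?c"
        using s c by (simp flip: u(2) add: C.minus_eq C.a_assoc C.l_neg)
      then show ?thesis
        using u(1) c add[OF that, of "nu_power k \<odot>\<^bsub>completed P\<^esub> u" ?c] smult[OF that u(1) u(1)]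
        by simp
    qed
    have cls: "\<phi> u \<in> carrier N" "\<psi> u \<in> carrier N" "\<psi> ?c \<in> carrier N"
      using cl u(1) c by auto
    then have "\<phi> s \<ominus>\<^bsub>N\<^esub> \<psi> s = nu_power k \<odot>\<^bsub>N\<^esub> \<phi> u \<ominus>\<^bsub>N\<^esub> nu_power k \<odot>\<^bsub>N\<^esub> \<psi> u"
      using const[OF fk]
      by (simp add: * N.minus_add_minus) (simp add: N.minus_eq N.r_neg)
    then show ?thesis
      using cls by (simp add: N.nu_multiples_minus N.nu_multiplesI)
  qed
  then show ?thesis
    using cl s by (intro N.eq_if_minus_nu_multiples) auto
qed

text \<open>The prescribed values extend to the free abelian group, and then by continuity: along a
  coherent sequence the images form a Cauchy sequence in \<open>N\<close>, whose limit is the value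
  of the map.\<close>

lemma tensor_maps_ex1:
  assumes N: "adic_module N"
    and f: "\<And>x. x \<in> gens P \<Longrightarrow> f x \<in> carrier N"
    and f_scal: "\<And>c x. x \<in> gens P \<Longrightarrow> f (gen_scal P c x) = c \<odot>\<^bsub>N\<^esub> f x"
    and f_rel: "\<And>r. r \<in> rels P \<Longrightarrow> compatible N (gens P) f r"
  shows "\<exists>!\<phi>. \<phi> \<in> tensor_maps P N f"
proof -
  interpret N: adic_module N by (rule N)
  interpret C: module formal_scalars "completed P" by (rule completed_module)
  obtain h where h: "h \<in> hom (free_on P) (add_monoid N)" "\<And>x. x \<in> gens P \<Longrightarrow> h (frag_of x) = f x"
    by (rule comm_group.free_Abelian_group_universal[OF N.a_comm_group, of f "gens P"]) (use f in auto)
  have h_cl: "h a \<in> carrier N" if "a \<in> elems" for a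
    using h(1) that by (auto simp: hom_def)
  note h_diff = hom_diff[OF N.abelian_group_axioms h(1)]
  have h_add: "h (a + b) = h a \<oplus>\<^bsub>N\<^esub> h b" if "a \<in> elems" "b \<in> elems" for a b
    using hom_mult[OF h(1), of a b] that by simp
  have h_zero: "h 0 = \<zero>\<^bsub>N\<^esub>"
    using h_diff[of 0 0] h_cl[of 0] by (simp add: N.minus_eq N.r_neg)
  have h_scale: "h (scale c a) = c \<odot>\<^bsub>N\<^esub> h a" if "a \<in> elems" for a c
    using that
  proof (induction rule: elems_induct)
    case (diff a b)
    have "h (scale c (a - b)) = c \<odot>\<^bsub>N\<^esub> h a \<ominus>\<^bsub>N\<^esub> c \<odot>\<^bsub>N\<^esub> h b"
      using diff h_diff[OF scale_elems scale_elems] by (simp add: scale_diff)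
    then show ?case
      using diff h_cl by (simp add: h_diff N.minus_eq N.smult_r_distr N.smult_r_minus)
  qed (auto simp: h_zero h f_scal gen_scal_closed)
  have h_rel: "h r = \<zero>\<^bsub>N\<^esub>" if "r \<in> rels P" for r
    using f_rel[OF that] unfolding compatible_def
  proof (elim disjE bexE conjE)
    fix x y z
    assume *: "x \<in> gens P" "y \<in> gens P" "z \<in> gens P" "r = frag_of x - frag_of y - frag_of z"
      "f x = f y \<oplus>\<^bsub>N\<^esub> f z"
    then have "frag_of x - frag_of y \<in> elems" by (intro elems_diff) auto
    then have "h r = f x \<ominus>\<^bsub>N\<^esub> f y \<ominus>\<^bsub>N\<^esub> f z"
      using * by (simp add: h_diff h)
    then show ?thesis
      using f * by (simp add: N.minus_minus_add) (simp add: N.minus_eq N.r_neg)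
  next
    fix x y
    assume "x \<in> gens P" "y \<in> gens P" "r = frag_of x - frag_of y" "f x = f y"
    then show ?thesis using f by (simp add: h_diff h N.minus_eq N.r_neg)
  qed
  \<comment> \<open>Relations go to zero and \<nu>^k-multiples to \<nu>^k-multiples, so
    \<open>h\<close> induces maps between the quotients modulo \<nu>^k.\<close>
  have h_level: "h a \<in> nu_multiples N k" if "a \<in> level P k" for a k
    using that
  proof (induction rule: level_induct[THEN conjunct2, consumes 1, case_names zero rel gen diff])
    case (rel r)
    then show ?case using h_rel N.nu_multiples_zero by simp
  next
    case (gen x)
    then show ?case using f by (auto simp: h gen_scal_closed f_scal nu_multiples_def)
  qed (auto simp: h_zero h_diff N.nu_multiples_zero N.nu_multiples_minus)
  \<comment> \<open>Quantifying over all members of the cosets makes the limit independent of the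
    representatives; \<open>limI\<close> shows that checking one coherent choice suffices.\<close>
  define lim where "lim s y \<longleftrightarrow> y \<in> carrier N \<and> (\<forall>k. \<forall>a\<in>s k. y \<ominus>\<^bsub>N\<^esub> h a \<in> nu_multiples N k)" for s y
  have limI: "lim (seq_class g) y" if g: "coherent g" and y: "y \<in> carrier N"
    and l: "\<And>k. y \<ominus>\<^bsub>N\<^esub> h (g k) \<in> nu_multiples N k" for g y
    unfolding lim_def
  proof (intro conjI allI ballI y)
    fix k a assume "a \<in> seq_class g k"
    then have a: "a - g k \<in> level P k" by (simp add: seq_class_def coset_def)
    have gk: "g k \<in> elems" using g by (simp add: coherent_def)
    have a': "a \<in> elems" using level_elems[OF a] gk elems_add[of "a - g k" "g k"] by simp
    have "y \<ominus>\<^bsub>N\<^esub> h a = (y \<ominus>\<^bsub>N\<^esub> h (g k)) \<ominus>\<^bsub>N\<^esub> h (a - g k)"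
      using y h_cl[OF gk] h_cl[OF a']
      by (simp add: h_diff[OF a' gk] N.minus_minus_cancel)
    then show "y \<ominus>\<^bsub>N\<^esub> h a \<in> nu_multiples N k"
      using l[of k] h_level[OF a] by (simp add: N.nu_multiples_minus)
  qed
  have lim_ex: "\<exists>y. lim s y" if s: "s \<in> carrier (completed P)" for s
  proof -
    obtain g where g: "s = seq_class g" "coherent g" using s by (auto simp: completed_carrier)
    have ge: "g k \<in> elems" "g (Suc k) - g k \<in> level P k" for k using g(2) by (auto simp: coherent_def)
    have "\<exists>z\<in>carrier N. \<forall>m. z \<ominus>\<^bsub>N\<^esub> h (g m) \<in> nu_multiples N m"
      using h_cl ge(1) h_level[OF ge(2)] by (intro N.complete) (auto simp flip: h_diff)
    then show ?thesis using limI g by blast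
  qed
  have lim_unique: "y = z" if s: "s \<in> carrier (completed P)" and yz: "lim s y" "lim s z" for s y z
  proof (rule N.eq_if_minus_nu_multiples)
    show cl: "y \<in> carrier N" "z \<in> carrier N" using yz by (auto simp: lim_def)
    fix k
    obtain g where g: "s = seq_class g" "coherent g" using s by (auto simp: completed_carrier)
    then have "g k \<in> s k" and gk: "h (g k) \<in> carrier N"
      using h_cl by (auto simp: seq_class_def coherent_def)
    then have "(y \<ominus>\<^bsub>N\<^esub> h (g k)) \<ominus>\<^bsub>N\<^esub> (z \<ominus>\<^bsub>N\<^esub> h (g k)) \<in> nu_multiples N k"
      using yz by (simp add: lim_def N.nu_multiples_minus)
    also have "(y \<ominus>\<^bsub>N\<^esub> h (g k)) \<ominus>\<^bsub>N\<^esub> (z \<ominus>\<^bsub>N\<^esub> h (g k)) = y \<ominus>\<^bsub>N\<^esub> z"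
      using cl gk by (rule N.minus_minus_cancel)
    finally show "y \<ominus>\<^bsub>N\<^esub> z \<in> nu_multiples N k" .
  qed
  \<comment> \<open>Restriction to the carrier places the map among the extensional functions, where
    uniqueness can hold as equality.\<close>
  define \<phi> where "\<phi> = restrict (\<lambda>s. SOME y. lim s y) (carrier (completed P))"
  have \<phi>: "lim s (\<phi> s)" if "s \<in> carrier (completed P)" for s
    using someI_ex[OF lim_ex[OF that]] that by (simp add: \<phi>_def)
  have \<phi>_eq: "\<phi> s = y" if "s \<in> carrier (completed P)" "lim s y" for s y
    using lim_unique[OF that(1) \<phi>] that by blast
  have "\<phi> \<in> series_linear_maps (completed P) N"
    unfolding series_linear_maps_def
  proof (intro CollectI conjI ballI allI)
    show "\<phi> \<in> carrier (completed P) \<rightarrow>\<^sub>E carrier N"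
      using \<phi> by (auto simp: lim_def \<phi>_def)
    fix s assume s: "s \<in> carrier (completed P)"
    obtain g where g: "s = seq_class g" "coherent g" using s by (auto simp: completed_carrier)
    have gk: "g k \<in> elems" "h (g k) \<in> carrier N" for k
      using g(2) h_cl by (auto simp: coherent_def)
    have s_lim: "\<phi> s \<ominus>\<^bsub>N\<^esub> h (g k) \<in> nu_multiples N k" "\<phi> s \<in> carrier N" for k
      using \<phi>[OF s] by (auto simp: lim_def g seq_class_def)
    {
      fix c
      show "\<phi> (c \<odot>\<^bsub>completed P\<^esub> s) = c \<odot>\<^bsub>N\<^esub> \<phi> s"
      proof (rule \<phi>_eq)
        have "c \<odot>\<^bsub>N\<^esub> \<phi> s \<ominus>\<^bsub>N\<^esub> h (scale c (g k)) = c \<odot>\<^bsub>N\<^esub> (\<phi> s \<ominus>\<^bsub>N\<^esub> h (g k))" for k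
          using s_lim gk by (simp add: h_scale N.minus_eq N.smult_r_distr N.smult_r_minus)
        then show "lim (c \<odot>\<^bsub>completed P\<^esub> s) (c \<odot>\<^bsub>N\<^esub> \<phi> s)"
          unfolding g(1) completed_smult using s_lim
          by (intro limI coherent_scale g) (auto simp: N.nu_multiples_smult g(1))
      qed (use s in auto)
    }
    fix t assume t: "t \<in> carrier (completed P)"
    obtain g' where g': "t = seq_class g'" "coherent g'" using t by (auto simp: completed_carrier)
    have gk': "g' k \<in> elems" "h (g' k) \<in> carrier N" for k
      using g'(2) h_cl by (auto simp: coherent_def)
    have t_lim: "\<phi> t \<ominus>\<^bsub>N\<^esub> h (g' k) \<in> nu_multiples N k" "\<phi> t \<in> carrier N" for k
      using \<phi>[OF t] by (auto simp: lim_def g' seq_class_def)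
    show "\<phi> (s \<oplus>\<^bsub>completed P\<^esub> t) = \<phi> s \<oplus>\<^bsub>N\<^esub> \<phi> t"
    proof (rule \<phi>_eq)
      have "(\<phi> s \<oplus>\<^bsub>N\<^esub> \<phi> t) \<ominus>\<^bsub>N\<^esub> h (g k + g' k)
          = (\<phi> s \<ominus>\<^bsub>N\<^esub> h (g k)) \<oplus>\<^bsub>N\<^esub> (\<phi> t \<ominus>\<^bsub>N\<^esub> h (g' k))" for k
        using s_lim t_lim gk gk' by (simp add: h_add N.minus_add_minus)
      then have "(\<phi> s \<oplus>\<^bsub>N\<^esub> \<phi> t) \<ominus>\<^bsub>N\<^esub> h (g k + g' k) \<in> nu_multiples N k" for k
        using s_lim t_lim by (simp add: N.nu_multiples_add)
      then have "lim (seq_class (\<lambda>k. g k + g' k)) (\<phi> s \<oplus>\<^bsub>N\<^esub> \<phi> t)"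
        using s_lim t_lim by (intro limI coherent_add g g') auto
      then show "lim (s \<oplus>\<^bsub>completed P\<^esub> t) (\<phi> s \<oplus>\<^bsub>N\<^esub> \<phi> t)"
        by (simp add: g g' completed_add)
    qed (use s t in auto)
  qed
  moreover have "\<phi> (pure_tensor P x) = f x" if x: "x \<in> gens P" for x
  proof (rule \<phi>_eq[OF pure_tensor_closed[OF x]])
    show "lim (pure_tensor P x) (f x)"
      unfolding pure_tensor_eq using x f[OF x] N.nu_multiples_zero
      by (intro limI coherent_const) (auto simp: h N.minus_eq N.r_neg)
  qed
  ultimately have *: "\<phi> \<in> tensor_maps P N f"
    by (simp add: tensor_maps_def)
  moreover have "\<psi> = \<phi>" if "\<psi> \<in> tensor_maps P N f" for \<psi>
  proof (rule extensionalityI)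
    show "\<psi> \<in> extensional (carrier (completed P))" "\<phi> \<in> extensional (carrier (completed P))"
      using that * by (auto simp: tensor_maps_def series_linear_maps_def PiE_def)
    show "\<psi> s = \<phi> s" if "s \<in> carrier (completed P)" for s
      by (rule series_linear_maps_eqI[OF N _ _ _ that])
        (use * \<open>\<psi> \<in> tensor_maps P N f\<close> in \<open>auto simp: tensor_maps_def\<close>)
  qed
  ultimately show ?thesis by blast
qed


lemma pure_tensor_add:
  assumes "frag_of x - frag_of y - frag_of z \<in> rels P"
  shows "pure_tensor P x = pure_tensor P y \<oplus>\<^bsub>completed P\<^esub> pure_tensor P z"
  using level_rel[OF assms] by (simp add: pure_tensor_eq completed_add seq_class_eq_iff diff_diff_eq)

lemma pure_tensor_cong:
  assumes "frag_of x - frag_of y \<in> rels P"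
  shows "pure_tensor P x = pure_tensor P y"
  using level_rel[OF assms] by (simp add: pure_tensor_eq seq_class_eq_iff)

lemma pure_tensor_scal: "pure_tensor P (gen_scal P c x) = c \<odot>\<^bsub>completed P\<^esub> pure_tensor P x"
  by (simp add: pure_tensor_eq completed_smult)

end

lemma series_linear_maps_compose:
  assumes "module formal_scalars L" "f \<in> series_linear_maps L M" "g \<in> series_linear_maps M N"
  shows "compose (carrier L) g f \<in> series_linear_maps L N"
proof -
  interpret L: module formal_scalars L by (rule assms(1))
  have f: "f x \<in> carrier M" if "x \<in> carrier L" for x
    using assms(2) that by (auto simp: series_linear_maps_def)
  show ?thesis
    using assms(2,3) f
    by (auto simp: series_linear_maps_def compose_def)
qed

section \<open>Passing to a quotient by further relations\<close>

locale tensor_quotient = tensor_pres P + finer: tensor_pres F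
  for P F :: "'x tensor_presentation" +
  assumes same_gens: "gens F = gens P" and same_scal: "gen_scal F = gen_scal P"
    and rels_subset: "rels F \<subseteq> rels P"
begin

lemma level_finer: "level F k \<subseteq> level P k"
  unfolding level_def same_gens same_scal using rels_subset by (intro group.mono_generate[OF group_free_Abelian_group]) auto

lemma coherent_finer: "finer.coherent f \<Longrightarrow> coherent f"
  using level_finer by (auto simp: finer.coherent_def coherent_def same_gens)

lemma tensor_projection_seq_class:
  "tensor_projection P (finer.seq_class f) = seq_class f"
proof -
  have "level P k <#>\<^bsub>free_on P\<^esub> finer.coset k (f k) = coset k (f k)" for k
    using level_finer[of k] by (intro level_set_mult) (auto simp: finer.coset_def)
  then show ?thesis
    by (simp add: tensor_projection_def seq_class_def finer.seq_class_def)
qed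

lemma tensor_projection_pure: "tensor_projection P (pure_tensor F x) = pure_tensor P x"
  by (simp add: finer.pure_tensor_eq pure_tensor_eq tensor_projection_seq_class)

lemma tensor_projection_linear:
  "restrict (tensor_projection P) (carrier (completed F)) \<in> series_linear_maps (completed F) (completed P)"
proof -
  interpret C: module formal_scalars "completed F" by (rule finer.completed_module)
  have scale: "finer.scale = scale"
    by (simp add: fun_eq_iff finer.scale_def scale_def same_scal)
  show ?thesis
    unfolding series_linear_maps_def
  proof (intro CollectI conjI ballI allI)
    show "restrict (tensor_projection P) (carrier (completed F)) \<in>
        carrier (completed F) \<rightarrow>\<^sub>E carrier (completed P)"
      by (auto simp: finer.completed_carrier completed_carrier tensor_projection_seq_class
          dest: coherent_finer)
    fix s c assume s: "s \<in> carrier (completed F)"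
    then obtain f where f: "s = finer.seq_class f" by (auto simp: finer.completed_carrier)
    have "c \<odot>\<^bsub>completed F\<^esub> s \<in> carrier (completed F)" using s by simp
    then show "restrict (tensor_projection P) (carrier (completed F)) (c \<odot>\<^bsub>completed F\<^esub> s) =
        c \<odot>\<^bsub>completed P\<^esub> restrict (tensor_projection P) (carrier (completed F)) s"
      using s by (simp add: f finer.completed_smult completed_smult tensor_projection_seq_class scale)
    fix t assume t: "t \<in> carrier (completed F)"
    then obtain g where g: "t = finer.seq_class g" by (auto simp: finer.completed_carrier)
    have "s \<oplus>\<^bsub>completed F\<^esub> t \<in> carrier (completed F)" using s t by simp
    then show "restrict (tensor_projection P) (carrier (completed F)) (s \<oplus>\<^bsub>completed F\<^esub> t) =
        restrict (tensor_projection P) (carrier (completed F)) s \<oplus>\<^bsub>completed P\<^esub>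
        restrict (tensor_projection P) (carrier (completed F)) t"
      using s t by (simp add: f g finer.completed_add completed_add tensor_projection_seq_class)
  qed
qed

text \<open>The descended map is the universal one on the quotient for the same values
  \<open>f\<close>: composed with the projection it is linear and agrees with \<mu> on pure
  tensors.\<close>

lemma tensor_map_descends:
  assumes N: "adic_module N" and ex1: "\<exists>!\<phi>. \<phi> \<in> tensor_maps P N f" and \<mu>: "\<mu> \<in> tensor_maps F N f"
  shows "\<exists>!\<mu>'. \<mu>' \<in> series_linear_maps (completed P) N \<and>
    (\<forall>x\<in>carrier (completed F). \<mu>' (tensor_projection P x) = \<mu> x)"
proof -
  let ?\<pi> = "restrict (tensor_projection P) (carrier (completed F))"
  obtain \<phi> where \<phi>: "\<phi> \<in> tensor_maps P N f" using ex1 by blast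
  then have \<phi>_lin: "\<phi> \<in> series_linear_maps (completed P) N" by (simp add: tensor_maps_def)
  have "\<phi> (tensor_projection P x) = \<mu> x" if x: "x \<in> carrier (completed F)" for x
  proof -
    have "compose (carrier (completed F)) \<phi> ?\<pi> x = \<mu> x"
    proof (rule finer.series_linear_maps_eqI[OF N _ _ _ x])
      show "compose (carrier (completed F)) \<phi> ?\<pi> \<in> series_linear_maps (completed F) N"
        by (rule series_linear_maps_compose[OF finer.completed_module tensor_projection_linear \<phi>_lin])
      show "\<mu> \<in> series_linear_maps (completed F) N" using \<mu> by (simp add: tensor_maps_def)
      fix y assume y: "y \<in> gens F"
      then show "compose (carrier (completed F)) \<phi> ?\<pi> (pure_tensor F y) = \<mu> (pure_tensor F y)"
        using \<phi> \<mu> finer.pure_tensor_closed[OF y]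
        by (simp add: compose_eq tensor_projection_pure tensor_maps_def same_gens)
    qed
    then show ?thesis using x by (simp add: compose_eq)
  qed
  moreover have "\<psi> = \<phi>"
    if \<psi>: "\<psi> \<in> series_linear_maps (completed P) N"
      "\<forall>x\<in>carrier (completed F). \<psi> (tensor_projection P x) = \<mu> x" for \<psi>
  proof -
    \<comment> \<open>Pure tensors of \<open>P\<close> are projections of pure tensors of
      \<open>F\<close>, so the factorization prescribes the values of \<psi> on them and
      \<open>ex1\<close> applies.\<close>
    have "\<psi> (pure_tensor P x) = f x" if "x \<in> gens P" for x
      using \<psi>(2) \<mu> that finer.pure_tensor_closed[of x]
      by (auto simp: tensor_maps_def same_gens simp flip: tensor_projection_pure)
    then have "\<psi> \<in> tensor_maps P N f" using \<psi>(1) by (simp add: tensor_maps_def)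
    then show ?thesis using ex1 \<phi> by blast
  qed
  ultimately show ?thesis using \<phi>_lin by blast
qed

end

section \<open>Two-fold tensor products\<close>

lemma keys_diff_subset:
  "\<lbrakk>Poly_Mapping.keys f \<subseteq> S; Poly_Mapping.keys g \<subseteq> S\<rbrakk> \<Longrightarrow> Poly_Mapping.keys (f - g) \<subseteq> S"
  using keys_diff[of f g] by blast

text \<open>Scaling acts on the first factor, so the relation that moves a scalar \<open>d\<close>
  across the tensor sign is stable under \<open>c\<close> because \<open>c\<close> and
  \<open>d\<close> commute.\<close>

lemma formal_scalars_module_commute:
  assumes "module formal_scalars M" "x \<in> carrier M"
  shows "c \<odot>\<^bsub>M\<^esub> (d \<odot>\<^bsub>M\<^esub> x) = d \<odot>\<^bsub>M\<^esub> (c \<odot>\<^bsub>M\<^esub> x)"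
proof -
  interpret M: module formal_scalars M by (rule assms(1))
  show ?thesis
    using M.smult_assoc1[of c d x] M.smult_assoc1[of d c x] assms(2) by (simp add: mult.commute)
qed

lemma tensor2_sel:
  "gens (tensor2 M N) = carrier M \<times> carrier N"
  "gen_scal (tensor2 M N) c (x, y) = (c \<odot>\<^bsub>M\<^esub> x, y)"
  by (simp_all add: tensor2_def)

lemma tensor2_rels:
  shows tensor2_rel_add_left: "\<lbrakk>x \<in> carrier M; x' \<in> carrier M; y \<in> carrier N\<rbrakk> \<Longrightarrow>
      frag_of (x \<oplus>\<^bsub>M\<^esub> x', y) - frag_of (x, y) - frag_of (x', y) \<in> rels (tensor2 M N)"
    and tensor2_rel_add_right: "\<lbrakk>x \<in> carrier M; y \<in> carrier N; y' \<in> carrier N\<rbrakk> \<Longrightarrow>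
      frag_of (x, y \<oplus>\<^bsub>N\<^esub> y') - frag_of (x, y) - frag_of (x, y') \<in> rels (tensor2 M N)"
    and tensor2_rel_scal: "\<lbrakk>x \<in> carrier M; y \<in> carrier N\<rbrakk> \<Longrightarrow>
      frag_of (c \<odot>\<^bsub>M\<^esub> x, y) - frag_of (x, c \<odot>\<^bsub>N\<^esub> y) \<in> rels (tensor2 M N)"
  by (auto simp: tensor2_def)

lemma tensor2_rels_cases [consumes 1, case_names add_left add_right scal]:
  assumes "r \<in> rels (tensor2 M N)"
  obtains x x' y where "x \<in> carrier M" "x' \<in> carrier M" "y \<in> carrier N"
      "r = frag_of (x \<oplus>\<^bsub>M\<^esub> x', y) - frag_of (x, y) - frag_of (x', y)"
    | x y y' where "x \<in> carrier M" "y \<in> carrier N" "y' \<in> carrier N"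
      "r = frag_of (x, y \<oplus>\<^bsub>N\<^esub> y') - frag_of (x, y) - frag_of (x, y')"
    | c x y where "x \<in> carrier M" "y \<in> carrier N"
      "r = frag_of (c \<odot>\<^bsub>M\<^esub> x, y) - frag_of (x, c \<odot>\<^bsub>N\<^esub> y)"
  using assms by (auto simp: tensor2_def)

lemma tensor2_tensor_pres:
  assumes M: "module formal_scalars M" and N: "module formal_scalars N"
  shows "tensor_pres (tensor2 M N)"
proof -
  interpret M: module formal_scalars M by (rule M)
  interpret N: module formal_scalars N by (rule N)
  show ?thesis
  proof
    fix c d x
    assume "x \<in> gens (tensor2 M N)"
    then obtain m n where x: "x = (m, n)" "m \<in> carrier M" "n \<in> carrier N"
      by (auto simp: tensor2_sel)
    show "gen_scal (tensor2 M N) c x \<in> gens (tensor2 M N)"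
      "gen_scal (tensor2 M N) 1 x = x"
      "gen_scal (tensor2 M N) (c * d) x = gen_scal (tensor2 M N) c (gen_scal (tensor2 M N) d x)"
      using x M.smult_assoc1[of c d m] M.smult_one[of m] by (simp_all add: tensor2_sel)
    show "frag_of (gen_scal (tensor2 M N) (c + d) x) - frag_of (gen_scal (tensor2 M N) c x) -
        frag_of (gen_scal (tensor2 M N) d x) \<in> rels (tensor2 M N)"
      using x M.smult_l_distr[of c d m] tensor2_rel_add_left[of "c \<odot>\<^bsub>M\<^esub> m" M "d \<odot>\<^bsub>M\<^esub> m" n N]
      by (simp add: tensor2_sel)
  next
    fix c r
    assume r: "r \<in> rels (tensor2 M N)"
    then show "Poly_Mapping.keys r \<subseteq> gens (tensor2 M N)"
      by (cases rule: tensor2_rels_cases) (simp_all add: tensor2_sel keys_diff_subset)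
    show "frag_extend (frag_of \<circ> gen_scal (tensor2 M N) c) r \<in> rels (tensor2 M N)"
      using r
      by (cases rule: tensor2_rels_cases)
        (simp_all add: frag_extend_diff tensor2_sel M.smult_r_distr tensor2_rels
          formal_scalars_module_commute[OF M, of _ c])
  qed
qed

definition series_bilinear where
  "series_bilinear M N W f \<longleftrightarrow> (\<forall>x\<in>carrier M. \<forall>y\<in>carrier N. f x y \<in> carrier W \<and>
    (\<forall>x'\<in>carrier M. f (x \<oplus>\<^bsub>M\<^esub> x') y = f x y \<oplus>\<^bsub>W\<^esub> f x' y) \<and>
    (\<forall>y'\<in>carrier N. f x (y \<oplus>\<^bsub>N\<^esub> y') = f x y \<oplus>\<^bsub>W\<^esub> f x y') \<and>
    (\<forall>c. f (c \<odot>\<^bsub>M\<^esub> x) y = c \<odot>\<^bsub>W\<^esub> f x y \<and> f x (c \<odot>\<^bsub>N\<^esub> y) = c \<odot>\<^bsub>W\<^esub> f x y))"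

lemma series_bilinear_compatible:
  assumes M: "module formal_scalars M" and N: "module formal_scalars N"
    and f: "series_bilinear M N W f" and r: "r \<in> rels (tensor2 M N)"
  shows "compatible W (carrier M \<times> carrier N) (\<lambda>(x, y). f x y) r"
proof -
  interpret M: module formal_scalars M by (rule M)
  interpret N: module formal_scalars N by (rule N)
  note f = f[unfolded series_bilinear_def]
  show ?thesis
    using r
  proof (cases rule: tensor2_rels_cases)
    case add_left
    then show ?thesis using f by (auto intro!: compatible_add)
  next
    case add_right
    then show ?thesis using f by (auto intro!: compatible_add)
  next
    case scal
    then show ?thesis using f by (auto intro!: compatible_eq)
  qed
qed

lemma tensor2_maps_ex1:
  assumes M: "module formal_scalars M" and N: "module formal_scalars N" and W: "adic_module W"
    and f: "series_bilinear M N W f"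
  shows "\<exists>!\<phi>. \<phi> \<in> tensor_maps (tensor2 M N) W (\<lambda>(x, y). f x y)"
proof (rule tensor_pres.tensor_maps_ex1[OF tensor2_tensor_pres[OF M N] W])
  show "compatible W (gens (tensor2 M N)) (\<lambda>(x, y). f x y) r" if "r \<in> rels (tensor2 M N)" for r
    using series_bilinear_compatible[OF M N f that] by (simp add: tensor2_sel)
qed (use f in \<open>auto simp: tensor2_sel series_bilinear_def\<close>)

lemma balanced_tensor2_sel:
  "gens (balanced_tensor2 R M r N l) = carrier M \<times> carrier N"
  "gen_scal (balanced_tensor2 R M r N l) = gen_scal (tensor2 M N)"
  by (simp_all add: balanced_tensor2_def tensor2_def)

lemma balanced_tensor2_rels_subset: "rels (tensor2 M N) \<subseteq> rels (balanced_tensor2 R M r N l)"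
  by (auto simp: balanced_tensor2_def)

lemma balanced_tensor2_rel_balanced:
  "\<lbrakk>a \<in> carrier R; x \<in> carrier M; y \<in> carrier N\<rbrakk> \<Longrightarrow>
    frag_of (r x a, y) - frag_of (x, l a y) \<in> rels (balanced_tensor2 R M r N l)"
  by (auto simp: balanced_tensor2_def)

lemma balanced_tensor2_rels_cases [consumes 1, case_names tensor balanced]:
  assumes "q \<in> rels (balanced_tensor2 R M r N l)"
  obtains "q \<in> rels (tensor2 M N)"
    | a x y where "a \<in> carrier R" "x \<in> carrier M" "y \<in> carrier N"
      "q = frag_of (r x a, y) - frag_of (x, l a y)"
  using assms by (auto simp: balanced_tensor2_def)

text \<open>By linearity of \<open>r\<close> in its module argument, scaling the balancing relation
  for \<open>x\<close> gives the one for the scaled \<open>x\<close>.\<close>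

lemma balanced_tensor2_tensor_pres:
  assumes M: "module formal_scalars M" and N: "module formal_scalars N"
    and r: "\<And>a x. \<lbrakk>a \<in> carrier R; x \<in> carrier M\<rbrakk> \<Longrightarrow> r x a \<in> carrier M"
    and l: "\<And>a y. \<lbrakk>a \<in> carrier R; y \<in> carrier N\<rbrakk> \<Longrightarrow> l a y \<in> carrier N"
    and r_scal: "\<And>a x c. \<lbrakk>a \<in> carrier R; x \<in> carrier M\<rbrakk> \<Longrightarrow> r (c \<odot>\<^bsub>M\<^esub> x) a = c \<odot>\<^bsub>M\<^esub> r x a"
  shows "tensor_pres (balanced_tensor2 R M r N l)"
proof -
  interpret M: module formal_scalars M by (rule M)
  interpret T: tensor_pres "tensor2 M N" by (rule tensor2_tensor_pres[OF M N])
  note sel = balanced_tensor2_sel[of R M r N l] and sub = balanced_tensor2_rels_subset[of M N R r l]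
  show ?thesis
  proof
    fix c d x assume "x \<in> gens (balanced_tensor2 R M r N l)"
    then have x: "x \<in> gens (tensor2 M N)" by (simp add: sel tensor2_sel)
    show "gen_scal (balanced_tensor2 R M r N l) c x \<in> gens (balanced_tensor2 R M r N l)"
      "gen_scal (balanced_tensor2 R M r N l) (c * d) x =
        gen_scal (balanced_tensor2 R M r N l) c (gen_scal (balanced_tensor2 R M r N l) d x)"
      "gen_scal (balanced_tensor2 R M r N l) 1 x = x"
      using T.gen_scal_closed[OF x] T.gen_scal_mult[OF x] T.gen_scal_one[OF x]
      by (simp_all add: sel tensor2_sel)
    show "frag_of (gen_scal (balanced_tensor2 R M r N l) (c + d) x) -
        frag_of (gen_scal (balanced_tensor2 R M r N l) c x) -
        frag_of (gen_scal (balanced_tensor2 R M r N l) d x) \<in> rels (balanced_tensor2 R M r N l)"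
      unfolding sel using T.gen_scal_add[OF x] sub by blast
  next
    fix c q assume q: "q \<in> rels (balanced_tensor2 R M r N l)"
    then show "Poly_Mapping.keys q \<subseteq> gens (balanced_tensor2 R M r N l)"
    proof (cases rule: balanced_tensor2_rels_cases)
      case tensor
      then show ?thesis using T.rels_keys by (simp add: sel tensor2_sel)
    next
      case balanced
      then show ?thesis by (simp add: sel keys_diff_subset r l)
    qed
    show "frag_extend (frag_of \<circ> gen_scal (balanced_tensor2 R M r N l) c) q
        \<in> rels (balanced_tensor2 R M r N l)"
      using q
    proof (cases rule: balanced_tensor2_rels_cases)
      case tensor
      then show ?thesis unfolding sel using T.rels_scal sub by blast
    next
      case (balanced a x y)
      then show ?thesis
        using balanced_tensor2_rel_balanced[of a R "c \<odot>\<^bsub>M\<^esub> x" M y N r l]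
        by (simp add: frag_extend_diff sel tensor2_sel r_scal)
    qed
  qed
qed

lemma balanced_tensor2_maps_ex1:
  assumes T: "tensor_pres (balanced_tensor2 R M r N l)"
    and M: "module formal_scalars M" and N: "module formal_scalars N" and W: "adic_module W"
    and r: "\<And>a x. \<lbrakk>a \<in> carrier R; x \<in> carrier M\<rbrakk> \<Longrightarrow> r x a \<in> carrier M"
    and l: "\<And>a y. \<lbrakk>a \<in> carrier R; y \<in> carrier N\<rbrakk> \<Longrightarrow> l a y \<in> carrier N"
    and f: "series_bilinear M N W f"
    and f_balanced: "\<And>a x y. \<lbrakk>a \<in> carrier R; x \<in> carrier M; y \<in> carrier N\<rbrakk> \<Longrightarrow>
      f (r x a) y = f x (l a y)"
  shows "\<exists>!\<phi>. \<phi> \<in> tensor_maps (balanced_tensor2 R M r N l) W (\<lambda>(x, y). f x y)"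
proof (rule tensor_pres.tensor_maps_ex1[OF T W])
  fix q assume "q \<in> rels (balanced_tensor2 R M r N l)"
  then show "compatible W (gens (balanced_tensor2 R M r N l)) (\<lambda>(x, y). f x y) q"
  proof (cases rule: balanced_tensor2_rels_cases)
    case tensor
    then show ?thesis
      using series_bilinear_compatible[OF M N f] by (simp add: balanced_tensor2_sel)
  next
    case balanced
    then show ?thesis using r l f_balanced by (auto simp: balanced_tensor2_sel intro!: compatible_eq)
  qed
qed (use f in \<open>auto simp: balanced_tensor2_sel tensor2_sel series_bilinear_def\<close>)

text \<open>Prepares a completed two-fold product as the target of maps out of a three-fold
  one.\<close>

lemma balanced_tensor2_pure_bilinear:
  assumes T: "tensor_pres (balanced_tensor2 R M r N l)"
    and M: "module formal_scalars M" and N: "module formal_scalars N"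
  shows "series_bilinear M N (completed (balanced_tensor2 R M r N l))
    (\<lambda>x y. pure_tensor (balanced_tensor2 R M r N l) (x, y))"
proof -
  let ?T = "balanced_tensor2 R M r N l"
  interpret T: tensor_pres ?T by (rule T)
  interpret M: module formal_scalars M by (rule M)
  note sub = subsetD[OF balanced_tensor2_rels_subset[of M N R r l]]
  show ?thesis
    unfolding series_bilinear_def
  proof (intro ballI conjI allI)
    fix x y assume xy: "x \<in> carrier M" "y \<in> carrier N"
    then show "pure_tensor ?T (x, y) \<in> carrier (completed ?T)"
      by (intro T.pure_tensor_closed) (simp add: balanced_tensor2_sel)
    show "pure_tensor ?T (x \<oplus>\<^bsub>M\<^esub> x', y) = pure_tensor ?T (x, y) \<oplus>\<^bsub>completed ?T\<^esub> pure_tensor ?T (x', y)"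
      if "x' \<in> carrier M" for x'
      using xy that by (intro T.pure_tensor_add sub tensor2_rel_add_left)
    show "pure_tensor ?T (x, y \<oplus>\<^bsub>N\<^esub> y') = pure_tensor ?T (x, y) \<oplus>\<^bsub>completed ?T\<^esub> pure_tensor ?T (x, y')"
      if "y' \<in> carrier N" for y'
      using xy that by (intro T.pure_tensor_add sub tensor2_rel_add_right)
    fix c
    show *: "pure_tensor ?T (c \<odot>\<^bsub>M\<^esub> x, y) = c \<odot>\<^bsub>completed ?T\<^esub> pure_tensor ?T (x, y)"
      using T.pure_tensor_scal[of c "(x, y)"] by (simp add: balanced_tensor2_sel tensor2_sel)
    have "pure_tensor ?T (c \<odot>\<^bsub>M\<^esub> x, y) = pure_tensor ?T (x, c \<odot>\<^bsub>N\<^esub> y)"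
      using xy by (intro T.pure_tensor_cong sub tensor2_rel_scal)
    then show "pure_tensor ?T (x, c \<odot>\<^bsub>N\<^esub> y) = c \<odot>\<^bsub>completed ?T\<^esub> pure_tensor ?T (x, y)"
      using * by simp
  qed
qed

section \<open>Three-fold tensor products\<close>

lemma balanced_tensor3_sel:
  "gens (balanced_tensor3 R S M r N l r' Z l') = carrier M \<times> carrier N \<times> carrier Z"
  "gen_scal (balanced_tensor3 R S M r N l r' Z l') c (x, y, z) = (c \<odot>\<^bsub>M\<^esub> x, y, z)"
  by (simp_all add: balanced_tensor3_def tensor3_def)

lemma balanced_tensor3_rels:
  fixes R S M r N l r' Z l'
  defines "rs \<equiv> rels (balanced_tensor3 R S M r N l r' Z l')"
  shows "\<lbrakk>x \<in> carrier M; x' \<in> carrier M; y \<in> carrier N; z \<in> carrier Z\<rbrakk> \<Longrightarrow>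
      frag_of (x \<oplus>\<^bsub>M\<^esub> x', y, z) - frag_of (x, y, z) - frag_of (x', y, z) \<in> rs"
    and "\<lbrakk>x \<in> carrier M; y \<in> carrier N; y' \<in> carrier N; z \<in> carrier Z\<rbrakk> \<Longrightarrow>
      frag_of (x, y \<oplus>\<^bsub>N\<^esub> y', z) - frag_of (x, y, z) - frag_of (x, y', z) \<in> rs"
    and "\<lbrakk>x \<in> carrier M; y \<in> carrier N; z \<in> carrier Z; z' \<in> carrier Z\<rbrakk> \<Longrightarrow>
      frag_of (x, y, z \<oplus>\<^bsub>Z\<^esub> z') - frag_of (x, y, z) - frag_of (x, y, z') \<in> rs"
    and "\<lbrakk>x \<in> carrier M; y \<in> carrier N; z \<in> carrier Z\<rbrakk> \<Longrightarrow>
      frag_of (c \<odot>\<^bsub>M\<^esub> x, y, z) - frag_of (x, c \<odot>\<^bsub>N\<^esub> y, z) \<in> rs"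
    and "\<lbrakk>x \<in> carrier M; y \<in> carrier N; z \<in> carrier Z\<rbrakk> \<Longrightarrow>
      frag_of (x, c \<odot>\<^bsub>N\<^esub> y, z) - frag_of (x, y, c \<odot>\<^bsub>Z\<^esub> z) \<in> rs"
    and "\<lbrakk>a \<in> carrier R; x \<in> carrier M; y \<in> carrier N; z \<in> carrier Z\<rbrakk> \<Longrightarrow>
      frag_of (r x a, y, z) - frag_of (x, l a y, z) \<in> rs"
    and "\<lbrakk>b \<in> carrier S; x \<in> carrier M; y \<in> carrier N; z \<in> carrier Z\<rbrakk> \<Longrightarrow>
      frag_of (x, r' y b, z) - frag_of (x, y, l' b z) \<in> rs"
  unfolding rs_def balanced_tensor3_def tensor3_def tensor_presentation.simps
proof goal_cases
  case 1
  show ?case by (rule UnI1[THEN UnI1, THEN UnI1, THEN UnI1, THEN UnI1, THEN UnI1]) (use 1 in blast)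
next
  case 2
  show ?case by (rule UnI2[THEN UnI1, THEN UnI1, THEN UnI1, THEN UnI1, THEN UnI1]) (use 2 in blast)
next
  case 3
  show ?case by (rule UnI2[THEN UnI1, THEN UnI1, THEN UnI1, THEN UnI1]) (use 3 in blast)
next
  case 4
  show ?case by (rule UnI2[THEN UnI1, THEN UnI1, THEN UnI1]) (use 4 in blast)
next
  case 5
  show ?case by (rule UnI2[THEN UnI1, THEN UnI1]) (use 5 in blast)
next
  case 6
  show ?case by (rule UnI2[THEN UnI1]) (use 6 in blast)
next
  case 7
  show ?case by (rule UnI2) (use 7 in blast)
qed

lemma balanced_tensor3_rels_cases
    [consumes 1, case_names add1 add2 add3 scal12 scal23 balanced12 balanced23]:
  assumes "q \<in> rels (balanced_tensor3 R S M r N l r' Z l')"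
  obtains x x' y z where "x \<in> carrier M" "x' \<in> carrier M" "y \<in> carrier N" "z \<in> carrier Z"
      "q = frag_of (x \<oplus>\<^bsub>M\<^esub> x', y, z) - frag_of (x, y, z) - frag_of (x', y, z)"
    | x y y' z where "x \<in> carrier M" "y \<in> carrier N" "y' \<in> carrier N" "z \<in> carrier Z"
      "q = frag_of (x, y \<oplus>\<^bsub>N\<^esub> y', z) - frag_of (x, y, z) - frag_of (x, y', z)"
    | x y z z' where "x \<in> carrier M" "y \<in> carrier N" "z \<in> carrier Z" "z' \<in> carrier Z"
      "q = frag_of (x, y, z \<oplus>\<^bsub>Z\<^esub> z') - frag_of (x, y, z) - frag_of (x, y, z')"
    | c x y z where "x \<in> carrier M" "y \<in> carrier N" "z \<in> carrier Z"
      "q = frag_of (c \<odot>\<^bsub>M\<^esub> x, y, z) - frag_of (x, c \<odot>\<^bsub>N\<^esub> y, z)"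
    | c x y z where "x \<in> carrier M" "y \<in> carrier N" "z \<in> carrier Z"
      "q = frag_of (x, c \<odot>\<^bsub>N\<^esub> y, z) - frag_of (x, y, c \<odot>\<^bsub>Z\<^esub> z)"
    | a x y z where "a \<in> carrier R" "x \<in> carrier M" "y \<in> carrier N" "z \<in> carrier Z"
      "q = frag_of (r x a, y, z) - frag_of (x, l a y, z)"
    | a x y z where "a \<in> carrier S" "x \<in> carrier M" "y \<in> carrier N" "z \<in> carrier Z"
      "q = frag_of (x, r' y a, z) - frag_of (x, y, l' a z)"
  using assms unfolding balanced_tensor3_def tensor3_def
  by simp (elim disjE exE conjE; simp)

lemma balanced_tensor3_tensor_pres:
  assumes M: "module formal_scalars M" and N: "module formal_scalars N" and Z: "module formal_scalars Z"
    and r: "\<And>a x. \<lbrakk>a \<in> carrier R; x \<in> carrier M\<rbrakk> \<Longrightarrow> r x a \<in> carrier M"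
    and l: "\<And>a y. \<lbrakk>a \<in> carrier R; y \<in> carrier N\<rbrakk> \<Longrightarrow> l a y \<in> carrier N"
    and r': "\<And>a y. \<lbrakk>a \<in> carrier S; y \<in> carrier N\<rbrakk> \<Longrightarrow> r' y a \<in> carrier N"
    and l': "\<And>a z. \<lbrakk>a \<in> carrier S; z \<in> carrier Z\<rbrakk> \<Longrightarrow> l' a z \<in> carrier Z"
    and r_scal: "\<And>a x c. \<lbrakk>a \<in> carrier R; x \<in> carrier M\<rbrakk> \<Longrightarrow> r (c \<odot>\<^bsub>M\<^esub> x) a = c \<odot>\<^bsub>M\<^esub> r x a"
  shows "tensor_pres (balanced_tensor3 R S M r N l r' Z l')"
proof -
  let ?T = "balanced_tensor3 R S M r N l r' Z l'"
  interpret M: module formal_scalars M by (rule M)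
  interpret N: module formal_scalars N by (rule N)
  interpret Z: module formal_scalars Z by (rule Z)
  note sel = balanced_tensor3_sel[of R S M r N l r' Z l']
    and intros = balanced_tensor3_rels[where R = R and S = S and M = M and r = r and N = N
      and l = l and r' = r' and Z = Z and l' = l']
  show ?thesis
  proof
    fix c d u assume "u \<in> gens ?T"
    then obtain x y z where u: "u = (x, y, z)" "x \<in> carrier M" "y \<in> carrier N" "z \<in> carrier Z"
      by (auto simp: sel)
    show "gen_scal ?T c u \<in> gens ?T" "gen_scal ?T 1 u = u"
      "gen_scal ?T (c * d) u = gen_scal ?T c (gen_scal ?T d u)"
      using u M.smult_assoc1[of c d x] M.smult_one[of x] by (simp_all add: sel)
    show "frag_of (gen_scal ?T (c + d) u) - frag_of (gen_scal ?T c u) - frag_of (gen_scal ?T d u) \<in> rels ?T"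
      using u M.smult_l_distr[of c d x] intros(1)[of "c \<odot>\<^bsub>M\<^esub> x" "d \<odot>\<^bsub>M\<^esub> x" y z]
      by (simp add: sel)
  next
    fix c q assume q: "q \<in> rels ?T"
    then show "Poly_Mapping.keys q \<subseteq> gens ?T"
      by (cases rule: balanced_tensor3_rels_cases) (simp_all add: sel keys_diff_subset r l r' l')
    show "frag_extend (frag_of \<circ> gen_scal ?T c) q \<in> rels ?T"
      using q
      by (cases rule: balanced_tensor3_rels_cases)
        (simp_all add: frag_extend_diff sel M.smult_r_distr intros
          formal_scalars_module_commute[OF M, of _ c] flip: r_scal)
  qed
qed

text \<open>Trilinearity is given as two bilinearities that share the middle variable, the form in
  which it follows from bilinearity of the star product and of pure tensors.\<close>

lemma balanced_tensor3_maps_ex1: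
  assumes T: "tensor_pres (balanced_tensor3 R S M r N l r' Z l')"
    and M: "module formal_scalars M" and N: "module formal_scalars N" and Z: "module formal_scalars Z"
    and W: "adic_module W"
    and r: "\<And>a x. \<lbrakk>a \<in> carrier R; x \<in> carrier M\<rbrakk> \<Longrightarrow> r x a \<in> carrier M"
    and l: "\<And>a y. \<lbrakk>a \<in> carrier R; y \<in> carrier N\<rbrakk> \<Longrightarrow> l a y \<in> carrier N"
    and r': "\<And>a y. \<lbrakk>a \<in> carrier S; y \<in> carrier N\<rbrakk> \<Longrightarrow> r' y a \<in> carrier N"
    and l': "\<And>a z. \<lbrakk>a \<in> carrier S; z \<in> carrier Z\<rbrakk> \<Longrightarrow> l' a z \<in> carrier Z"
    and f12: "\<And>z. z \<in> carrier Z \<Longrightarrow> series_bilinear M N W (\<lambda>x y. f x y z)"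
    and f23: "\<And>x. x \<in> carrier M \<Longrightarrow> series_bilinear N Z W (f x)"
    and f_balanced12: "\<And>a x y z. \<lbrakk>a \<in> carrier R; x \<in> carrier M; y \<in> carrier N; z \<in> carrier Z\<rbrakk> \<Longrightarrow>
      f (r x a) y z = f x (l a y) z"
    and f_balanced23: "\<And>a x y z. \<lbrakk>a \<in> carrier S; x \<in> carrier M; y \<in> carrier N; z \<in> carrier Z\<rbrakk> \<Longrightarrow>
      f x (r' y a) z = f x y (l' a z)"
  shows "\<exists>!\<phi>. \<phi> \<in> tensor_maps (balanced_tensor3 R S M r N l r' Z l') W (\<lambda>(x, y, z). f x y z)"
proof -
  interpret M: module formal_scalars M by (rule M)
  interpret N: module formal_scalars N by (rule N)
  interpret Z: module formal_scalars Z by (rule Z)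
  note f12 = f12[unfolded series_bilinear_def] and f23 = f23[unfolded series_bilinear_def]
  show ?thesis
  proof (rule tensor_pres.tensor_maps_ex1[OF T W])
    fix q assume "q \<in> rels (balanced_tensor3 R S M r N l r' Z l')"
    then show "compatible W (gens (balanced_tensor3 R S M r N l r' Z l')) (\<lambda>(x, y, z). f x y z) q"
    proof (cases rule: balanced_tensor3_rels_cases)
      case add1
      then show ?thesis using f12 by (auto simp: balanced_tensor3_sel intro!: compatible_add)
    next
      case add2
      then show ?thesis using f12 by (auto simp: balanced_tensor3_sel intro!: compatible_add)
    next
      case add3
      then show ?thesis using f23 by (auto simp: balanced_tensor3_sel intro!: compatible_add)
    next
      case scal12
      then show ?thesis using f12 by (auto simp: balanced_tensor3_sel intro!: compatible_eq)
    next
      case scal23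
      then show ?thesis using f23 by (auto simp: balanced_tensor3_sel intro!: compatible_eq)
    next
      case balanced12
      then show ?thesis
        using f_balanced12 r l by (auto simp: balanced_tensor3_sel intro!: compatible_eq)
    next
      case balanced23
      then show ?thesis
        using f_balanced23 r' l' by (auto simp: balanced_tensor3_sel intro!: compatible_eq)
    qed
  qed (use f12 in \<open>auto simp: balanced_tensor3_sel\<close>)
qed

section \<open>The weight spaces as bimodules\<close>

context heisenberg_module_algebra begin

lemma E_module_sel [simp]:
  "carrier (E_module H n) = E n" "x \<oplus>\<^bsub>E_module H n\<^esub> y = x + y"
  "\<zero>\<^bsub>E_module H n\<^esub> = 0" "c \<odot>\<^bsub>E_module H n\<^esub> x = c *\<^sub>S x"
  by (simp_all add: E_module_def star_algebra_def)

lemma A0_algebra_sel [simp]: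
  "carrier (A0_algebra H \<theta>) = E 0" "x \<oplus>\<^bsub>A0_algebra H \<theta>\<^esub> y = x + y"
  "\<zero>\<^bsub>A0_algebra H \<theta>\<^esub> = 0" "c \<odot>\<^bsub>A0_algebra H \<theta>\<^esub> x = c *\<^sub>S x"
  "x \<otimes>\<^bsub>A0_algebra H \<theta>\<^esub> y = star H \<theta> x y" "\<one>\<^bsub>A0_algebra H \<theta>\<^esub> = fps_const (unity H)"
  by (simp_all add: A0_algebra_def star_algebra_def)

lemma star_algebra_sel [simp]:
  "carrier (star_algebra H \<theta>) = UNIV" "x \<oplus>\<^bsub>star_algebra H \<theta>\<^esub> y = x + y"
  "\<zero>\<^bsub>star_algebra H \<theta>\<^esub> = 0" "c \<odot>\<^bsub>star_algebra H \<theta>\<^esub> x = c *\<^sub>S x"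
  "x \<otimes>\<^bsub>star_algebra H \<theta>\<^esub> y = star H \<theta> x y" "\<one>\<^bsub>star_algebra H \<theta>\<^esub> = fps_const (unity H)"
  by (simp_all add: star_algebra_def)

lemma series_moduleI:
  assumes M: "\<And>x y. x \<oplus>\<^bsub>M\<^esub> y = x + y" "\<zero>\<^bsub>M\<^esub> = 0" "\<And>c x. c \<odot>\<^bsub>M\<^esub> x = c *\<^sub>S x"
    and closed: "0 \<in> carrier M" "\<And>x y. \<lbrakk>x \<in> carrier M; y \<in> carrier M\<rbrakk> \<Longrightarrow> x + y \<in> carrier M"
      "\<And>c x. x \<in> carrier M \<Longrightarrow> c *\<^sub>S x \<in> carrier M"
  shows "module formal_scalars M"
proof (intro moduleI abelian_groupI)
  show "cring formal_scalars" by (rule cring_from_type_algebra)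
  fix x assume "x \<in> carrier M"
  then show "\<exists>y\<in>carrier M. y \<oplus>\<^bsub>M\<^esub> x = \<zero>\<^bsub>M\<^esub>"
    using closed(3)[of x "-1"] by (intro bexI[of _ "- x"]) (simp_all add: M)
qed (simp_all add: M closed add.assoc add.commute series.scale_left_distrib series.scale_right_distrib)

lemma E_module_module: "module formal_scalars (E_module H n)"
  by (rule series_moduleI) (simp_all add: E_zero E_add E_scal)

lemma A0_algebra_module: "module formal_scalars (A0_algebra H \<theta>)"
  by (rule series_moduleI) (simp_all add: E_zero E_add E_scal)

lemma star_algebra_module: "module formal_scalars (star_algebra H \<theta>)"
  by (rule series_moduleI) simp_all

lemma X_power_scal: "(fps_X ^ k *\<^sub>S a) $ n = (if n < k then 0 else a $ (n - k))"
proof -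
  have "(fps_X ^ k *\<^sub>S a) $ n = (\<Sum>i=0..n. if i = k then a $ (n - i) else 0)"
    unfolding series_scal_nth by (intro sum.cong refl) auto
  then show ?thesis by simp
qed

text \<open>Weight is a condition on each coefficient separately, so dividing by \<nu>^k, a shift of
  coefficients, does not leave \<open>E n\<close>.\<close>

lemma nu_multiples_E_module: "nu_multiples (E_module H n) k = {a \<in> E n. \<forall>i<k. a $ i = 0}"
proof (intro equalityI subsetI)
  fix a assume "a \<in> nu_multiples (E_module H n) k"
  then show "a \<in> {a \<in> E n. \<forall>i<k. a $ i = 0}"
    by (auto simp: nu_multiples_def E_scal X_power_scal)
next
  fix a assume a: "a \<in> {a \<in> E n. \<forall>i<k. a $ i = 0}"
  then have "Abs_fps (\<lambda>i. a $ (i + k)) \<in> E n" by (simp add: weight_series_def)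
  moreover have "a = fps_X ^ k *\<^sub>S Abs_fps (\<lambda>i. a $ (i + k))"
    using a by (simp add: fps_eq_iff X_power_scal)
  ultimately show "a \<in> nu_multiples (E_module H n) k"
    by (auto simp: nu_multiples_def)
qed

lemma E_module_adic: "adic_module (E_module H n)"
proof (intro adic_module.intro adic_module_axioms.intro E_module_module)
  interpret M: module formal_scalars "E_module H n" by (rule E_module_module)
  have minus: "x \<ominus>\<^bsub>E_module H n\<^esub> y = x - y" if "y \<in> E n" for x y
  proof -
    have "\<ominus>\<^bsub>E_module H n\<^esub> y = - y"
      using that by (intro M.minus_equality) (simp_all add: E_uminus)
    then show ?thesis by (simp add: a_minus_def)
  qed
  show "x = \<zero>\<^bsub>E_module H n\<^esub>" if "x \<in> carrier (E_module H n)" "\<And>k. x \<in> nu_multiples (E_module H n) k" for x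
  proof (simp, rule fps_ext)
    fix i
    show "x $ i = 0 $ i" using that(2)[of "Suc i"] by (simp add: nu_multiples_E_module)
  qed
  fix y assume y: "\<And>m. y m \<in> carrier (E_module H n)"
    and step: "\<And>m. y (Suc m) \<ominus>\<^bsub>E_module H n\<^esub> y m \<in> nu_multiples (E_module H n) m"
  \<comment> \<open>The step from \<open>y m\<close> to \<open>y (Suc m)\<close> fixes only
    coefficients of index below \<open>m\<close>, so coefficient \<open>i\<close> is stable from the
    index \<open>Suc i\<close> on, not from \<open>i\<close>.\<close>
  define z where "z = Abs_fps (\<lambda>i. y (Suc i) $ i)"
  have z: "z \<in> E n"
    using y by (auto simp: z_def weight_series_def)
  have "y (Suc m) $ i = y m $ i" if "i < m" for m i
    using step[of m] y that by (simp add: minus nu_multiples_E_module)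
  then have stable: "y m $ i = y (Suc i) $ i" if "i < m" for m i
    using that by (induction m) (auto elim: less_SucE)
  have "z \<ominus>\<^bsub>E_module H n\<^esub> y m \<in> nu_multiples (E_module H n) m" for m
  proof -
    have ym: "y m \<in> E n" using y by simp
    have "z - y m \<in> E n" using E_add[OF z E_uminus[OF ym]] by simp
    then show ?thesis
      using stable[of _ m] by (simp add: minus[OF ym] nu_multiples_E_module) (simp add: z_def)
  qed
  then show "\<exists>z\<in>carrier (E_module H n). \<forall>m. z \<ominus>\<^bsub>E_module H n\<^esub> y m \<in> nu_multiples (E_module H n) m"
    using z by auto
qed

section \<open>The algebra A_0 and the bimodules\<close>

lemma alpha_0: "alpha 0 \<theta> = \<theta>"
  by (simp add: alpha_def)

lemma star_assoc_alpha:
  assumes "\<theta> \<in> Theta" "b \<in> E n"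
  shows "star H (alpha n \<theta>) a (star H \<theta> b c) = star H \<theta> (star H (alpha n \<theta>) a b) c"
  by (rule star_assoc[OF assms(1) alpha_Theta[OF assms(1)] alpha_times[OF assms(1)] assms(2)])

lemma star_assoc_E0:
  assumes "\<theta> \<in> Theta" "b \<in> E 0"
  shows "star H \<theta> a (star H \<theta> b c) = star H \<theta> (star H \<theta> a b) c"
  using star_assoc_alpha[OF assms] by (simp add: alpha_0)

lemma star_E0:
  assumes "\<theta> \<in> Theta" "a \<in> E 0" "x \<in> E n"
  shows "star H \<theta> a x \<in> E n" "star H \<theta> x a \<in> E n"
  using star_E[OF assms] star_E[OF assms(1,3,2)] by simp_all

lemmas star_bilinear = star_add_left star_add_right star_scal_left star_scal_right

lemma star_algebra_unital:
  assumes "\<theta> \<in> Theta"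
  shows "unital_algebra formal_scalars (star_algebra H \<theta>)"
  by (intro unital_algebra.intro unital_algebra_axioms.intro star_algebra_module)
    (simp_all add: assms star_bilinear star_unity)

lemma A0_algebra_unital:
  assumes "\<theta> \<in> Theta"
  shows "unital_algebra formal_scalars (A0_algebra H \<theta>)"
  by (intro unital_algebra.intro unital_algebra_axioms.intro A0_algebra_module)
    (simp_all add: assms star_bilinear star_unity star_E0 unity_E)

lemma A0_algebra_ring:
  assumes "\<theta> \<in> Theta"
  shows "ring (A0_algebra H \<theta>)"
proof -
  interpret M: module formal_scalars "A0_algebra H \<theta>" by (rule A0_algebra_module)
  show ?thesis
    by (intro ringI M.abelian_group_axioms monoidI)
      (simp_all add: assms star_bilinear star_unity star_E0 unity_E star_assoc_E0)
qed

lemma A0_assoc_unital_subalgebra: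
  assumes "\<theta> \<in> Theta"
  shows "assoc_unital_subalgebra formal_scalars (E 0) (star_algebra H \<theta>)"
proof -
  interpret M: module formal_scalars "star_algebra H \<theta>" by (rule star_algebra_module)
  have uminus: "\<ominus>\<^bsub>star_algebra H \<theta>\<^esub> x = - x" for x
    by (intro M.minus_equality) simp_all
  have "submodule (E 0) formal_scalars (star_algebra H \<theta>)"
    by (rule M.submoduleI) (simp_all add: E_zero E_add E_scal E_uminus uminus)
  then show ?thesis
    using assms by (simp add: assoc_unital_subalgebra_def star_algebra_unital unity_E star_E0 star_assoc_E0)
qed

text \<open>Both module laws have a middle factor of weight 0 and a single parameter. In the
  compatibility of the two actions the middle factor has weight \<open>n\<close>, which forces the
  parameter \<open>alpha n \<theta>\<close> on the left.\<close>

lemma E_bimodule: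
  assumes "\<theta> \<in> Theta"
  shows "algebra_bimodule formal_scalars (A0_algebra H (alpha n \<theta>)) (A0_algebra H \<theta>) (E_module H n)
    (star H (alpha n \<theta>)) (star H \<theta>)"
proof -
  have \<alpha>: "alpha n \<theta> \<in> Theta" using assms by (rule alpha_Theta)
  show ?thesis
    by (intro algebra_bimodule.intro A0_algebra_unital A0_algebra_ring E_module_module assms \<alpha>)
      (simp_all add: assms \<alpha> star_bilinear star_unity star_E0 star_assoc_E0 star_assoc_alpha)
qed

section \<open>Star products on balanced tensor products and the diagram\<close>

lemma E_tensor2_tensor_pres: "\<theta> \<in> Theta \<Longrightarrow> tensor_pres (E_tensor2 H \<theta> j k)"
  unfolding E_tensor2_def
  by (intro balanced_tensor2_tensor_pres E_module_module) (simp_all add: star_E0 star_bilinear)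

lemma E_tensor3_tensor_pres:
  "\<lbrakk>\<theta>' \<in> Theta; \<theta> \<in> Theta\<rbrakk> \<Longrightarrow> tensor_pres (E_tensor3 H \<theta>' \<theta> m n p)"
  unfolding E_tensor3_def
  by (intro balanced_tensor3_tensor_pres E_module_module) (simp_all add: star_E0 star_bilinear)

lemma star_series_bilinear:
  assumes "\<theta> \<in> Theta" "i = j + k"
  shows "series_bilinear (E_module H j) (E_module H k) (E_module H i) (star H \<theta>)"
  using assms by (simp add: series_bilinear_def star_E star_bilinear)

text \<open>The target weight \<open>i\<close> is kept separate from the sum because the diagram
  needs \<open>m + n + p\<close> where the factors give \<open>m + (n + p)\<close>.\<close>

lemma E_tensor2_ex1:
  assumes "\<theta> \<in> Theta" "i = j + k"
  shows "\<exists>!\<mu>. \<mu> \<in> tensor_maps (E_tensor2 H \<theta> j k) (E_module H i) (\<lambda>(a, b). star H \<theta> a b)"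
  unfolding E_tensor2_def
  by (intro balanced_tensor2_maps_ex1 E_module_module E_module_adic star_series_bilinear assms
      E_tensor2_tensor_pres[unfolded E_tensor2_def])
    (simp_all add: assms star_E0 star_assoc_E0)

lemma E_tensor2_pure:
  assumes \<theta>: "\<theta> \<in> Theta"
  shows "series_bilinear (E_module H j) (E_module H k) (completed (E_tensor2 H \<theta> j k))
      (\<lambda>a b. pure_tensor (E_tensor2 H \<theta> j k) (a, b))"
    and "\<lbrakk>c \<in> E 0; a \<in> E j; b \<in> E k\<rbrakk> \<Longrightarrow>
      pure_tensor (E_tensor2 H \<theta> j k) (star H \<theta> a c, b) = pure_tensor (E_tensor2 H \<theta> j k) (a, star H \<theta> c b)"
proof -
  note T = E_tensor2_tensor_pres[OF \<theta>, of j k]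
  show "series_bilinear (E_module H j) (E_module H k) (completed (E_tensor2 H \<theta> j k))
      (\<lambda>a b. pure_tensor (E_tensor2 H \<theta> j k) (a, b))"
    unfolding E_tensor2_def
    by (intro balanced_tensor2_pure_bilinear E_module_module T[unfolded E_tensor2_def])
  show "pure_tensor (E_tensor2 H \<theta> j k) (star H \<theta> a c, b) = pure_tensor (E_tensor2 H \<theta> j k) (a, star H \<theta> c b)"
    if "c \<in> E 0" "a \<in> E j" "b \<in> E k"
    using that unfolding E_tensor2_def
    by (intro tensor_pres.pure_tensor_cong[OF T[unfolded E_tensor2_def]] balanced_tensor2_rel_balanced)
      simp_all
qed

text \<open>Balancedness over the left algebra moves \<open>a\<close> across the tensor sign of the
  target and then inside the product \<open>y * z\<close>, where the middle factor \<open>y\<close>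
  has weight \<open>n\<close>. Over the right algebra it is associativity with the middle factor
  \<open>a\<close> of weight 0.\<close>

lemma id_star_ex1:
  assumes \<theta>: "\<theta> \<in> Theta" and \<theta>': "\<theta>' = alpha n \<theta>"
  shows "\<exists>!f. f \<in> tensor_maps (E_tensor3 H \<theta>' \<theta> m n p) (completed (E_tensor2 H \<theta>' m (n + p)))
    (\<lambda>(a, b, c). pure_tensor (E_tensor2 H \<theta>' m (n + p)) (a, star H \<theta> b c))"
proof -
  have \<alpha>: "\<theta>' \<in> Theta" using \<theta> by (simp add: \<theta>' alpha_Theta)
  let ?U = "E_tensor2 H \<theta>' m (n + p)"
  note bil = E_tensor2_pure(1)[OF \<alpha>, of m "n + p", unfolded series_bilinear_def, simplified]
  have assoc: "star H \<theta>' a (star H \<theta> b c) = star H \<theta> (star H \<theta>' a b) c" if "b \<in> E n" for a b c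
    unfolding \<theta>' by (rule star_assoc_alpha[OF \<theta> that])
  show ?thesis
    unfolding E_tensor3_def
  proof (rule balanced_tensor3_maps_ex1[where f = "\<lambda>a b c. pure_tensor ?U (a, star H \<theta> b c)"])
    show "tensor_pres (balanced_tensor3 (A0_algebra H \<theta>') (A0_algebra H \<theta>)
      (E_module H m) (star H \<theta>') (E_module H n) (star H \<theta>') (star H \<theta>) (E_module H p) (star H \<theta>))"
      by (rule E_tensor3_tensor_pres[OF \<alpha> \<theta>, unfolded E_tensor3_def])
    show "adic_module (completed ?U)"
      by (rule tensor_pres.completed_adic_module[OF E_tensor2_tensor_pres[OF \<alpha>]])
    show "series_bilinear (E_module H m) (E_module H n) (completed ?U) (\<lambda>x y. pure_tensor ?U (x, star H \<theta> y z))"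
      if "z \<in> carrier (E_module H p)" for z
      using that \<theta> bil by (simp add: series_bilinear_def star_E star_bilinear)
    show "series_bilinear (E_module H n) (E_module H p) (completed ?U) (\<lambda>y z. pure_tensor ?U (x, star H \<theta> y z))"
      if "x \<in> carrier (E_module H m)" for x
      using that \<theta> bil by (simp add: series_bilinear_def star_E star_bilinear)
    fix a x y z
    assume "x \<in> carrier (E_module H m)" "y \<in> carrier (E_module H n)" "z \<in> carrier (E_module H p)"
    then have xyz: "x \<in> E m" "y \<in> E n" "z \<in> E p" by simp_all
    show "pure_tensor ?U (star H \<theta>' x a, star H \<theta> y z) = pure_tensor ?U (x, star H \<theta> (star H \<theta>' a y) z)"
      if "a \<in> carrier (A0_algebra H \<theta>')"
      using that xyz E_tensor2_pure(2)[OF \<alpha>, of a x m "star H \<theta> y z" "n + p"]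
      by (simp add: star_E \<theta> assoc)
    show "pure_tensor ?U (x, star H \<theta> (star H \<theta> y a) z) = pure_tensor ?U (x, star H \<theta> y (star H \<theta> a z))"
      if "a \<in> carrier (A0_algebra H \<theta>)"
      using that by (simp add: star_assoc_E0[OF \<theta>])
  qed (simp_all add: E_module_module star_E0 \<theta> \<alpha>)
qed

text \<open>Mirror image of the previous case: the middle factor \<open>y\<close> of weight
  \<open>n\<close> now serves balancedness over the right algebra.\<close>

lemma star_id_ex1:
  assumes \<theta>: "\<theta> \<in> Theta" and \<theta>': "\<theta>' = alpha n \<theta>"
  shows "\<exists>!f. f \<in> tensor_maps (E_tensor3 H \<theta>' \<theta> m n p) (completed (E_tensor2 H \<theta> (m + n) p))
    (\<lambda>(a, b, c). pure_tensor (E_tensor2 H \<theta> (m + n) p) (star H \<theta>' a b, c))"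
proof -
  have \<alpha>: "\<theta>' \<in> Theta" using \<theta> by (simp add: \<theta>' alpha_Theta)
  let ?V = "E_tensor2 H \<theta> (m + n) p"
  note bil = E_tensor2_pure(1)[OF \<theta>, of "m + n" p, unfolded series_bilinear_def, simplified]
  have assoc: "star H \<theta>' a (star H \<theta> b c) = star H \<theta> (star H \<theta>' a b) c" if "b \<in> E n" for a b c
    unfolding \<theta>' by (rule star_assoc_alpha[OF \<theta> that])
  show ?thesis
    unfolding E_tensor3_def
  proof (rule balanced_tensor3_maps_ex1[where f = "\<lambda>a b c. pure_tensor ?V (star H \<theta>' a b, c)"])
    show "tensor_pres (balanced_tensor3 (A0_algebra H \<theta>') (A0_algebra H \<theta>)
      (E_module H m) (star H \<theta>') (E_module H n) (star H \<theta>') (star H \<theta>) (E_module H p) (star H \<theta>))"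
      by (rule E_tensor3_tensor_pres[OF \<alpha> \<theta>, unfolded E_tensor3_def])
    show "adic_module (completed ?V)"
      by (rule tensor_pres.completed_adic_module[OF E_tensor2_tensor_pres[OF \<theta>]])
    show "series_bilinear (E_module H m) (E_module H n) (completed ?V) (\<lambda>x y. pure_tensor ?V (star H \<theta>' x y, z))"
      if "z \<in> carrier (E_module H p)" for z
      using that \<alpha> bil by (simp add: series_bilinear_def star_E star_bilinear)
    show "series_bilinear (E_module H n) (E_module H p) (completed ?V) (\<lambda>y z. pure_tensor ?V (star H \<theta>' x y, z))"
      if "x \<in> carrier (E_module H m)" for x
      using that \<alpha> bil by (simp add: series_bilinear_def star_E star_bilinear)
    fix a x y z
    assume "x \<in> carrier (E_module H m)" "y \<in> carrier (E_module H n)" "z \<in> carrier (E_module H p)"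
    then have xyz: "x \<in> E m" "y \<in> E n" "z \<in> E p" by simp_all
    show "pure_tensor ?V (star H \<theta>' (star H \<theta>' x a) y, z) = pure_tensor ?V (star H \<theta>' x (star H \<theta>' a y), z)"
      if "a \<in> carrier (A0_algebra H \<theta>')"
      using that by (simp add: star_assoc_E0[OF \<alpha>])
    show "pure_tensor ?V (star H \<theta>' x (star H \<theta> y a), z) = pure_tensor ?V (star H \<theta>' x y, star H \<theta> a z)"
      if "a \<in> carrier (A0_algebra H \<theta>)"
      using that xyz E_tensor2_pure(2)[OF \<theta>, of a "star H \<theta>' x y" "m + n" z p]
      by (simp add: star_E \<alpha> assoc)
  qed (simp_all add: E_module_module star_E0 \<theta> \<alpha>)
qed

lemma star_descends:
  assumes \<theta>: "\<theta> \<in> Theta"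
    and \<mu>: "\<mu> \<in> tensor_maps (tensor2 (E_module H j) (E_module H k)) (E_module H (j + k)) (\<lambda>(a, b). star H \<theta> a b)"
  shows "\<exists>!\<mu>'. \<mu>' \<in> series_linear_maps (completed (E_tensor2 H \<theta> j k)) (E_module H (j + k)) \<and>
    (\<forall>x\<in>carrier (completed (tensor2 (E_module H j) (E_module H k))).
      \<mu>' (tensor_projection (E_tensor2 H \<theta> j k) x) = \<mu> x)"
proof -
  interpret tensor_quotient "E_tensor2 H \<theta> j k" "tensor2 (E_module H j) (E_module H k)"
    by (intro tensor_quotient.intro tensor_quotient_axioms.intro E_tensor2_tensor_pres[OF \<theta>]
        tensor2_tensor_pres E_module_module)
      (auto simp: E_tensor2_def balanced_tensor2_sel tensor2_sel intro: subsetD[OF balanced_tensor2_rels_subset])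
  show ?thesis
    by (rule tensor_map_descends[OF E_module_adic E_tensor2_ex1[OF \<theta> refl] \<mu>])
qed

text \<open>Both paths are linear maps into a separated module, and on pure tensors their equality
  is associativity with the middle factor of weight \<open>n\<close>.\<close>

lemma star_diagram_commutes:
  fixes m n p :: int and \<theta> \<theta>' :: "complex fps"
  assumes \<theta>: "\<theta> \<in> Theta" and \<theta>': "\<theta>' = alpha n \<theta>"
  defines "T \<equiv> E_tensor3 H \<theta>' \<theta> m n p" and "U \<equiv> E_tensor2 H \<theta>' m (n + p)"
    and "V \<equiv> E_tensor2 H \<theta> (m + n) p" and "W \<equiv> E_module H (m + n + p)"
  assumes f: "f \<in> tensor_maps T (completed U) (\<lambda>(a, b, c). pure_tensor U (a, star H \<theta> b c))"
    and g: "g \<in> tensor_maps U W (\<lambda>(a, b). star H \<theta>' a b)"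
    and f': "f' \<in> tensor_maps T (completed V) (\<lambda>(a, b, c). pure_tensor V (star H \<theta>' a b, c))"
    and g': "g' \<in> tensor_maps V W (\<lambda>(a, b). star H \<theta> a b)"
    and x: "x \<in> carrier (completed T)"
  shows "g (f x) = g' (f' x)"
proof -
  have \<alpha>: "\<theta>' \<in> Theta" using \<theta> by (simp add: \<theta>' alpha_Theta)
  interpret T: tensor_pres T unfolding T_def by (rule E_tensor3_tensor_pres[OF \<alpha> \<theta>])
  have "compose (carrier (completed T)) g f x = compose (carrier (completed T)) g' f' x"
  proof (rule T.series_linear_maps_eqI[OF _ _ _ _ x])
    show "adic_module W" unfolding W_def by (rule E_module_adic)
    show "compose (carrier (completed T)) g f \<in> series_linear_maps (completed T) W"
      "compose (carrier (completed T)) g' f' \<in> series_linear_maps (completed T) W"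
      using f g f' g' by (auto simp: tensor_maps_def intro: series_linear_maps_compose[OF T.completed_module])
    fix u assume u: "u \<in> gens T"
    then obtain a b c where abc: "u = (a, b, c)" "a \<in> E m" "b \<in> E n" "c \<in> E p"
      by (auto simp: T_def E_tensor3_def balanced_tensor3_sel)
    have "(a, star H \<theta> b c) \<in> gens U" "(star H \<theta>' a b, c) \<in> gens V"
      using abc by (simp_all add: U_def V_def E_tensor2_def balanced_tensor2_sel star_E \<theta> \<alpha>)
    then have "g (f (pure_tensor T u)) = star H \<theta>' a (star H \<theta> b c)"
      "g' (f' (pure_tensor T u)) = star H \<theta> (star H \<theta>' a b) c"
      using f g f' g' u abc(1) by (auto simp: tensor_maps_def)
    then show "compose (carrier (completed T)) g f (pure_tensor T u) =
        compose (carrier (completed T)) g' f' (pure_tensor T u)"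
      using T.pure_tensor_closed[OF u] star_assoc_alpha[OF \<theta> abc(3)] by (simp add: compose_eq \<theta>')
  qed
  then show ?thesis using x by (simp add: compose_eq)
qed

end

theorem corollary3p3:
  fixes H :: "'a::ring heis_algebra" and \<theta> :: "complex fps"
  assumes "heisenberg_module_algebra H" and "\<theta> \<in> Theta"
  shows
    "assoc_unital_subalgebra formal_scalars (weight_series H 0) (star_algebra H \<theta>) \<and>
     (\<forall>n. algebra_bimodule formal_scalars
        (A0_algebra H (alpha n \<theta>)) (A0_algebra H \<theta>) (E_module H n)
        (star H (alpha n \<theta>)) (star H \<theta>)) \<and>
     (\<forall>j k.
        (\<exists>!\<mu>. \<mu> \<in> tensor_maps (tensor2 (E_module H j) (E_module H k)) (E_module H (j + k))
                    (\<lambda>(a, b). star H \<theta> a b)) \<and>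
        (\<forall>\<mu> \<in> tensor_maps (tensor2 (E_module H j) (E_module H k)) (E_module H (j + k))
                 (\<lambda>(a, b). star H \<theta> a b).
           \<exists>!\<mu>'. \<mu>' \<in> series_linear_maps (completed (E_tensor2 H \<theta> j k)) (E_module H (j + k)) \<and>
             (\<forall>x \<in> carrier (completed (tensor2 (E_module H j) (E_module H k))).
                \<mu>' (tensor_projection (E_tensor2 H \<theta> j k) x) = \<mu> x))) \<and>
     (\<forall>m n p \<theta>'. \<theta>' = alpha n \<theta> \<longrightarrow>
        (let T = E_tensor3 H \<theta>' \<theta> m n p;
             U = E_tensor2 H \<theta>' m (n + p);
             V = E_tensor2 H \<theta> (m + n) p;
             W = E_module H (m + n + p);
             id_star = tensor_maps T (completed U) (\<lambda>(a, b, c). pure_tensor U (a, star H \<theta> b c));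
             star_U = tensor_maps U W (\<lambda>(a, b). star H \<theta>' a b);
             star_id = tensor_maps T (completed V) (\<lambda>(a, b, c). pure_tensor V (star H \<theta>' a b, c));
             star_V = tensor_maps V W (\<lambda>(a, b). star H \<theta> a b)
         in (\<exists>!f. f \<in> id_star) \<and> (\<exists>!g. g \<in> star_U) \<and> (\<exists>!f'. f' \<in> star_id) \<and> (\<exists>!g'. g' \<in> star_V) \<and>
            (\<forall>f \<in> id_star. \<forall>g \<in> star_U. \<forall>f' \<in> star_id. \<forall>g' \<in> star_V.
               \<forall>x \<in> carrier (completed T). g (f x) = g' (f' x))))"
proof -
  interpret heisenberg_module_algebra H by (rule assms(1))
  note \<theta> = assms(2)
  show ?thesis
    unfolding Let_def
    by (intro conjI allI impI ballI;
       ((rule A0_assoc_unital_subalgebra[OF \<theta>] E_bimodule[OF \<theta>]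
          tensor2_maps_ex1[OF E_module_module E_module_module E_module_adic star_series_bilinear[OF \<theta> refl]]
          E_tensor2_ex1[OF \<theta> refl])
        | (rule star_descends[OF \<theta>] id_star_ex1[OF \<theta>] star_id_ex1[OF \<theta>], assumption)
        | (rule E_tensor2_ex1[OF _ add.assoc], simp add: alpha_Theta[OF \<theta>])
        | (rule star_diagram_commutes[OF \<theta>], assumption+)))
qed

end
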